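(* Let $M$ be an $n$-dimensional ($n\ge 3$) oriented compact spin Riemannian manifold, let $p$ be a $(0,2)$-tensor on $M$, let $f_1,f_2$ be complex numbers, and let $\widetilde D=D+f_1P+f_2$ and $\widetilde D^*=D-\overline{f_1}P+\overline{f_2}$ be the Dirac-Witten operators, where $D$ is the Dirac operator and $P=\sum_{u<v}(p_{uv}-p_{vu})c(e_u)c(e_v)$. Let $s$ be the scalar curvature of $M$. Then \begin{align*} \widetilde D^*\widetilde D={}&-\Big[g^{ij}\big(\nabla_{\partial_i}\nabla_{\partial_j}-\nabla_{\nabla^L_{\partial_i}\partial_j}\big)\Big]+\frac14 s+(f_1\overline{f_2}-\overline{f_1}f_2)P\\ &+\frac14\sum_i\big[c(e_i)(f_1P+f_2)+(-\overline{f_1}P+\overline{f_2})c(e_i)\big]^2\\ &+\frac12\sum_j\big[c(e_j)\,e_j(f_1P+f_2)-e_j(-\overline{f_1}P+\overline{f_2})\,c(e_j)\big]-f_1\overline{f_1}P^2+f_2\overline{f_2}, \end{align*} and \begin{align*} \widetilde D^2={}&-\Big[g^{ij}\big(\nabla_{\partial_i}\nabla_{\partial_j}-\nabla_{\nabla^L_{\partial_i}\partial_j}\big)\Big]+\frac14 s+f_1^2P^2\\ &+\frac14\sum_i\big[c(e_i)(f_1P+f_2)+(f_1P+f_2)c(e_i)\big]^2\\ &-\frac12\sum_j\big[e_j(f_1P+f_2)\,c(e_j)-c(e_j)\,e_j(f_1P+f_2)\big]+2f_1f_2P+f_2^2 . \end{align*} Here, in each formula, $\nabla$ is the connection on the spinor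 bundle uniquely associated with the Laplace type operator on the left-hand side.
   Context: $\{e_1,\dots,e_n\}$ is a local orthonormal frame of $TM$; $c(e_i)$ is Clifford multiplication on the spinor bundle, with $c(e_i)c(e_j)+c(e_j)c(e_i)=-2\delta_{ij}$. $\nabla^L$ is the Levi-Civita connection of $g^M$ and $(\omega_{s,t})$ its connection matrix: $\nabla^L(e_1,\dots,e_n)=(e_1,\dots,e_n)(\omega_{s,t})$. The Dirac operator is $D=\sum_{i}c(e_i)\big[e_i-\frac14\sum_{s,t}\omega_{s,t}(e_i)c(e_s)c(e_t)\big]$. We write $p_{uv}=p(e_u,e_v)$. $\partial_i$ is a natural local (coordinate) frame on $TM$, $(g^{ij})$ is the inverse of the metric matrix $(g_{ij})$, and repeated indices $i,j$ in $g^{ij}(\cdots)$ are summed. A differential operator of Laplace type on a vector bundle $N$ is one which locally has the form $-(g^{ij}\partial_i\partial_j+A^i\partial_i+B)$ with $A^i,B$ smooth sections of $\mathrm{End}(N)$. For such an operator $L$ there are a unique connection $\nabla$ on $N$ and a unique endomorphism $E$ of $N$ with $L=-\big[g^{ij}(\nabla_{\partial_i}\nabla_{\partial_j}-\nabla_{\nabla^L_{\partial_i}\partial_j})+E\big]$. For $L=\widetilde D^*\widetilde D$ this connection is $\nabla_{\partial_i}=\partial_i+\sigma_i-\frac12\big[c(\partial_i)(f_1P+f_2)+(-\overline{f_1}P+\overline{f_2})c(\partial_i)\big]$, where $\partial_i+\sigma_i$ is the spin connection. For an endomorphism field $\Phi$ of the spinor bundle, $e_j(\Phi)$ denotes its (Levi-Civita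 induced) covariant derivative in the direction $e_j$; equivalently, at a point $x_0$, the derivative of $\Phi$ along $e_j$ in a normal frame centred at $x_0$. *)

theory Defs
  imports "HOL-Analysis.Analysis"
begin

text \<open>
  Spin manifolds are presented in the classical way, by local data indexed by a set of
  trivializations: an oriented atlas, the metric and a positively oriented orthonormal frame in
  each chart, and a lift of the \<open>SO(n)\<close>-valued transition functions of these frames to the spin
  group that satisfies the cocycle condition (the spin structure). The index set is arbitrary: any
  chart domain with any oriented orthonormal frame to which the spin structure lifts may be a
  member, so nothing is lost by working with the charts and frames of the presentation.

  Local fields are functions of the coordinates, that is, they live on the open subset
  \<open>chart X a ` chart_dom X a\<close> of \<open>real ^ 'n\<close>; vectors, covectors and tensors are given by their
  components in the coordinate frame, and spinors by their components in the trivialization.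
\<close>


section \<open>Calculus in coordinates\<close>

fun times_differentiable_on ::
    "nat \<Rightarrow> 'a::real_normed_vector set \<Rightarrow> ('a \<Rightarrow> 'b::real_normed_vector) \<Rightarrow> bool" where
  "times_differentiable_on 0 S f \<longleftrightarrow> continuous_on S f"
| "times_differentiable_on (Suc k) S f \<longleftrightarrow>
     (\<forall>y\<in>S. f differentiable (at y)) \<and>
     (\<forall>v. times_differentiable_on k S (\<lambda>y. frechet_derivative f (at y) v))"

text \<open>Only used for open sets \<open>S\<close>.\<close>

definition smooth_on ::
    "'a::real_normed_vector set \<Rightarrow> ('a \<Rightarrow> 'b::real_normed_vector) \<Rightarrow> bool" where
  "smooth_on S f \<longleftrightarrow> (\<forall>k. times_differentiable_on k S f)"

definition pd :: "'n::finite \<Rightarrow> (real ^ 'n \<Rightarrow> 'b::real_normed_vector) \<Rightarrow> real ^ 'n \<Rightarrow> 'b" where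
  "pd i f y = frechet_derivative f (at y) (axis i 1)"

definition cscale :: "complex \<Rightarrow> complex ^ 'k::finite ^ 'k \<Rightarrow> complex ^ 'k ^ 'k"  (infixr \<open>*\<^sub>c\<close> 75) where
  "z *\<^sub>c A = (\<chi> r c. z * A $ r $ c)"


section \<open>Spin manifolds\<close>

record ('a, 'm, 'n::finite, 'k::finite) spin_mfd =
  index :: "'a set"
  chart_dom :: "'a \<Rightarrow> 'm set"
  chart :: "'a \<Rightarrow> 'm \<Rightarrow> real ^ 'n"
  metric :: "'a \<Rightarrow> real ^ 'n \<Rightarrow> real ^ 'n ^ 'n"
  frame :: "'a \<Rightarrow> 'n \<Rightarrow> real ^ 'n \<Rightarrow> real ^ 'n"
  gamma :: "'n \<Rightarrow> complex ^ 'k ^ 'k"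
  lift :: "'a \<Rightarrow> 'a \<Rightarrow> 'm \<Rightarrow> complex ^ 'k ^ 'k"

definition point :: "('a, 'm, 'n::finite, 'k::finite) spin_mfd \<Rightarrow> 'a \<Rightarrow> real ^ 'n \<Rightarrow> 'm" where
  "point X a = inv_into (chart_dom X a) (chart X a)"

definition transition ::
    "('a, 'm, 'n::finite, 'k::finite) spin_mfd \<Rightarrow> 'a \<Rightarrow> 'a \<Rightarrow> real ^ 'n \<Rightarrow> real ^ 'n" where
  "transition X a b = (\<lambda>y. chart X b (point X a y))"

text \<open>\<open>jac X a b x $ j $ i\<close> is the derivative of the \<open>j\<close>-th coordinate of the chart \<open>b\<close> with respect
  to the \<open>i\<close>-th coordinate of the chart \<open>a\<close>, at the point \<open>x\<close>.\<close>

definition jac ::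
    "('a, 'm, 'n::finite, 'k::finite) spin_mfd \<Rightarrow> 'a \<Rightarrow> 'a \<Rightarrow> 'm \<Rightarrow> real ^ 'n ^ 'n" where
  "jac X a b x = jacobian (transition X a b) (at (chart X a x))"

definition oriented_atlas :: "('a, 'm::topological_space, 'n::finite, 'k::finite) spin_mfd \<Rightarrow> bool" where
  "oriented_atlas X \<longleftrightarrow>
     (\<Union>a\<in>index X. chart_dom X a) = UNIV \<and>
     (\<forall>a\<in>index X. open (chart_dom X a) \<and> open (chart X a ` chart_dom X a) \<and>
        homeomorphism (chart_dom X a) (chart X a ` chart_dom X a) (chart X a) (point X a)) \<and>
     (\<forall>a\<in>index X. \<forall>b\<in>index X.
        smooth_on (chart X a ` (chart_dom X a \<inter> chart_dom X b)) (transition X a b) \<and>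
        (\<forall>x\<in>chart_dom X a \<inter> chart_dom X b. det (jac X a b x) > 0))"

definition tensor02 ::
    "('a, 'm, 'n::finite, 'k::finite) spin_mfd \<Rightarrow> ('a \<Rightarrow> real ^ 'n \<Rightarrow> real ^ 'n ^ 'n) \<Rightarrow> bool" where
  "tensor02 X p \<longleftrightarrow>
     (\<forall>a\<in>index X. smooth_on (chart X a ` chart_dom X a) (p a)) \<and>
     (\<forall>a\<in>index X. \<forall>b\<in>index X. \<forall>x\<in>chart_dom X a \<inter> chart_dom X b.
        p a (chart X a x) = transpose (jac X a b x) ** p b (chart X b x) ** jac X a b x)"

definition riemannian_metric :: "('a, 'm, 'n::finite, 'k::finite) spin_mfd \<Rightarrow> bool" where
  "riemannian_metric X \<longleftrightarrow>
     tensor02 X (metric X) \<and>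
     (\<forall>a\<in>index X. \<forall>y\<in>chart X a ` chart_dom X a.
        transpose (metric X a y) = metric X a y \<and>
        (\<forall>v. v \<noteq> 0 \<longrightarrow> v \<bullet> (metric X a y *v v) > 0))"

definition oriented_orthonormal_frames :: "('a, 'm, 'n::finite, 'k::finite) spin_mfd \<Rightarrow> bool" where
  "oriented_orthonormal_frames X \<longleftrightarrow>
     (\<forall>a\<in>index X.
        (\<forall>s. smooth_on (chart X a ` chart_dom X a) (frame X a s)) \<and>
        (\<forall>y\<in>chart X a ` chart_dom X a.
           (\<forall>s t. frame X a s y \<bullet> (metric X a y *v frame X a t y) = (if s = t then 1 else 0)) \<and>
           det (\<chi> i s. frame X a s y $ i) > 0))"

text \<open>The spinor module: skew-Hermitian generators of the complex Clifford algebra acting on a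
  space of the dimension of the irreducible modules.\<close>

definition spinor_module :: "('n::finite \<Rightarrow> complex ^ 'k::finite ^ 'k) \<Rightarrow> bool" where
  "spinor_module c \<longleftrightarrow>
     CARD('k) = 2 ^ (CARD('n) div 2) \<and>
     (\<forall>i j. c i ** c j + c j ** c i = (if i = j then - mat 2 else 0)) \<and>
     (\<forall>i r s. c i $ r $ s = - cnj (c i $ s $ r))"

definition clifford_vector :: "('n::finite \<Rightarrow> complex ^ 'k::finite ^ 'k) \<Rightarrow> real ^ 'n \<Rightarrow> complex ^ 'k ^ 'k"
  where "clifford_vector c v = (\<Sum>i\<in>UNIV. v $ i *\<^sub>R c i)"

text \<open>The spin group (products of evenly many unit vectors) in the spinor representation, which
  is faithful on it.\<close>

inductive_set spin_group :: "('n::finite \<Rightarrow> complex ^ 'k::finite ^ 'k) \<Rightarrow> (complex ^ 'k ^ 'k) set"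
  for c :: "'n \<Rightarrow> complex ^ 'k ^ 'k" where
  one: "mat 1 \<in> spin_group c"
| step: "norm v = 1 \<Longrightarrow> norm w = 1 \<Longrightarrow> A \<in> spin_group c \<Longrightarrow>
    clifford_vector c v ** clifford_vector c w ** A \<in> spin_group c"

text \<open>Clifford multiplication by a tangent vector with components \<open>v\<close> in the coordinate frame.\<close>

definition clifford ::
    "('a, 'm, 'n::finite, 'k::finite) spin_mfd \<Rightarrow> 'a \<Rightarrow> real ^ 'n \<Rightarrow> real ^ 'n \<Rightarrow> complex ^ 'k ^ 'k" where
  "clifford X a y v = clifford_vector (gamma X) (\<chi> s. frame X a s y \<bullet> (metric X a y *v v))"

text \<open>The frame of \<open>b\<close> is obtained from the frame of \<open>a\<close> by an \<open>SO(n)\<close>-valued function on the overlap;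
  \<open>lift X a b\<close> lifts this function along the double cover \<open>A \<mapsto> (v \<mapsto> A v A\<inverse>)\<close>.\<close>

definition spin_structure :: "('a, 'm, 'n::finite, 'k::finite) spin_mfd \<Rightarrow> bool" where
  "spin_structure X \<longleftrightarrow>
     spinor_module (gamma X) \<and>
     (\<forall>a\<in>index X. \<forall>b\<in>index X.
        smooth_on (chart X a ` (chart_dom X a \<inter> chart_dom X b)) (\<lambda>y. lift X a b (point X a y)) \<and>
        (\<forall>x\<in>chart_dom X a \<inter> chart_dom X b.
           lift X a b x \<in> spin_group (gamma X) \<and>
           (\<forall>s. lift X a b x ** gamma X s =
                clifford X a (chart X a x) (jac X b a x *v frame X b s (chart X b x)) ** lift X a b x))) \<and>
     (\<forall>a\<in>index X. \<forall>b\<in>index X. \<forall>d\<in>index X. \<forall>x\<in>chart_dom X a \<inter> chart_dom X b \<inter> chart_dom X d.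
        lift X a b x ** lift X b d x = lift X a d x)"

definition compact_oriented_spin_manifold ::
    "('a, 'm::t2_space, 'n::finite, 'k::finite) spin_mfd \<Rightarrow> bool" where
  "compact_oriented_spin_manifold X \<longleftrightarrow>
     compact (UNIV :: 'm set) \<and> oriented_atlas X \<and> riemannian_metric X \<and>
     oriented_orthonormal_frames X \<and> spin_structure X"


section \<open>Levi-Civita connection and scalar curvature\<close>

definition inv_metric :: "('a, 'm, 'n::finite, 'k::finite) spin_mfd \<Rightarrow> 'a \<Rightarrow> real ^ 'n \<Rightarrow> real ^ 'n ^ 'n" where
  "inv_metric X a y = matrix_inv (metric X a y)"

text \<open>The upper index comes first: the covariant derivative of the \<open>j\<close>-th coordinate field in the
  direction of the \<open>i\<close>-th one is the sum over \<open>l\<close> of \<open>christoffel X a l i j\<close> times the \<open>l\<close>-th one.\<close>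

definition christoffel ::
    "('a, 'm, 'n::finite, 'k::finite) spin_mfd \<Rightarrow> 'a \<Rightarrow> 'n \<Rightarrow> 'n \<Rightarrow> 'n \<Rightarrow> real ^ 'n \<Rightarrow> real" where
  "christoffel X a l i j y = (1 / 2) * (\<Sum>m\<in>UNIV. inv_metric X a y $ l $ m *
     (pd i (\<lambda>z. metric X a z $ j $ m) y + pd j (\<lambda>z. metric X a z $ i $ m) y
        - pd m (\<lambda>z. metric X a z $ i $ j) y))"

text \<open>Covariant derivative of the vector field \<open>V\<close> in the direction \<open>v\<close>.\<close>

definition levi_civita ::
    "('a, 'm, 'n::finite, 'k::finite) spin_mfd \<Rightarrow> 'a \<Rightarrow> (real ^ 'n \<Rightarrow> real ^ 'n) \<Rightarrow> real ^ 'n \<Rightarrow> real ^ 'n \<Rightarrow> real ^ 'n"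
  where "levi_civita X a V y v = frechet_derivative V (at y) v +
     (\<chi> l. \<Sum>i\<in>UNIV. \<Sum>j\<in>UNIV. christoffel X a l i j y * v $ i * V y $ j)"

text \<open>The connection matrix: \<open>\<nabla> e\<^sub>t = (\<Sum>s. \<omega>\<^sub>s\<^sub>t e\<^sub>s)\<close>, so \<open>\<omega>\<^sub>s\<^sub>t\<close> is the
  inner product of \<open>e\<^sub>s\<close> with \<open>\<nabla> e\<^sub>t\<close>.\<close>

definition conn_form ::
    "('a, 'm, 'n::finite, 'k::finite) spin_mfd \<Rightarrow> 'a \<Rightarrow> 'n \<Rightarrow> 'n \<Rightarrow> real ^ 'n \<Rightarrow> real ^ 'n \<Rightarrow> real" where
  "conn_form X a s t y v = frame X a s y \<bullet> (metric X a y *v levi_civita X a (frame X a t) y v)"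

text \<open>\<open>riemann X a l k i j\<close> is the \<open>l\<close>-th component of \<open>R(\<partial>\<^sub>i, \<partial>\<^sub>j) \<partial>\<^sub>k\<close>; with the sign
  conventions below round spheres have positive scalar curvature.\<close>

definition riemann ::
    "('a, 'm, 'n::finite, 'k::finite) spin_mfd \<Rightarrow> 'a \<Rightarrow> 'n \<Rightarrow> 'n \<Rightarrow> 'n \<Rightarrow> 'n \<Rightarrow> real ^ 'n \<Rightarrow> real" where
  "riemann X a l k i j y =
     pd i (christoffel X a l j k) y - pd j (christoffel X a l i k) y +
     (\<Sum>m\<in>UNIV. christoffel X a l i m y * christoffel X a m j k y
              - christoffel X a l j m y * christoffel X a m i k y)"

definition ricci :: "('a, 'm, 'n::finite, 'k::finite) spin_mfd \<Rightarrow> 'a \<Rightarrow> 'n \<Rightarrow> 'n \<Rightarrow> real ^ 'n \<Rightarrow> real" where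
  "ricci X a j k y = (\<Sum>i\<in>UNIV. riemann X a i k i j y)"

definition scalar_curvature :: "('a, 'm, 'n::finite, 'k::finite) spin_mfd \<Rightarrow> 'a \<Rightarrow> real ^ 'n \<Rightarrow> real" where
  "scalar_curvature X a y = (\<Sum>j\<in>UNIV. \<Sum>k\<in>UNIV. inv_metric X a y $ j $ k * ricci X a j k y)"


section \<open>The spinor bundle\<close>

text \<open>A smooth spinor field over the open set \<open>W\<close> is a family of local representatives, one for each
  trivialization, related by the spin transition functions. Sections over all open sets are used,
  since the objects of interest (differential operators, coordinate derivatives) are local; global
  sections are the case \<open>W = UNIV\<close>.\<close>

definition spinor_section ::
    "('a, 'm::topological_space, 'n::finite, 'k::finite) spin_mfd \<Rightarrow> 'm set \<Rightarrow>
      ('a \<Rightarrow> real ^ 'n \<Rightarrow> complex ^ 'k) \<Rightarrow> bool" where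
  "spinor_section X W \<psi> \<longleftrightarrow>
     open W \<and>
     (\<forall>a\<in>index X. smooth_on (chart X a ` (chart_dom X a \<inter> W)) (\<psi> a)) \<and>
     (\<forall>a\<in>index X. \<forall>b\<in>index X. \<forall>x\<in>chart_dom X a \<inter> chart_dom X b \<inter> W.
        \<psi> a (chart X a x) = lift X a b x *v \<psi> b (chart X b x))"

definition spinor_endo ::
    "('a, 'm, 'n::finite, 'k::finite) spin_mfd \<Rightarrow> ('a \<Rightarrow> real ^ 'n \<Rightarrow> complex ^ 'k ^ 'k) \<Rightarrow> bool" where
  "spinor_endo X E \<longleftrightarrow>
     (\<forall>a\<in>index X. smooth_on (chart X a ` chart_dom X a) (E a)) \<and>
     (\<forall>a\<in>index X. \<forall>b\<in>index X. \<forall>x\<in>chart_dom X a \<inter> chart_dom X b.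
        E a (chart X a x) ** lift X a b x = lift X a b x ** E b (chart X b x))"

text \<open>The covariant derivative \<open>\<partial>\<^sub>i + \<theta>\<^sub>i\<close> of a local spinor \<open>u\<close> in the trivialization \<open>a\<close>, for a
  family \<open>\<theta>\<close> of local connection forms.\<close>

definition cov ::
    "('a \<Rightarrow> 'n::finite \<Rightarrow> real ^ 'n \<Rightarrow> complex ^ 'k::finite ^ 'k) \<Rightarrow> 'a \<Rightarrow> 'n \<Rightarrow>
      (real ^ 'n \<Rightarrow> complex ^ 'k) \<Rightarrow> real ^ 'n \<Rightarrow> complex ^ 'k" where
  "cov \<theta> a i u y = pd i u y + \<theta> a i y *v u y"

text \<open>A connection on the spinor bundle is given by smooth local connection forms whose covariant
  derivatives agree on overlaps. Local forms take the dummy value \<open>0\<close> outside their domain, so that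
  connections are equal if and only if their representing functions are.\<close>

definition spinor_connection ::
    "('a, 'm::topological_space, 'n::finite, 'k::finite) spin_mfd \<Rightarrow>
      ('a \<Rightarrow> 'n \<Rightarrow> real ^ 'n \<Rightarrow> complex ^ 'k ^ 'k) \<Rightarrow> bool" where
  "spinor_connection X \<theta> \<longleftrightarrow>
     (\<forall>a i y. a \<notin> index X \<or> y \<notin> chart X a ` chart_dom X a \<longrightarrow> \<theta> a i y = 0) \<and>
     (\<forall>a\<in>index X. \<forall>i. smooth_on (chart X a ` chart_dom X a) (\<theta> a i)) \<and>
     (\<forall>W \<psi>. spinor_section X W \<psi> \<longrightarrow>
        (\<forall>a\<in>index X. \<forall>b\<in>index X. \<forall>x\<in>chart_dom X a \<inter> chart_dom X b \<inter> W. \<forall>i.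
           lift X a b x *v cov \<theta> b i (\<psi> b) (chart X b x) =
           (\<Sum>j\<in>UNIV. jac X b a x $ j $ i *\<^sub>R cov \<theta> a j (\<psi> a) (chart X a x))))"

text \<open>The operator \<open>g\<^sup>i\<^sup>j (\<nabla>\<^sub>i \<nabla>\<^sub>j - \<nabla>\<^sub>v)\<close>, where \<open>v\<close> is the Levi-Civita derivative of \<open>\<partial>\<^sub>j\<close> in the
  direction \<open>\<partial>\<^sub>i\<close>.\<close>

definition connection_laplacian ::
    "('a, 'm, 'n::finite, 'k::finite) spin_mfd \<Rightarrow>
      ('a \<Rightarrow> 'n \<Rightarrow> real ^ 'n \<Rightarrow> complex ^ 'k ^ 'k) \<Rightarrow>
      ('a \<Rightarrow> real ^ 'n \<Rightarrow> complex ^ 'k) \<Rightarrow> 'a \<Rightarrow> real ^ 'n \<Rightarrow> complex ^ 'k" where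
  "connection_laplacian X \<theta> \<psi> a y =
     (\<Sum>i\<in>UNIV. \<Sum>j\<in>UNIV. inv_metric X a y $ i $ j *\<^sub>R
        (cov \<theta> a i (cov \<theta> a j (\<psi> a)) y -
         (\<Sum>l\<in>UNIV. christoffel X a l i j y *\<^sub>R cov \<theta> a l (\<psi> a) y)))"

definition associated_connection ::
    "('a, 'm::topological_space, 'n::finite, 'k::finite) spin_mfd \<Rightarrow>
      (('a \<Rightarrow> real ^ 'n \<Rightarrow> complex ^ 'k) \<Rightarrow> 'a \<Rightarrow> real ^ 'n \<Rightarrow> complex ^ 'k) \<Rightarrow>
      ('a \<Rightarrow> 'n \<Rightarrow> real ^ 'n \<Rightarrow> complex ^ 'k ^ 'k) \<Rightarrow> bool" where
  "associated_connection X L \<theta> \<longleftrightarrow>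
     spinor_connection X \<theta> \<and>
     (\<exists>E. spinor_endo X E \<and>
        (\<forall>W \<psi>. spinor_section X W \<psi> \<longrightarrow>
           (\<forall>a\<in>index X. \<forall>y\<in>chart X a ` (chart_dom X a \<inter> W).
              L \<psi> a y = - (connection_laplacian X \<theta> \<psi> a y + E a y *v \<psi> a y))))"


section \<open>Dirac-Witten operators\<close>

definition spin_form ::
    "('a, 'm, 'n::finite, 'k::finite) spin_mfd \<Rightarrow> 'a \<Rightarrow> real ^ 'n \<Rightarrow> real ^ 'n \<Rightarrow> complex ^ 'k ^ 'k" where
  "spin_form X a y v =
     - ((1 / 4) *\<^sub>R (\<Sum>s\<in>UNIV. \<Sum>t\<in>UNIV. conn_form X a s t y v *\<^sub>R (gamma X s ** gamma X t)))"

definition dirac ::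
    "('a, 'm, 'n::finite, 'k::finite) spin_mfd \<Rightarrow> ('a \<Rightarrow> real ^ 'n \<Rightarrow> complex ^ 'k) \<Rightarrow>
      'a \<Rightarrow> real ^ 'n \<Rightarrow> complex ^ 'k" where
  "dirac X \<psi> a y = (\<Sum>i\<in>UNIV. gamma X i *v
     (frechet_derivative (\<psi> a) (at y) (frame X a i y) + spin_form X a y (frame X a i y) *v \<psi> a y))"

definition frame_comp ::
    "('a, 'm, 'n::finite, 'k::finite) spin_mfd \<Rightarrow> ('a \<Rightarrow> real ^ 'n \<Rightarrow> real ^ 'n ^ 'n) \<Rightarrow>
      'a \<Rightarrow> real ^ 'n \<Rightarrow> 'n \<Rightarrow> 'n \<Rightarrow> real" where
  "frame_comp X p a y u v = frame X a u y \<bullet> (p a y *v frame X a v y)"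

text \<open>The linear order on the index type \<open>'n\<close> only serves to state the summation range \<open>u < v\<close>.\<close>

definition witten_endo ::
    "('a, 'm, 'n::{finite,linorder}, 'k::finite) spin_mfd \<Rightarrow> ('a \<Rightarrow> real ^ 'n::{finite,linorder} \<Rightarrow> real ^ 'n::{finite,linorder} ^ 'n::{finite,linorder}) \<Rightarrow>
      'a \<Rightarrow> real ^ 'n::{finite,linorder} \<Rightarrow> complex ^ 'k ^ 'k" where
  "witten_endo X p a y = (\<Sum>(u, v) | u < v.
     (frame_comp X p a y u v - frame_comp X p a y v u) *\<^sub>R (gamma X u ** gamma X v))"

definition witten_pot ::
    "('a, 'm, 'n::{finite,linorder}, 'k::finite) spin_mfd \<Rightarrow> ('a \<Rightarrow> real ^ 'n::{finite,linorder} \<Rightarrow> real ^ 'n::{finite,linorder} ^ 'n::{finite,linorder}) \<Rightarrow>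
      complex \<Rightarrow> complex \<Rightarrow> 'a \<Rightarrow> real ^ 'n::{finite,linorder} \<Rightarrow> complex ^ 'k ^ 'k" where
  "witten_pot X p z w a y = z *\<^sub>c witten_endo X p a y + mat w"

definition dirac_witten ::
    "('a, 'm, 'n::{finite,linorder}, 'k::finite) spin_mfd \<Rightarrow> ('a \<Rightarrow> real ^ 'n::{finite,linorder} \<Rightarrow> real ^ 'n::{finite,linorder} ^ 'n::{finite,linorder}) \<Rightarrow>
      complex \<Rightarrow> complex \<Rightarrow> ('a \<Rightarrow> real ^ 'n::{finite,linorder} \<Rightarrow> complex ^ 'k) \<Rightarrow>
      'a \<Rightarrow> real ^ 'n::{finite,linorder} \<Rightarrow> complex ^ 'k" where
  "dirac_witten X p z w \<psi> a y = dirac X \<psi> a y + witten_pot X p z w a y *v \<psi> a y"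

text \<open>Covariant derivative of an endomorphism field in the frame direction \<open>e\<^sub>j\<close>, for the connection
  induced by the spin connection; the commutator vanishes at the centre of a normal frame.\<close>

definition endo_deriv ::
    "('a, 'm, 'n::finite, 'k::finite) spin_mfd \<Rightarrow> ('a \<Rightarrow> real ^ 'n \<Rightarrow> complex ^ 'k ^ 'k) \<Rightarrow>
      'n \<Rightarrow> 'a \<Rightarrow> real ^ 'n \<Rightarrow> complex ^ 'k ^ 'k" where
  "endo_deriv X \<Phi> j a y = frechet_derivative (\<Phi> a) (at y) (frame X a j y) +
     (spin_form X a y (frame X a j y) ** \<Phi> a y - \<Phi> a y ** spin_form X a y (frame X a j y))"

definition msq :: "complex ^ 'k::finite ^ 'k \<Rightarrow> complex ^ 'k ^ 'k" where
  "msq A = A ** A"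

end

theory Submission
  imports Defs
begin

text \<open>
  With the connection \<open>\<nabla>' = \<nabla> - (c \<Phi> + \<Psi> c) / 2\<close>, completing the square in \<open>(D + \<Psi>)(D + \<Phi>)\<close> for
  arbitrary endomorphism fields \<open>\<Phi>\<close>, \<open>\<Psi>\<close> reduces both formulas to the Lichnerowicz formula for the
  square of the Dirac operator; there the curvature of the spin connection is a bivector, hence
  determined by its commutators with Clifford multiplication, and the Bianchi identity contracts it
  to a quarter of the scalar curvature. That \<open>\<nabla>'\<close> is a global connection rests on the fact that a
  skew element of the real even Clifford algebra which commutes with Clifford multiplication
  vanishes: it makes the spin connection the only one compatible with the Levi-Civita connection,
  also after a change of chart and frame. The zeroth order term is natural because the operator
  and the Laplacian of \<open>\<nabla>'\<close> are, so naturality of the curvature is not needed. A section that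
  vanishes at a point and has prescribed first derivatives there shows that the operator
  determines the connection.
\<close>

section \<open>Directional derivatives\<close>

text \<open>The first-order term of (D + \<Psi>)(D + \<Phi>) is the sum over s of A_s \<nabla>_s
  with A_s = c_s \<Phi> + \<Psi> c_s. In the square of \<nabla>_s - A_s/2 the cross term occurs
  twice, so the half absorbs it exactly; A_s^2/4 and half the derivatives of \<Phi> and \<Psi>, with
  opposite signs, are left over. The classical computation takes place at the centre of a normal
  frame. Here each chart carries a given frame whose connection matrix need not vanish anywhere.
  Instead, second derivatives enter only as \<nabla>_v \<nabla>_w - \<nabla>_z with z = \<Gamma>(v,
  w), for constant coordinate vectors v, w. This is bilinear at each point, so its trace against
  g^ij equals the trace over any orthonormal basis, including the frame of another chart carried
  back by the transition map. The connection matrix terms from differentiating c_s and e_s cancel by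
  skewness. Constant vectors of one chart are variable fields in another. The extra first-order
  terms are absorbed by the transformation law of the Christoffel symbols, which comes from the
  uniqueness of a symmetric metric connection rather than from differentiating an inverse
  metric.\<close>

definition dd :: "'a \<Rightarrow> ('a::real_normed_vector \<Rightarrow> 'b::real_normed_vector) \<Rightarrow> 'a \<Rightarrow> 'b" where
  "dd v f y = frechet_derivative f (at y) v"

lemma pd_eq_dd: "pd i = dd (axis i 1)"
  by (simp add: fun_eq_iff pd_def dd_def)

lemma dd_has_derivative:
  "(f has_derivative f') (at y) \<Longrightarrow> dd v f y = f' v"
  unfolding dd_def by (metis frechet_derivative_at)

lemma has_derivative_dd:
  "f differentiable (at y) \<Longrightarrow> (f has_derivative (\<lambda>v. dd v f y)) (at y)"
  unfolding dd_def using frechet_derivative_works by auto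

lemma linear_dd: "f differentiable (at y) \<Longrightarrow> linear (\<lambda>v. dd v f y)"
  using has_derivative_dd has_derivative_linear by blast

text \<open>\<open>frechet_derivative\<close> is a choice among all derivatives. Both functions have
  the same ones at \<open>y\<close>, so the choices agree even where no derivative exists.\<close>

lemma dd_cong:
  assumes "open S" "y \<in> S" "\<And>z. z \<in> S \<Longrightarrow> f z = g z"
  shows "dd v f y = dd v g y"
proof -
  have "(f has_derivative f') (at y) \<longleftrightarrow> (g has_derivative f') (at y)" for f'
    using has_derivative_transform_within_open[of f f' y UNIV S g]
      has_derivative_transform_within_open[of g f' y UNIV S f] assms by auto
  then show ?thesis
    by (simp add: dd_def frechet_derivative_def)
qed

lemma differentiable_cong_open:
  assumes "f differentiable (at y)" "open S" "y \<in> S" "\<And>z. z \<in> S \<Longrightarrow> f z = g z"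
  shows "g differentiable (at y)"
  using assms has_derivative_transform_within_open unfolding differentiable_def by blast

lemma dd_const [simp]: "dd v (\<lambda>_. k) y = 0"
  by (rule dd_has_derivative) simp

lemma dd_add:
  assumes "f differentiable (at y)" "g differentiable (at y)"
  shows "dd v (\<lambda>z. f z + g z) y = dd v f y + dd v g y"
  by (rule dd_has_derivative) (intro has_derivative_add has_derivative_dd assms)

lemma dd_diff:
  assumes "f differentiable (at y)" "g differentiable (at y)"
  shows "dd v (\<lambda>z. f z - g z) y = dd v f y - dd v g y"
  by (rule dd_has_derivative) (intro has_derivative_diff has_derivative_dd assms)

lemma dd_sum:
  assumes "\<And>i. i \<in> I \<Longrightarrow> f i differentiable (at y)"
  shows "dd v (\<lambda>z. \<Sum>i\<in>I. f i z) y = (\<Sum>i\<in>I. dd v (f i) y)"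
  by (rule dd_has_derivative) (intro has_derivative_sum has_derivative_dd assms)

lemma dd_bounded_linear:
  assumes "bounded_linear h" "f differentiable (at y)"
  shows "dd v (\<lambda>z. h (f z)) y = h (dd v f y)"
  by (rule dd_has_derivative) (intro bounded_linear.has_derivative[OF assms(1)] has_derivative_dd assms)

lemma dd_bounded_bilinear:
  assumes "bounded_bilinear B" "f differentiable (at y)" "g differentiable (at y)"
  shows "dd v (\<lambda>z. B (f z) (g z)) y = B (f y) (dd v g y) + B (dd v f y) (g y)"
  by (rule dd_has_derivative) (intro bounded_bilinear.FDERIV[OF assms(1)] has_derivative_dd assms)

lemma differentiable_bounded_bilinear:
  assumes "bounded_bilinear B" "f differentiable (at y)" "g differentiable (at y)"
  shows "(\<lambda>z. B (f z) (g z)) differentiable (at y)"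
  using bounded_bilinear.FDERIV[OF assms(1)] assms(2,3) unfolding differentiable_def by blast

lemma differentiable_bounded_linear:
  assumes "bounded_linear h" "f differentiable (at y)"
  shows "(\<lambda>z. h (f z)) differentiable (at y)"
  using bounded_linear.has_derivative[OF assms(1)] assms(2) unfolding differentiable_def by blast

lemma dd_compose:
  assumes "g differentiable (at y)" "f differentiable (at (g y))"
  shows "dd v (\<lambda>z. f (g z)) y = dd (dd v g y) f (g y)"
  by (rule dd_has_derivative)
    (use has_derivative_compose[OF has_derivative_dd[OF assms(1)] has_derivative_dd[OF assms(2)]] in auto)

lemma differentiable_compose_at:
  assumes "g differentiable (at y)" "f differentiable (at (g y))"
  shows "(\<lambda>z. f (g z)) differentiable (at y)"
  using has_derivative_compose assms unfolding differentiable_def by blast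

lemma has_derivative_along_line:
  assumes "f differentiable (at (y + t *\<^sub>R v + u))"
  shows "((\<lambda>t. f (y + t *\<^sub>R v + u)) has_derivative (\<lambda>a. a *\<^sub>R dd v f (y + t *\<^sub>R v + u))) (at t)"
proof -
  have "((\<lambda>t. y + t *\<^sub>R v + u) has_derivative (\<lambda>a. a *\<^sub>R v)) (at t)"
    by (auto intro!: derivative_eq_intros)
  from has_derivative_compose[OF this has_derivative_dd[OF assms]] show ?thesis
    by (simp add: linear_cmul[OF linear_dd[OF assms]])
qed

text \<open>Difference quotients lie in the subspace, which is closed in a Euclidean space. This
  keeps derivatives of the lift in the even Clifford algebra and derivatives of the spin connection
  in the bivectors.\<close>

lemma dd_in_subspace:
  fixes f :: "'a::real_normed_vector \<Rightarrow> 'b::euclidean_space"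
  assumes "subspace V" "open S" "y \<in> S" "\<And>z. z \<in> S \<Longrightarrow> f z \<in> V" "f differentiable (at y)"
  shows "dd v f y \<in> V"
proof -
  have "(\<lambda>t. y + t *\<^sub>R v) \<midarrow>0\<rightarrow> y + 0 *\<^sub>R v" by (intro tendsto_intros)
  then have ev: "eventually (\<lambda>t::real. y + t *\<^sub>R v \<in> S) (at 0)"
    using topological_tendstoD[of "\<lambda>t. y + t *\<^sub>R v" y "at 0" S] assms(2,3) by simp
  have "((\<lambda>t. f (y + t *\<^sub>R v)) has_derivative (\<lambda>t. t *\<^sub>R dd v f y)) (at 0)"
    using has_derivative_along_line[of f y 0 v 0] assms(5) by simp
  then have "((\<lambda>t. norm (f (y + t *\<^sub>R v) - f y - t *\<^sub>R dd v f y) / norm t) \<longlongrightarrow> 0) (at 0)"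
    unfolding has_derivative_at by simp
  then have "((\<lambda>t. norm ((f (y + t *\<^sub>R v) - f y) /\<^sub>R t - dd v f y)) \<longlongrightarrow> 0) (at 0)"
  proof (rule Lim_transform_eventually)
    have "norm (f (y + t *\<^sub>R v) - f y - t *\<^sub>R dd v f y) / norm t
        = norm ((f (y + t *\<^sub>R v) - f y) /\<^sub>R t - dd v f y)" if "t \<noteq> 0" for t
    proof -
      have "(f (y + t *\<^sub>R v) - f y) /\<^sub>R t - dd v f y = (f (y + t *\<^sub>R v) - f y - t *\<^sub>R dd v f y) /\<^sub>R t"
        using that by (simp add: scaleR_diff_right)
      then show ?thesis by (simp add: divide_inverse mult.commute)
    qed
    then show "\<forall>\<^sub>F t in at 0. norm (f (y + t *\<^sub>R v) - f y - t *\<^sub>R dd v f y) / norm t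
        = norm ((f (y + t *\<^sub>R v) - f y) /\<^sub>R t - dd v f y)"
      unfolding eventually_at_filter by (intro always_eventually allI impI) blast
  qed
  then have "((\<lambda>t. (f (y + t *\<^sub>R v) - f y) /\<^sub>R t) \<longlongrightarrow> dd v f y) (at 0)"
    by (rule LIM_zero_cancel[OF tendsto_norm_zero_cancel])
  then show ?thesis
  proof (rule Lim_in_closed_set[OF closed_subspace[OF assms(1)], rotated -1])
    show "\<forall>\<^sub>F t in at 0. (f (y + t *\<^sub>R v) - f y) /\<^sub>R t \<in> V"
      using ev by (rule eventually_mono) (use assms in \<open>auto intro!: subspace_scale subspace_diff\<close>)
  qed simp
qed

text \<open>One half of Schwarz's theorem: the mean value theorem, applied along \<open>v\<close>
  and then along \<open>w\<close>, turns the second difference into h^2 times a nearby value of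
  \<open>dd w (dd v f)\<close>. The second difference is symmetric in the two directions, so the
  other order of derivation has to give the same limit.\<close>

lemma dd_swap_real:
  fixes f :: "'a::real_normed_vector \<Rightarrow> real"
  assumes "open S" "y \<in> S" "\<And>z. z \<in> S \<Longrightarrow> f differentiable (at z)"
    and dv: "\<And>z. z \<in> S \<Longrightarrow> dd v f differentiable (at z)"
    and c: "continuous_on S (dd w (dd v f))"
    and e: "e > 0"
  shows "\<exists>h0>0. \<forall>h. 0 < h \<and> h < h0 \<longrightarrow>
    \<bar>(f (y + h *\<^sub>R v + h *\<^sub>R w) - f (y + h *\<^sub>R v) - f (y + h *\<^sub>R w) + f y) - h\<^sup>2 * dd w (dd v f) y\<bar> \<le> h\<^sup>2 * e"
proof -
  have "isCont (dd w (dd v f)) y"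
    using c assms(1,2) by (simp add: continuous_on_eq_continuous_at)
  then obtain r1 where r1: "r1 > 0" "\<And>z. dist z y < r1 \<Longrightarrow> \<bar>dd w (dd v f) z - dd w (dd v f) y\<bar> < e"
    using e unfolding continuous_at_eps_delta dist_real_def by blast
  obtain r2 where r2: "r2 > 0" "ball y r2 \<subseteq> S" using assms(1,2) openE by blast
  define r where "r = min r1 r2"
  \<comment> \<open>The summand 1 keeps the denominator positive when both directions vanish and
    makes the distance bound strict.\<close>
  define h0 where "h0 = r / (norm v + norm w + 1)"
  have pos: "norm v + norm w + 1 > 0"
    using norm_ge_zero[of v] norm_ge_zero[of w] by linarith
  have "r > 0" using r1 r2 by (auto simp: r_def)
  then have "h0 > 0" using pos by (simp add: h0_def)
  have near: "dist (y + s *\<^sub>R v + t *\<^sub>R w) y < r" if "0 \<le> s" "s \<le> h" "0 \<le> t" "t \<le> h" "0 < h" "h < h0" for s t h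
  proof -
    have "norm (s *\<^sub>R v + t *\<^sub>R w) \<le> s * norm v + t * norm w"
      using norm_triangle_ineq[of "s *\<^sub>R v" "t *\<^sub>R w"] that by simp
    also have "\<dots> \<le> h * norm v + h * norm w" using that by (intro add_mono mult_right_mono) auto
    also have "\<dots> < h * (norm v + norm w + 1)" using that by (simp add: algebra_simps)
    also have "\<dots> < h0 * (norm v + norm w + 1)" using that pos by (intro mult_strict_right_mono) auto
    also have "\<dots> = r" unfolding h0_def using pos by simp
    finally show ?thesis by (simp add: dist_norm add.assoc)
  qed
  have inS: "z \<in> S" if "dist z y < r" for z using that r2 by (auto simp: r_def dist_commute subset_iff)
  have "\<bar>(f (y + h *\<^sub>R v + h *\<^sub>R w) - f (y + h *\<^sub>R v) - f (y + h *\<^sub>R w) + f y) - h\<^sup>2 * dd w (dd v f) y\<bar> \<le> h\<^sup>2 * e"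
    if h: "0 < h" "h < h0" for h
  proof -
    \<comment> \<open>The increment of \<open>f\<close> along \<open>h\<close> times
      \<open>w\<close>, as a function of the position along \<open>v\<close>; its own increment over
      [0, h] is the second difference.\<close>
    define G where "G s = f (y + s *\<^sub>R v + h *\<^sub>R w) - f (y + s *\<^sub>R v + 0 *\<^sub>R w)" for s
    have dG: "DERIV G s :> dd v f (y + s *\<^sub>R v + h *\<^sub>R w) - dd v f (y + s *\<^sub>R v + 0 *\<^sub>R w)" if "0 \<le> s" "s \<le> h" for s
    proof -
      have 1: "((\<lambda>s. f (y + s *\<^sub>R v + t *\<^sub>R w)) has_real_derivative dd v f (y + s *\<^sub>R v + t *\<^sub>R w)) (at s)"
        if "0 \<le> t" "t \<le> h" for t
      proof -
        have d: "f differentiable (at (y + s *\<^sub>R v + t *\<^sub>R w))"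
          using assms(3)[OF inS[OF near[of s h t]]] that \<open>0 \<le> s\<close> \<open>s \<le> h\<close> h by blast
        show ?thesis using has_derivative_along_line[OF d]
          by (simp add: has_field_derivative_def mult_commute_abs)
      qed
      show ?thesis unfolding G_def using h by (intro DERIV_diff 1) auto
    qed
    obtain s where s: "0 < s" "s < h" "G h - G 0 = h * (dd v f (y + s *\<^sub>R v + h *\<^sub>R w) - dd v f (y + s *\<^sub>R v + 0 *\<^sub>R w))"
      using MVT2[of 0 h G, OF h(1) dG] by auto
    have dH: "((\<lambda>t. dd v f (y + s *\<^sub>R v + t *\<^sub>R w)) has_real_derivative dd w (dd v f) (y + s *\<^sub>R v + t *\<^sub>R w)) (at t)"
      if "0 \<le> t" "t \<le> h" for t
    proof -
      have d: "dd v f differentiable (at (y + s *\<^sub>R v + t *\<^sub>R w))"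
        using dv[OF inS[OF near[of s h t]]] that s h by auto
      show ?thesis using has_derivative_along_line[of "dd v f" "y + s *\<^sub>R v" t w 0] d
        by (simp add: has_field_derivative_def mult_commute_abs)
    qed
    obtain t where t: "0 < t" "t < h"
      "dd v f (y + s *\<^sub>R v + h *\<^sub>R w) - dd v f (y + s *\<^sub>R v + 0 *\<^sub>R w) = h * dd w (dd v f) (y + s *\<^sub>R v + t *\<^sub>R w)"
      using MVT2[of 0 h "\<lambda>t. dd v f (y + s *\<^sub>R v + t *\<^sub>R w)", OF h(1) dH] by auto
    have "(f (y + h *\<^sub>R v + h *\<^sub>R w) - f (y + h *\<^sub>R v) - f (y + h *\<^sub>R w) + f y) = G h - G 0"
      by (simp add: G_def)
    also have "\<dots> = h\<^sup>2 * dd w (dd v f) (y + s *\<^sub>R v + t *\<^sub>R w)"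
      using s t by (simp add: power2_eq_square)
    finally have *: "(f (y + h *\<^sub>R v + h *\<^sub>R w) - f (y + h *\<^sub>R v) - f (y + h *\<^sub>R w) + f y) - h\<^sup>2 * dd w (dd v f) y
       = h\<^sup>2 * (dd w (dd v f) (y + s *\<^sub>R v + t *\<^sub>R w) - dd w (dd v f) y)" by (simp add: algebra_simps)
    have "dist (y + s *\<^sub>R v + t *\<^sub>R w) y < r1"
      using near[of s h t] s t h by (auto simp: r_def)
    from r1(2)[OF this] show ?thesis unfolding * by (simp add: abs_mult mult_left_mono less_imp_le)
  qed
  with \<open>h0 > 0\<close> show ?thesis by blast
qed


section \<open>Smooth maps\<close>

named_theorems smooth_intros

lemma times_differentiable_on_Suc_dd:
  "times_differentiable_on (Suc k) S f \<longleftrightarrow>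
    (\<forall>y\<in>S. f differentiable (at y)) \<and> (\<forall>v. times_differentiable_on k S (dd v f))"
  by (simp add: dd_def[abs_def])

lemmas times_differentiable_on_simps = times_differentiable_on.simps(1) times_differentiable_on_Suc_dd

declare times_differentiable_on.simps(2) [simp del]

lemma times_differentiable_on_mono:
  "times_differentiable_on (Suc k) S f \<Longrightarrow> times_differentiable_on k S f"
proof (induction k arbitrary: f)
  case 0
  then show ?case
    unfolding times_differentiable_on_simps
    by (blast intro: continuous_at_imp_continuous_on differentiable_imp_continuous_within)
next
  case (Suc k)
  have "times_differentiable_on k S (dd v f)" for v
    using Suc.prems times_differentiable_on_Suc_dd[of "Suc k" S f] by (blast intro: Suc.IH)
  then show ?case
    using Suc.prems times_differentiable_on_Suc_dd[of "Suc k" S f] times_differentiable_on_Suc_dd[of k S f]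
    by blast
qed

lemma times_differentiable_on_subset:
  "times_differentiable_on k S f \<Longrightarrow> T \<subseteq> S \<Longrightarrow> times_differentiable_on k T f"
  by (induction k arbitrary: f) (auto simp: times_differentiable_on_simps intro: continuous_on_subset)

lemma times_differentiable_on_cong:
  assumes "open S"
  shows "(\<And>z. z \<in> S \<Longrightarrow> f z = g z) \<Longrightarrow> times_differentiable_on k S f \<Longrightarrow> times_differentiable_on k S g"
proof (induction k arbitrary: f g)
  case 0
  then show ?case using continuous_on_cong[of S S f g] by simp
next
  case (Suc k)
  have "times_differentiable_on k S (dd v g)" for v
    by (rule Suc.IH[of "dd v f"]) (use Suc.prems in \<open>auto simp: times_differentiable_on_simps intro: dd_cong[OF assms]\<close>)
  moreover have "g differentiable (at y)" if "y \<in> S" for y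
    using differentiable_cong_open[OF _ assms that Suc.prems(1)] Suc.prems(2) that
    by (auto simp: times_differentiable_on_simps)
  ultimately show ?case by (simp add: times_differentiable_on_simps)
qed

lemma smooth_on_subset: "smooth_on S f \<Longrightarrow> T \<subseteq> S \<Longrightarrow> smooth_on T f"
  using times_differentiable_on_subset unfolding smooth_on_def by blast

lemma smooth_on_cong:
  "open S \<Longrightarrow> (\<And>z. z \<in> S \<Longrightarrow> f z = g z) \<Longrightarrow> smooth_on S f \<Longrightarrow> smooth_on S g"
  using times_differentiable_on_cong unfolding smooth_on_def by blast

lemma smooth_on_differentiable: "smooth_on S f \<Longrightarrow> y \<in> S \<Longrightarrow> f differentiable (at y)"
  unfolding smooth_on_def using times_differentiable_on_Suc_dd[of 0 S f] by blast

lemma smooth_on_continuous: "smooth_on S f \<Longrightarrow> continuous_on S f"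
  unfolding smooth_on_def using times_differentiable_on.simps(1) by blast

lemma smooth_on_dd [smooth_intros]: "smooth_on S f \<Longrightarrow> smooth_on S (dd v f)"
  unfolding smooth_on_def using times_differentiable_on_Suc_dd by blast

lemma smooth_on_pd [smooth_intros]: "smooth_on S f \<Longrightarrow> smooth_on S (pd i f)"
  unfolding pd_eq_dd by (rule smooth_on_dd)

lemma times_differentiable_on_const:
  fixes S :: "'a::real_normed_vector set"
  shows "times_differentiable_on k S (\<lambda>_. c)"
proof (induction k arbitrary: c)
  case (Suc k)
  have "dd v (\<lambda>_. c) = (\<lambda>_. 0)" for v :: 'a by (simp add: fun_eq_iff)
  then show ?case using Suc by (auto simp: times_differentiable_on_simps)
qed simp

lemma smooth_on_const [smooth_intros]: "smooth_on S (\<lambda>_. c)"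
  by (simp add: smooth_on_def times_differentiable_on_const)

lemma times_differentiable_on_add:
  assumes "open S"
  shows "times_differentiable_on k S f \<Longrightarrow> times_differentiable_on k S g \<Longrightarrow>
    times_differentiable_on k S (\<lambda>y. f y + g y)"
proof (induction k arbitrary: f g)
  case 0
  then show ?case by (auto intro: continuous_intros)
next
  case (Suc k)
  have "times_differentiable_on k S (dd v (\<lambda>y. f y + g y))" for v
    by (rule times_differentiable_on_cong[OF assms, of "\<lambda>y. dd v f y + dd v g y"])
      (use Suc in \<open>auto simp: times_differentiable_on_simps dd_add\<close>)
  with Suc.prems show ?case by (auto simp: times_differentiable_on_simps)
qed

lemma times_differentiable_on_bounded_linear:
  assumes "open S" "bounded_linear h"
  shows "times_differentiable_on k S f \<Longrightarrow> times_differentiable_on k S (\<lambda>y. h (f y))"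
proof (induction k arbitrary: f)
  case 0
  then show ?case by (auto intro: bounded_linear.continuous_on[OF assms(2)])
next
  case (Suc k)
  have "times_differentiable_on k S (dd v (\<lambda>y. h (f y)))" for v
    by (rule times_differentiable_on_cong[OF assms(1), of "\<lambda>y. h (dd v f y)"])
      (use Suc in \<open>auto simp: times_differentiable_on_simps dd_bounded_linear[OF assms(2)]\<close>)
  with Suc.prems show ?case
    by (auto simp: times_differentiable_on_simps intro: differentiable_bounded_linear[OF assms(2)])
qed

lemma times_differentiable_on_bounded_bilinear:
  assumes "open S" "bounded_bilinear B"
  shows "times_differentiable_on k S f \<Longrightarrow> times_differentiable_on k S g \<Longrightarrow>
    times_differentiable_on k S (\<lambda>y. B (f y) (g y))"
proof (induction k arbitrary: f g)
  case 0
  then show ?case by (auto intro: bounded_bilinear.continuous_on[OF assms(2)])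
next
  case (Suc k)
  \<comment> \<open>The Leibniz rule leaves one factor of each product underived; that factor is
    needed with one degree of differentiability less than assumed.\<close>
  have "times_differentiable_on k S (\<lambda>y. B (f y) (dd v g y) + B (dd v f y) (g y))" for v
    by (intro times_differentiable_on_add[OF assms(1)] Suc.IH Suc.prems[THEN times_differentiable_on_mono])
      (use Suc.prems in \<open>simp_all add: times_differentiable_on_Suc_dd[of k]\<close>)
  then have "times_differentiable_on k S (dd v (\<lambda>y. B (f y) (g y)))" for v
    by (rule times_differentiable_on_cong[OF assms(1), rotated])
      (use Suc.prems in \<open>auto simp: times_differentiable_on_simps dd_bounded_bilinear[OF assms(2)]\<close>)
  with Suc.prems show ?case
    by (auto simp: times_differentiable_on_simps intro: differentiable_bounded_bilinear[OF assms(2)])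
qed

lemma smooth_on_add [smooth_intros]:
  "open S \<Longrightarrow> smooth_on S f \<Longrightarrow> smooth_on S g \<Longrightarrow> smooth_on S (\<lambda>y. f y + g y)"
  by (simp add: smooth_on_def times_differentiable_on_add)

lemma smooth_on_bounded_linear:
  "bounded_linear h \<Longrightarrow> open S \<Longrightarrow> smooth_on S f \<Longrightarrow> smooth_on S (\<lambda>y. h (f y))"
  by (simp add: smooth_on_def times_differentiable_on_bounded_linear)

lemma smooth_on_bounded_bilinear:
  "bounded_bilinear B \<Longrightarrow> open S \<Longrightarrow> smooth_on S f \<Longrightarrow> smooth_on S g \<Longrightarrow> smooth_on S (\<lambda>y. B (f y) (g y))"
  by (simp add: smooth_on_def times_differentiable_on_bounded_bilinear)

lemmas smooth_on_minus [smooth_intros] = smooth_on_bounded_linear[OF bounded_linear_minus[OF bounded_linear_ident]]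

lemma smooth_on_diff [smooth_intros]:
  "open S \<Longrightarrow> smooth_on S f \<Longrightarrow> smooth_on S g \<Longrightarrow> smooth_on S (\<lambda>y. f y - g y)"
  using smooth_on_add[of S f "\<lambda>y. - g y"] smooth_on_minus[of S g] by simp

lemma smooth_on_sum [smooth_intros]:
  assumes "open S" "\<And>i. i \<in> I \<Longrightarrow> smooth_on S (f i)"
  shows "smooth_on S (\<lambda>y. \<Sum>i\<in>I. f i y)"
  using assms(2)
  by (induction I rule: infinite_finite_induct) (auto intro!: smooth_intros assms(1))

lemma bounded_linear_axis: "bounded_linear (axis i :: 'b::euclidean_space \<Rightarrow> 'b ^ 'n::finite)"
  by (intro linear_conv_bounded_linear[THEN iffD1] linearI) (auto simp: axis_def vec_eq_iff)

lemma smooth_on_vec_lambda [smooth_intros]: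
  fixes f :: "'n::finite \<Rightarrow> 'a::real_normed_vector \<Rightarrow> 'b::euclidean_space"
  assumes "open S" "\<And>i. smooth_on S (f i)"
  shows "smooth_on S (\<lambda>y. \<chi> i. f i y)"
proof -
  have "(\<lambda>y. \<chi> i. f i y) = (\<lambda>y. \<Sum>i\<in>UNIV. axis i (f i y))"
    by (auto simp: fun_eq_iff vec_eq_iff axis_def if_distrib sum.delta cong: if_cong)
  then show ?thesis
    by (auto intro!: smooth_on_sum smooth_on_bounded_linear[OF bounded_linear_axis] assms)
qed

lemmas smooth_on_vec_nth [smooth_intros] = smooth_on_bounded_linear[OF bounded_linear_vec_nth]
lemmas smooth_on_scaleR [smooth_intros] = smooth_on_bounded_bilinear[OF bounded_bilinear_scaleR]
lemmas smooth_on_inner [smooth_intros] = smooth_on_bounded_bilinear[OF bounded_bilinear_inner]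
lemmas smooth_on_mult [smooth_intros] = smooth_on_bounded_bilinear[OF bounded_bilinear_mult]

text \<open>Both orders of derivation approximate the same second difference and hence differ by at
  most \<open>2 * e\<close> for every positive \<open>e\<close>. Euclidean-valued maps are treated
  component by component.\<close>

lemma dd_swap:
  fixes f :: "'a::real_normed_vector \<Rightarrow> 'b::euclidean_space"
  assumes "open S" "smooth_on S f" "y \<in> S"
  shows "dd v (dd w f) y = dd w (dd v f) y"
proof -
  have real: "dd v (dd w h) y = dd w (dd v h) y" if h: "smooth_on S h" for h :: "'a \<Rightarrow> real"
  proof -
    let ?Q = "\<lambda>t v w. h (y + t *\<^sub>R v + t *\<^sub>R w) - h (y + t *\<^sub>R v) - h (y + t *\<^sub>R w) + h y"
    have "\<bar>dd v (dd w h) y - dd w (dd v h) y\<bar> \<le> 2 * e" if "e > 0" for e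
    proof -
      have *: "\<exists>h0>0. \<forall>t. 0 < t \<and> t < h0 \<longrightarrow> \<bar>?Q t v w - t\<^sup>2 * dd w (dd v h) y\<bar> \<le> t\<^sup>2 * e" for v w
        using h that assms(1,3)
        by (intro dd_swap_real[of S]) (auto intro: smooth_on_differentiable smooth_on_continuous smooth_intros)
      obtain h1 where h1: "h1 > 0" "\<And>t. 0 < t \<Longrightarrow> t < h1 \<Longrightarrow> \<bar>?Q t v w - t\<^sup>2 * dd w (dd v h) y\<bar> \<le> t\<^sup>2 * e"
        using *[of v w] by blast
      obtain h2 where h2: "h2 > 0" "\<And>t. 0 < t \<Longrightarrow> t < h2 \<Longrightarrow> \<bar>?Q t w v - t\<^sup>2 * dd v (dd w h) y\<bar> \<le> t\<^sup>2 * e"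
        using *[of w v] by blast
      define t where "t = min h1 h2 / 2"
      have t: "0 < t" "t < h1" "t < h2" using h1(1) h2(1) by (auto simp: t_def)
      have "?Q t v w = ?Q t w v" by (simp add: algebra_simps)
      then have "\<bar>t\<^sup>2 * dd v (dd w h) y - t\<^sup>2 * dd w (dd v h) y\<bar> \<le> t\<^sup>2 * e + t\<^sup>2 * e"
        using h1(2)[of t] h2(2)[of t] t by linarith
      then have "t\<^sup>2 * \<bar>dd v (dd w h) y - dd w (dd v h) y\<bar> \<le> t\<^sup>2 * (2 * e)"
        by (simp add: abs_mult mult_ac flip: right_diff_distrib)
      then show ?thesis using t(1) by simp
    qed
    note bound = this
    have "\<bar>dd v (dd w h) y - dd w (dd v h) y\<bar> \<le> 0 + e" if "e > 0" for e
      using bound[of "e / 2"] that by simp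
    then have "\<bar>dd v (dd w h) y - dd w (dd v h) y\<bar> \<le> 0"
      by (rule field_le_epsilon)
    then show ?thesis by simp
  qed
  show ?thesis
  proof (rule euclidean_eqI)
    fix b :: 'b
    have diff: "dd u f differentiable (at y)" for u
      using assms by (intro smooth_on_differentiable[of S] smooth_intros)
    have in1: "dd u (\<lambda>z. dd u' f z \<bullet> b) y = dd u (dd u' f) y \<bullet> b" for u u'
      by (rule dd_bounded_linear[OF bounded_linear_inner_left diff])
    have in2: "dd u (dd u' (\<lambda>z. f z \<bullet> b)) y = dd u (\<lambda>z. dd u' f z \<bullet> b) y" for u u'
      using assms
      by (intro dd_cong[OF assms(1,3)] dd_bounded_linear[OF bounded_linear_inner_left])
        (auto intro: smooth_on_differentiable)
    show "dd v (dd w f) y \<bullet> b = dd w (dd v f) y \<bullet> b"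
      using real[of "\<lambda>z. f z \<bullet> b"] assms smooth_on_bounded_linear[OF bounded_linear_inner_left, of S f b]
      by (simp add: in1 in2)
  qed
qed

section \<open>Matrix products as bounded bilinear maps\<close>

text \<open>The distributive laws, the Leibniz rule and the smoothness of matrix products below are
  all instances of general facts on bounded bilinear maps. The entry type covers real and complex
  matrices alike.\<close>

lemma bounded_bilinear_matrix_mult:
  "bounded_bilinear ((**) :: 'a::{euclidean_space,real_algebra_1} ^ 'n::finite ^ 'm::finite \<Rightarrow>
     'a ^ 'p::finite ^ 'n \<Rightarrow> 'a ^ 'p ^ 'm)"
  unfolding bilinear_conv_bounded_bilinear[symmetric] bilinear_def
  by (auto intro!: linearI simp: matrix_matrix_mult_def vec_eq_iff distrib_left distrib_right
      sum.distrib scaleR_sum_right)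

lemma bounded_bilinear_matrix_vector_mult:
  "bounded_bilinear ((*v) :: 'a::{euclidean_space,real_algebra_1} ^ 'n::finite ^ 'm::finite \<Rightarrow>
     'a ^ 'n \<Rightarrow> 'a ^ 'm)"
  unfolding bilinear_conv_bounded_bilinear[symmetric] bilinear_def
  by (auto intro!: linearI simp: matrix_vector_mult_def vec_eq_iff distrib_left distrib_right
      sum.distrib scaleR_sum_right)

lemmas matrix_mult_distribs =
  bounded_bilinear.add_left[OF bounded_bilinear_matrix_mult]
  bounded_bilinear.add_right[OF bounded_bilinear_matrix_mult]
  bounded_bilinear.diff_left[OF bounded_bilinear_matrix_mult]
  bounded_bilinear.diff_right[OF bounded_bilinear_matrix_mult]
  bounded_bilinear.minus_left[OF bounded_bilinear_matrix_mult]
  bounded_bilinear.minus_right[OF bounded_bilinear_matrix_mult]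
  bounded_bilinear.scaleR_left[OF bounded_bilinear_matrix_mult]
  bounded_bilinear.scaleR_right[OF bounded_bilinear_matrix_mult]

lemmas matrix_mult_sums =
  bounded_bilinear.sum_left[OF bounded_bilinear_matrix_mult]
  bounded_bilinear.sum_right[OF bounded_bilinear_matrix_mult]

lemmas matrix_mult_zeros =
  bounded_bilinear.zero_left[OF bounded_bilinear_matrix_mult]
  bounded_bilinear.zero_right[OF bounded_bilinear_matrix_mult]

lemmas matrix_vector_distribs =
  bounded_bilinear.add_left[OF bounded_bilinear_matrix_vector_mult]
  bounded_bilinear.add_right[OF bounded_bilinear_matrix_vector_mult]
  bounded_bilinear.diff_left[OF bounded_bilinear_matrix_vector_mult]
  bounded_bilinear.diff_right[OF bounded_bilinear_matrix_vector_mult]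
  bounded_bilinear.minus_left[OF bounded_bilinear_matrix_vector_mult]
  bounded_bilinear.minus_right[OF bounded_bilinear_matrix_vector_mult]
  bounded_bilinear.scaleR_left[OF bounded_bilinear_matrix_vector_mult]
  bounded_bilinear.scaleR_right[OF bounded_bilinear_matrix_vector_mult]

lemmas matrix_vector_sums =
  bounded_bilinear.sum_left[OF bounded_bilinear_matrix_vector_mult]
  bounded_bilinear.sum_right[OF bounded_bilinear_matrix_vector_mult]

lemmas smooth_on_matrix_mult [smooth_intros] = smooth_on_bounded_bilinear[OF bounded_bilinear_matrix_mult]
lemmas smooth_on_matrix_vector_mult [smooth_intros] =
  smooth_on_bounded_bilinear[OF bounded_bilinear_matrix_vector_mult]

lemmas dd_matrix_mult = dd_bounded_bilinear[OF bounded_bilinear_matrix_mult]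
lemmas dd_matrix_vector_mult = dd_bounded_bilinear[OF bounded_bilinear_matrix_vector_mult]
lemmas dd_scaleR = dd_bounded_bilinear[OF bounded_bilinear_scaleR]

lemmas differentiable_matrix_mult = differentiable_bounded_bilinear[OF bounded_bilinear_matrix_mult]
lemmas differentiable_matrix_vector_mult = differentiable_bounded_bilinear[OF bounded_bilinear_matrix_vector_mult]
lemmas differentiable_scaleR_fun = differentiable_bounded_bilinear[OF bounded_bilinear_scaleR]

lemma bounded_linear_cscale: "bounded_linear ((*\<^sub>c) z)"
  by (intro linear_conv_bounded_linear[THEN iffD1] linearI)
    (simp_all add: cscale_def vec_eq_iff algebra_simps)

lemmas smooth_on_cscale [smooth_intros] = smooth_on_bounded_linear[OF bounded_linear_cscale]

section \<open>The Hermitian adjoint and the real inner product of complex matrices\<close>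

definition adj :: "complex ^ 'k::finite ^ 'k \<Rightarrow> complex ^ 'k ^ 'k" where
  "adj A = (\<chi> r s. cnj (A $ s $ r))"

lemma bounded_linear_adj: "bounded_linear adj"
  by (intro linear_conv_bounded_linear[THEN iffD1] linearI) (simp_all add: adj_def vec_eq_iff)

lemma adj_mult: "adj (A ** B) = adj B ** adj A"
  by (simp add: adj_def matrix_matrix_mult_def vec_eq_iff mult.commute)

lemma adj_mat_1 [simp]: "adj (mat 1) = mat 1"
  by (simp add: adj_def mat_def vec_eq_iff)

lemma adj_adj [simp]: "adj (adj A) = A"
  by (simp add: adj_def vec_eq_iff)

lemmas linear_adj = bounded_linear.linear[OF bounded_linear_adj]

lemma subspace_skew_adj: "subspace {A. adj A = - A}"
  by (simp add: subspace_def linear_0[OF linear_adj] linear_add[OF linear_adj] linear_scale[OF linear_adj])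

text \<open>The inner product that complex matrices carry as a real Euclidean space is the real part
  of the trace of X times the adjoint of Y, so the adjoint of a left multiplication is the left
  multiplication by the adjoint matrix.\<close>

lemma inner_mult_left: "(A ** X) \<bullet> Y = X \<bullet> (adj A ** Y)" for A X Y :: "complex ^ 'k::finite ^ 'k"
proof -
  have "(A ** X) \<bullet> Y = (\<Sum>r\<in>UNIV. \<Sum>s\<in>UNIV. \<Sum>t\<in>UNIV. (A $ r $ t * X $ t $ s) \<bullet> Y $ r $ s)"
    by (simp add: inner_vec_def matrix_matrix_mult_def inner_sum_left)
  also have "\<dots> = (\<Sum>t\<in>UNIV. \<Sum>s\<in>UNIV. \<Sum>r\<in>UNIV. (A $ r $ t * X $ t $ s) \<bullet> Y $ r $ s)"
    by (subst sum.swap, subst (2) sum.swap, subst sum.swap) (rule refl)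
  also have "\<dots> = X \<bullet> (adj A ** Y)"
    by (simp add: inner_vec_def matrix_matrix_mult_def inner_sum_right adj_def inner_complex_def sum_distrib_left
        algebra_simps flip: sum.distrib sum_subtractf)
  finally show ?thesis .
qed

lemma inner_adj: "adj X \<bullet> adj Y = X \<bullet> Y"
  by (simp add: inner_vec_def adj_def inner_complex_def) (rule sum.swap)

lemma inner_mult_right: "(X ** A) \<bullet> Y = X \<bullet> (Y ** adj A)" for A X Y :: "complex ^ 'k::finite ^ 'k"
  using inner_mult_left[of "adj A" "adj X" "adj Y"] inner_adj[of "X ** A" Y] inner_adj[of X "Y ** adj A"]
  by (simp add: adj_mult)

section \<open>The Clifford algebra of the spinor module\<close>

locale clifford_module =
  fixes c :: "'n::finite \<Rightarrow> complex ^ 'k::finite ^ 'k"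
  assumes module: "spinor_module c"
begin

lemma c_anticomm: "c i ** c j + c j ** c i = (if i = j then - mat 2 else 0)"
  using module by (simp add: spinor_module_def)

lemma mat_2: "mat 2 = 2 *\<^sub>R (mat 1 :: complex ^ 'k ^ 'k)"
  by (simp add: mat_def vec_eq_iff scaleR_conv_of_real)

lemma c_square: "c i ** c i = - mat 1"
proof -
  have "2 *\<^sub>R (c i ** c i) = 2 *\<^sub>R (- mat 1)"
    using c_anticomm[of i i] by (simp add: mat_2 scaleR_2)
  then show ?thesis by (simp only: scaleR_cancel_left) simp
qed

lemma c_swap: "i \<noteq> j \<Longrightarrow> c i ** c j = - (c j ** c i)"
  using c_anticomm[of i j] by (simp add: eq_neg_iff_add_eq_0)

lemma c_square_mult: "c i ** (c i ** A) = - A"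
  by (simp add: matrix_mul_assoc c_square matrix_mult_distribs)

lemma c_swap_mult: "i \<noteq> j \<Longrightarrow> c i ** (c j ** A) = - (c j ** (c i ** A))"
  by (simp add: matrix_mul_assoc c_swap[of i j] matrix_mult_distribs)

lemma adj_c: "adj (c i) = - c i"
proof -
  have "c i $ r $ s = - cnj (c i $ s $ r)" for r s
    using module unfolding spinor_module_def by blast
  note skew = this
  have "adj (c i) $ r $ s = (- c i) $ r $ s" for r s
    using skew[of r s] by (simp add: adj_def)
  then show ?thesis by (simp add: vec_eq_iff)
qed

lemma adj_c_c: "adj (c i ** c j) = c j ** c i"
  by (simp add: adj_mult adj_c matrix_mult_distribs)

text \<open>Adding and subtracting \<open>c u ** c s ** c v\<close> turns the commutator into two
  anticommutators. Products of two generators thus act on vectors as infinitesimal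
  rotations.\<close>

lemma c_c_commutator:
  "c u ** c v ** c s - c s ** c u ** c v = (if s = u then 2 *\<^sub>R c v else 0) - (if s = v then 2 *\<^sub>R c u else 0)"
proof -
  have "c u ** c v ** c s - c s ** c u ** c v = c u ** (c v ** c s + c s ** c v) - (c u ** c s + c s ** c u) ** c v"
    by (simp add: matrix_mult_distribs matrix_mul_assoc)
  also have "\<dots> = (if s = u then 2 *\<^sub>R c v else 0) - (if s = v then 2 *\<^sub>R c u else 0)"
    by (auto simp: c_anticomm mat_2 matrix_mult_distribs matrix_mult_zeros)
  finally show ?thesis .
qed

section \<open>Words in the generators and the real even Clifford algebra\<close>

definition word :: "'n list \<Rightarrow> complex ^ 'k ^ 'k" where
  "word xs = foldr (\<lambda>i A. c i ** A) xs (mat 1)"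

lemma word_simps [simp]: "word [] = mat 1" "word (i # xs) = c i ** word xs"
  by (simp_all add: word_def)

lemma word_append: "word (xs @ ys) = word xs ** word ys"
  by (induction xs) (simp_all add: matrix_mul_assoc)

lemma c_word: "i \<notin> set xs \<Longrightarrow> c i ** word xs = (- 1) ^ length xs *\<^sub>R (word xs ** c i)"
proof (induction xs)
  case (Cons j xs)
  then have "c i ** word (j # xs) = - (c j ** (c i ** word xs))"
    by (simp add: c_swap_mult)
  also have "\<dots> = (- 1) ^ length (j # xs) *\<^sub>R (word (j # xs) ** c i)"
    using Cons by (simp add: matrix_mult_distribs matrix_mul_assoc)
  finally show ?case .
qed simp

text \<open>A repeated generator can be moved next to its other occurrence, where the pair cancels
  up to sign. Two letters disappear each time, so the parity of the length survives.\<close>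

lemma word_distinct:
  "\<exists>ys. distinct ys \<and> (even (length ys) \<longleftrightarrow> even (length xs)) \<and> (word xs = word ys \<or> word xs = - word ys)"
proof (induction xs)
  case (Cons i xs)
  then obtain ys where ys: "distinct ys" "even (length ys) \<longleftrightarrow> even (length xs)" "word xs = word ys \<or> word xs = - word ys"
    by blast
  show ?case
  proof (cases "i \<in> set ys")
    case False
    with ys show ?thesis by (intro exI[of _ "i # ys"]) (auto simp: matrix_mult_distribs)
  next
    case True
    then obtain as bs where ab: "ys = as @ i # bs" by (meson split_list)
    with ys have "i \<notin> set as" by simp
    then have "c i ** word ys = ((- 1) ^ length as *\<^sub>R word as) ** (c i ** (c i ** word bs))"
      by (simp add: ab word_append matrix_mul_assoc c_word matrix_mult_distribs)
    then have "c i ** word ys = word (as @ bs) \<or> c i ** word ys = - word (as @ bs)"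
      by (auto simp: c_square_mult word_append matrix_mult_distribs uminus_power_if)
    with ys ab show ?thesis by (intro exI[of _ "as @ bs"]) (auto simp: matrix_mult_distribs)
  qed
qed (intro exI[of _ "[]"], simp)

text \<open>Moving the first generator in from the right, past the tail of the word, costs one sign
  for each letter of the tail, and the tail has odd length.\<close>

lemma word_anticomm:
  assumes "distinct ys" "even (length ys)" "ys \<noteq> []"
  shows "c (hd ys) ** word ys = - (word ys ** c (hd ys))"
proof -
  obtain i bs where ys: "ys = i # bs" using assms(3) by (cases ys) auto
  have "word ys ** c i = c i ** (word bs ** c i)" by (simp add: ys matrix_mul_assoc)
  also have "\<dots> = - (c i ** (c i ** word bs))"
    using assms c_word[of i bs] by (simp add: ys matrix_mult_distribs)
  finally show ?thesis by (simp add: ys)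
qed

text \<open>The span is over the reals. In the complex span the imaginary unit times the identity
  would be central and skew, and the vanishing criterion \<open>even_central_skew_eq_0\<close> would
  fail.\<close>

definition even_part :: "(complex ^ 'k ^ 'k) set" where
  "even_part = span {word xs | xs. even (length xs)}"

lemma subspace_even_part: "subspace even_part"
  by (simp add: even_part_def)

lemma word_in_even_part: "even (length xs) \<Longrightarrow> word xs \<in> even_part"
  unfolding even_part_def by (rule span_base) blast

lemma mult_in_even_part:
  assumes "A \<in> even_part" "B \<in> even_part" shows "A ** B \<in> even_part"
proof -
  have *: "word xs ** B \<in> even_part" if "even (length xs)" for xs
    using assms(2)[unfolded even_part_def]
  proof (induction B rule: span_induct)
    case (step B)
    then show ?case using that by (auto simp: word_append[symmetric] intro!: word_in_even_part simp del: word_simps)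
  qed (use subspace_even_part in \<open>auto simp: subspace_def matrix_mult_distribs matrix_mult_zeros\<close>)
  from assms(1)[unfolded even_part_def] show ?thesis
  proof (induction A rule: span_induct)
    case (step A)
    then show ?case using * by auto
  qed (use subspace_even_part in \<open>auto simp: subspace_def matrix_mult_distribs matrix_mult_zeros\<close>)
qed

lemma c_c_in_even_part: "c i ** c j \<in> even_part"
  using word_in_even_part[of "[i, j]"] by simp

lemma clifford_vector_c: "clifford_vector c v = (\<Sum>i\<in>UNIV. v $ i *\<^sub>R c i)"
  by (simp add: clifford_vector_def)

lemma clifford_vectors_in_even_part: "clifford_vector c v ** clifford_vector c w \<in> even_part"
  unfolding clifford_vector_c
  by (subst matrix_mult_sums(1),
      subst matrix_mult_sums(2))
    (intro subspace_sum subspace_even_part, simp add: matrix_mult_distribs subspace_scale subspace_even_part c_c_in_even_part)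

lemma spin_group_even_part: "A \<in> spin_group c \<Longrightarrow> A \<in> even_part"
proof (induction rule: spin_group.induct)
  case one
  then show ?case using word_in_even_part[of "[]"] by simp
next
  case (step v w A)
  then show ?case by (simp add: mult_in_even_part clifford_vectors_in_even_part)
qed

lemma clifford_vector_square: "clifford_vector c v ** clifford_vector c v = - ((norm v)\<^sup>2 *\<^sub>R mat 1)"
proof -
  let ?Q = "clifford_vector c v ** clifford_vector c v"
  have Q: "?Q = (\<Sum>i\<in>UNIV. \<Sum>j\<in>UNIV. (v $ i * v $ j) *\<^sub>R (c i ** c j))"
    by (subst sum.swap) (simp add: clifford_vector_c matrix_mult_sums matrix_mult_distribs scaleR_sum_right mult.commute)
  also have "\<dots> = (\<Sum>i\<in>UNIV. \<Sum>j\<in>UNIV. (v $ i * v $ j) *\<^sub>R (c j ** c i))"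
    by (rule trans[OF sum.swap]) (simp add: mult.commute)
  finally have "?Q + ?Q = (\<Sum>i\<in>UNIV. \<Sum>j\<in>UNIV. (v $ i * v $ j) *\<^sub>R (c i ** c j + c j ** c i))"
    using Q by (simp add: scaleR_add_right sum.distrib)
  also have "\<dots> = (\<Sum>i\<in>UNIV. (v $ i * v $ i) *\<^sub>R (- mat 2))"
    by (simp add: c_anticomm if_distrib sum.delta cong: if_cong)
  also have "\<dots> = - (2 *\<^sub>R ((norm v)\<^sup>2 *\<^sub>R mat 1))"
    by (simp add: norm_vec_def L2_set_def sum_nonneg mat_2 scaleR_sum_left[symmetric] power2_eq_square sum_negf
        sum_distrib_left mult_ac)
  finally have "2 *\<^sub>R ?Q = 2 *\<^sub>R (- ((norm v)\<^sup>2 *\<^sub>R mat 1))"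
    by (simp add: scaleR_2)
  then show ?thesis by (simp only: scaleR_cancel_left) simp
qed

lemma adj_clifford_vector: "adj (clifford_vector c v) = - clifford_vector c v"
proof -
  have "clifford_vector c v \<in> {A. adj A = - A}"
    unfolding clifford_vector_c
    by (intro subspace_sum[OF subspace_skew_adj] subspace_scale[OF subspace_skew_adj]) (simp add: adj_c)
  then show ?thesis by simp
qed

text \<open>Taking adjoints reverses an even product of vectors and the signs cancel in pairs. As
  elements of the spin group are unitary, this says that their inverses are even as well.\<close>

lemma spin_group_adj_even_part: "A \<in> spin_group c \<Longrightarrow> adj A \<in> even_part"
proof (induction rule: spin_group.induct)
  case one
  then show ?case using word_in_even_part[of "[]"] by simp
next
  case (step v w A)
  then have "adj A ** (clifford_vector c w ** clifford_vector c v) \<in> even_part"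
    by (intro mult_in_even_part clifford_vectors_in_even_part)
  then show ?case
    by (simp add: adj_mult adj_clifford_vector matrix_mult_distribs)
qed

lemma spin_group_unitary: "A \<in> spin_group c \<Longrightarrow> A ** adj A = mat 1"
proof (induction rule: spin_group.induct)
  case (step v w A)
  have 1: "clifford_vector c u ** (B ** adj B) ** adj (clifford_vector c u) = mat 1"
    if "norm u = 1" "B ** adj B = mat 1" for u B
    using that by (simp add: adj_clifford_vector matrix_mult_distribs clifford_vector_square)
  have "(clifford_vector c w ** A) ** adj (clifford_vector c w ** A) = mat 1"
    using 1[OF step(2) step(4)] by (simp add: adj_mult matrix_mul_assoc)
  from 1[OF step(1) this] show ?case
    by (simp add: adj_mult matrix_mul_assoc)
qed simp

text \<open>Elements of the real even Clifford algebra are determined by their real inner products with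
  the words; a word that is not \<open>\<plusminus>1\<close> anticommutes with some generator and is therefore orthogonal
  to everything central. This replaces Schur's lemma and fixes the scalar part at the same time.\<close>

lemma even_central_skew_eq_0:
  assumes "A \<in> even_part" and comm: "\<And>i. c i ** A = A ** c i" and skew: "adj A = - A"
  shows "A = 0"
proof -
  have one: "A \<bullet> mat 1 = 0"
    using inner_adj[of A "mat 1"] by (simp add: skew)
  \<comment> \<open>\<open>c i\<close> is unitary, so multiplying both arguments by it on the same
    side preserves inner products. Passing from the left to the right fixes \<open>A\<close> and
    negates \<open>w\<close>, so the product equals its own negative.\<close>
  have anti: "A \<bullet> w = 0" if "c i ** w = - (w ** c i)" for i w
  proof -
    have "(c i ** A) \<bullet> (c i ** w) = A \<bullet> w"
      by (simp add: inner_mult_left adj_c matrix_mult_distribs c_square_mult)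
    moreover have "(A ** c i) \<bullet> (w ** c i) = A \<bullet> w"
      by (simp add: inner_mult_right adj_c matrix_mult_distribs c_square flip: matrix_mul_assoc)
    ultimately show ?thesis using comm[of i] that by simp
  qed
  have "A \<bullet> word xs = 0" if ev: "even (length xs)" for xs
  proof -
    obtain ys where ys: "distinct ys" "even (length ys)" "word xs = word ys \<or> word xs = - word ys"
      using word_distinct[of xs] ev by auto
    have "A \<bullet> word ys = 0"
      using one anti[OF word_anticomm[OF ys(1,2)]] by (cases "ys = []") auto
    with ys(3) show ?thesis by auto
  qed
  note words = this
  have "A \<bullet> B = 0" if "B \<in> even_part" for B
    using that[unfolded even_part_def]
    by (induction B rule: span_induct) (auto simp: subspace_def inner_add_right words)
  from this[OF assms(1)] show ?thesis by simp
qed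

section \<open>Bivectors: the Lie algebra of the spin group\<close>

definition bivectors :: "(complex ^ 'k ^ 'k) set" where
  "bivectors = span {c s ** c t - c t ** c s | s t. True}"

lemma subspace_bivectors: "subspace bivectors"
  by (simp add: bivectors_def)

lemma bivectors_even_part: "A \<in> bivectors \<Longrightarrow> A \<in> even_part"
  unfolding bivectors_def
  by (induction A rule: span_induct)
    (use subspace_even_part in \<open>auto simp: subspace_def intro!: subspace_diff c_c_in_even_part\<close>)

lemma bivectors_skew: "A \<in> bivectors \<Longrightarrow> adj A = - A"
  unfolding bivectors_def
proof (induction A rule: span_induct)
  case base
  then show ?case using subspace_skew_adj by simp
next
  case (step A)
  then show ?case
    by (auto simp: adj_c_c linear_diff[OF linear_adj])
qed

text \<open>Skewness allows each product to be replaced by half a commutator. In particular the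
  diagonal terms, which would be scalars and not bivectors, have coefficient zero.\<close>

lemma skew_sum_in_bivectors:
  assumes "\<And>s t. w s t = - w t s"
  shows "(\<Sum>s\<in>UNIV. \<Sum>t\<in>UNIV. w s t *\<^sub>R (c s ** c t)) \<in> bivectors"
proof -
  have "(\<Sum>s\<in>UNIV. \<Sum>t\<in>UNIV. w s t *\<^sub>R (c s ** c t)) = (\<Sum>s\<in>UNIV. \<Sum>t\<in>UNIV. w t s *\<^sub>R (c t ** c s))"
    by (rule sum.swap)
  also have "\<dots> = - (\<Sum>s\<in>UNIV. \<Sum>t\<in>UNIV. w s t *\<^sub>R (c t ** c s))"
    by (subst assms) (simp add: sum_negf)
  finally have "(\<Sum>s\<in>UNIV. \<Sum>t\<in>UNIV. w s t *\<^sub>R (c s ** c t)) =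
      (1 / 2) *\<^sub>R (\<Sum>s\<in>UNIV. \<Sum>t\<in>UNIV. w s t *\<^sub>R (c s ** c t - c t ** c s))"
    by (simp add: scaleR_diff_right sum_subtractf flip: scaleR_2)
  also have "\<dots> \<in> bivectors"
    by (intro subspace_scale subspace_sum subspace_bivectors) (auto simp: bivectors_def intro: span_base)
  finally show ?thesis .
qed

text \<open>The derivative of the double cover of the rotation group. The factor -4 is the reason
  for the factor -1/4 in \<open>spin_form\<close>.\<close>

lemma skew_sum_commutator:
  assumes "\<And>s t. w s t = - w t s"
  shows "(\<Sum>s\<in>UNIV. \<Sum>t\<in>UNIV. w s t *\<^sub>R (c s ** c t)) ** c u - c u ** (\<Sum>s\<in>UNIV. \<Sum>t\<in>UNIV. w s t *\<^sub>R (c s ** c t))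
    = - (4 *\<^sub>R (\<Sum>s\<in>UNIV. w s u *\<^sub>R c s))"
proof -
  have "(\<Sum>s\<in>UNIV. \<Sum>t\<in>UNIV. w s t *\<^sub>R (c s ** c t)) ** c u - c u ** (\<Sum>s\<in>UNIV. \<Sum>t\<in>UNIV. w s t *\<^sub>R (c s ** c t))
    = (\<Sum>s\<in>UNIV. \<Sum>t\<in>UNIV. w s t *\<^sub>R (c s ** c t ** c u - c u ** c s ** c t))"
    by (simp add: matrix_mult_sums matrix_mult_distribs scaleR_diff_right sum_subtractf matrix_mul_assoc)
  also have "\<dots> = (\<Sum>s\<in>UNIV. \<Sum>t\<in>UNIV. (if u = s then (2 * w s t) *\<^sub>R c t else 0)) - (\<Sum>s\<in>UNIV. \<Sum>t\<in>UNIV. (if u = t then (2 * w s t) *\<^sub>R c s else 0))"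
    unfolding c_c_commutator sum_subtractf[symmetric]
    by (intro sum.cong refl) (auto simp: scaleR_diff_right)
  also have "\<dots> = (\<Sum>t\<in>UNIV. (2 * w u t) *\<^sub>R c t) - (\<Sum>s\<in>UNIV. (2 * w s u) *\<^sub>R c s)"
    by (subst sum.swap) (simp add: sum.delta')
  also have "\<dots> = (\<Sum>s\<in>UNIV. (2 * w u s - 2 * w s u) *\<^sub>R c s)"
    by (simp add: sum_subtractf scaleR_left_diff_distrib)
  also have "\<dots> = (\<Sum>s\<in>UNIV. - (4 *\<^sub>R w s u *\<^sub>R c s))"
    by (intro sum.cong refl) (simp add: assms[of u] flip: scaleR_minus_left)
  also have "\<dots> = - (4 *\<^sub>R (\<Sum>s\<in>UNIV. w s u *\<^sub>R c s))"
    by (simp add: sum_negf scaleR_sum_right)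
  finally show ?thesis .
qed

lemma bivectors_commutator_c:
  assumes "A \<in> bivectors" shows "A ** c s - c s ** A \<in> span (range c)"
  using assms unfolding bivectors_def
proof (induction A rule: span_induct)
  case base
  have *: "(A + B) ** c s - c s ** (A + B) = (A ** c s - c s ** A) + (B ** c s - c s ** B)" for A B
    by (simp add: matrix_mult_distribs)
  have "(r *\<^sub>R A) ** c s - c s ** (r *\<^sub>R A) = r *\<^sub>R (A ** c s - c s ** A)" for A r
    by (simp add: matrix_mult_distribs scaleR_diff_right)
  with * show ?case
    by (simp add: subspace_def matrix_mult_zeros span_zero span_add span_scale)
next
  case (step A)
  then obtain u v where A: "A = c u ** c v - c v ** c u" by blast
  have "A ** c s - c s ** A = (c u ** c v ** c s - c s ** c u ** c v) - (c v ** c u ** c s - c s ** c v ** c u)"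
    by (simp add: A matrix_mult_distribs matrix_mul_assoc)
  then show ?case
    by (simp add: c_c_commutator span_diff span_zero span_scale span_base)
qed

text \<open>The commutator with \<open>A\<close> is a derivation that maps generators to vectors.
  Applied to \<open>c u ** c v - c v ** c u\<close> it therefore yields commutators of vectors with
  generators, which are bivectors again.\<close>

lemma bivectors_commutator:
  assumes "A \<in> bivectors" "B \<in> bivectors" shows "A ** B - B ** A \<in> bivectors"
  using assms(2) unfolding bivectors_def
proof (induction B rule: span_induct)
  case base
  have *: "A ** (B + C) - (B + C) ** A = (A ** B - B ** A) + (A ** C - C ** A)" for B C
    by (simp add: matrix_mult_distribs)
  have "A ** (r *\<^sub>R B) - (r *\<^sub>R B) ** A = r *\<^sub>R (A ** B - B ** A)" for B r
    by (simp add: matrix_mult_distribs scaleR_diff_right)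
  with * show ?case
    by (simp add: subspace_def matrix_mult_zeros span_zero span_add span_scale)
next
  case (step B)
  then obtain u v where B: "B = c u ** c v - c v ** c u" by blast
  have *: "w ** c t - c t ** w \<in> bivectors" if "w \<in> span (range c)" for w t
    using that
  proof (induction w rule: span_induct)
    case base
    have *: "(A + B) ** c t - c t ** (A + B) = (A ** c t - c t ** A) + (B ** c t - c t ** B)" for A B
      by (simp add: matrix_mult_distribs)
    have "(r *\<^sub>R A) ** c t - c t ** (r *\<^sub>R A) = r *\<^sub>R (A ** c t - c t ** A)" for A r
      by (simp add: matrix_mult_distribs scaleR_diff_right)
    with * show ?case
      by (simp add: bivectors_def subspace_def matrix_mult_zeros span_zero span_add span_scale)
  next
    case (step w)
    then show ?case by (auto simp: bivectors_def intro: span_base)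
  qed
  have "A ** B - B ** A = ((A ** c u - c u ** A) ** c v - c v ** (A ** c u - c u ** A))
     - ((A ** c v - c v ** A) ** c u - c u ** (A ** c v - c v ** A))"
    by (simp add: B matrix_mult_distribs matrix_mul_assoc)
  then show ?case
    using *[OF bivectors_commutator_c[OF assms(1)]] subspace_diff[OF subspace_bivectors]
    by (simp add: bivectors_def)
qed

text \<open>A bivector is recovered from its action on vectors. This is how the spin curvature is
  read off from the Riemann tensor, without differentiating the connection matrix.\<close>

lemma bivectors_contract:
  assumes "A \<in> bivectors" shows "(\<Sum>s\<in>UNIV. c s ** (A ** c s - c s ** A)) = 4 *\<^sub>R A"
  using assms unfolding bivectors_def
proof (induction A rule: span_induct)
  case base
  define K where "K A = (\<Sum>s\<in>UNIV. c s ** (A ** c s - c s ** A))" for A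
  have "linear K"
  proof (rule linearI)
    show "K (A + B) = K A + K B" for A B
      unfolding K_def sum.distrib[symmetric] by (intro sum.cong refl) (simp add: matrix_mult_distribs)
    show "K (r *\<^sub>R A) = r *\<^sub>R K A" for A r
      unfolding K_def scaleR_sum_right
      by (intro sum.cong refl) (simp add: matrix_mult_distribs scaleR_diff_right)
  qed
  then have "subspace {A. K A - 4 *\<^sub>R A = 0}"
    by (intro linear_subspace_kernel linear_compose_sub linear_scale_self)
  then show ?case by (simp add: K_def)
next
  case (step A)
  then obtain u v where A: "A = c u ** c v - c v ** c u" by blast
  have com: "A ** c s - c s ** A = (if s = u then 4 *\<^sub>R c v else 0) - (if s = v then 4 *\<^sub>R c u else 0)" for s
  proof -
    have "A ** c s - c s ** A = (c u ** c v ** c s - c s ** c u ** c v) - (c v ** c u ** c s - c s ** c v ** c u)"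
      by (simp add: A matrix_mult_distribs matrix_mul_assoc)
    moreover have "2 *\<^sub>R B + 2 *\<^sub>R B = 4 *\<^sub>R B" for B :: "complex ^ 'k ^ 'k"
      using scaleR_left_distrib[of 2 2 B] by simp
    ultimately show ?thesis unfolding c_c_commutator
      by (cases "s = u"; cases "s = v") (simp_all add: algebra_simps)
  qed
  have "(\<Sum>s\<in>UNIV. c s ** (A ** c s - c s ** A)) =
     (\<Sum>s\<in>UNIV. if s = u then 4 *\<^sub>R (c u ** c v) else 0) - (\<Sum>s\<in>UNIV. if s = v then 4 *\<^sub>R (c v ** c u) else 0)"
    unfolding com sum_subtractf[symmetric]
    by (intro sum.cong refl) (auto simp: matrix_mult_distribs matrix_mult_zeros)
  then show ?case by (simp add: A scaleR_diff_right)
qed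

end

section \<open>Clifford contractions of tensors with the symmetries of the Riemann tensor\<close>

context clifford_module begin

text \<open>Renaming the indices cyclically and bringing the generators back to their original order
  changes the sum only by traces, while the three cyclic versions of the coefficients cancel. Hence
  three times the left-hand side is a sum of traces, each of which is -2 times the contraction on
  the right.\<close>

lemma bianchi_contract:
  fixes f :: "'n \<Rightarrow> 'n \<Rightarrow> 'n \<Rightarrow> real"
  assumes skew: "\<And>l i j. f l i j = - f l j i"
    and bianchi: "\<And>l i j. f l i j + f i j l + f j l i = 0"
  shows "(\<Sum>l\<in>UNIV. \<Sum>i\<in>UNIV. \<Sum>j\<in>UNIV. f l i j *\<^sub>R (c i ** c j ** c l)) =
    - (2 *\<^sub>R (\<Sum>i\<in>UNIV. \<Sum>j\<in>UNIV. f j i j *\<^sub>R c i))" (is "?X = - (2 *\<^sub>R ?R)")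
proof -
  let ?S = "\<lambda>h. \<Sum>l\<in>UNIV. \<Sum>i\<in>UNIV. \<Sum>j\<in>UNIV. (h l i j :: complex ^ 'k ^ 'k)"
  \<comment> \<open>Cyclic renaming of the three summation indices.\<close>
  have rot: "?S h = ?S (\<lambda>l i j. h i j l)" for h
    by (subst sum.swap) (intro sum.cong refl sum.swap)
  have X2: "?X = ?S (\<lambda>l i j. f i j l *\<^sub>R (c j ** c l ** c i))"
    by (rule rot)
  also have "\<dots> = ?S (\<lambda>l i j. f i j l *\<^sub>R (c i ** c j ** c l)) +
      ?S (\<lambda>l i j. f i j l *\<^sub>R ((if i = j then 2 *\<^sub>R c l else 0) - (if i = l then 2 *\<^sub>R c j else 0)))"
    unfolding sum.distrib[symmetric] scaleR_add_right[symmetric]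
    by (intro sum.cong refl arg_cong2[of _ _ _ _ "(*\<^sub>R)"]) (simp flip: c_c_commutator)
  also have "?S (\<lambda>l i j. f i j l *\<^sub>R ((if i = j then 2 *\<^sub>R c l else 0) - (if i = l then 2 *\<^sub>R c j else 0))) =
      ?S (\<lambda>l i j. (if i = j then (2 * f i j l) *\<^sub>R c l else 0)) - ?S (\<lambda>l i j. (if i = l then (2 * f i j l) *\<^sub>R c j else 0))"
    unfolding sum_subtractf[symmetric] by (intro sum.cong refl) (simp add: scaleR_diff_right)
  also have "?S (\<lambda>l i j. (if i = j then (2 * f i j l) *\<^sub>R c l else 0)) = (\<Sum>l\<in>UNIV. \<Sum>i\<in>UNIV. (2 * f i i l) *\<^sub>R c l)"
    by (simp add: sum.delta)
  also have "?S (\<lambda>l i j. (if i = l then (2 * f i j l) *\<^sub>R c j else 0)) = (\<Sum>l\<in>UNIV. \<Sum>j\<in>UNIV. (2 * f l j l) *\<^sub>R c j)"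
    by (rule sum.cong[OF refl], rule trans[OF sum.swap]) (simp add: sum.delta)
  finally have X2': "?X = ?S (\<lambda>l i j. f i j l *\<^sub>R (c i ** c j ** c l)) +
     ((\<Sum>l\<in>UNIV. \<Sum>i\<in>UNIV. (2 * f i i l) *\<^sub>R c l) - (\<Sum>l\<in>UNIV. \<Sum>j\<in>UNIV. (2 * f l j l) *\<^sub>R c j))" .
  have X3: "?X = ?S (\<lambda>l i j. f j l i *\<^sub>R (c l ** c i ** c j))"
    using rot[of "\<lambda>l i j. f j l i *\<^sub>R (c l ** c i ** c j)"] by simp
  also have "\<dots> = ?S (\<lambda>l i j. f j l i *\<^sub>R (c i ** c j ** c l)) -
      ?S (\<lambda>l i j. f j l i *\<^sub>R ((if l = i then 2 *\<^sub>R c j else 0) - (if l = j then 2 *\<^sub>R c i else 0)))"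
    unfolding sum_subtractf[symmetric] scaleR_diff_right[symmetric]
    by (intro sum.cong refl arg_cong2[of _ _ _ _ "(*\<^sub>R)"]) (simp flip: c_c_commutator)
  also have "?S (\<lambda>l i j. f j l i *\<^sub>R ((if l = i then 2 *\<^sub>R c j else 0) - (if l = j then 2 *\<^sub>R c i else 0))) =
      ?S (\<lambda>l i j. (if l = i then (2 * f j l i) *\<^sub>R c j else 0)) - ?S (\<lambda>l i j. (if l = j then (2 * f j l i) *\<^sub>R c i else 0))"
    unfolding sum_subtractf[symmetric] by (intro sum.cong refl) (simp add: scaleR_diff_right)
  also have "?S (\<lambda>l i j. (if l = i then (2 * f j l i) *\<^sub>R c j else 0)) = 0"
  proof -
    have "f j l l = 0" for j l using skew[of j l l] by simp
    then show ?thesis by (intro sum.neutral ballI) auto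
  qed
  also have "?S (\<lambda>l i j. (if l = j then (2 * f j l i) *\<^sub>R c i else 0)) = (\<Sum>l\<in>UNIV. \<Sum>i\<in>UNIV. (2 * f l l i) *\<^sub>R c i)"
    by (simp add: sum.delta)
  finally have X3': "?X = ?S (\<lambda>l i j. f j l i *\<^sub>R (c i ** c j ** c l)) + (\<Sum>l\<in>UNIV. \<Sum>i\<in>UNIV. (2 * f l l i) *\<^sub>R c i)"
    by simp
  \<comment> \<open>The Bianchi identity, now that all three sums carry the generators in the same
    order.\<close>
  have "?X + ?S (\<lambda>l i j. f i j l *\<^sub>R (c i ** c j ** c l)) + ?S (\<lambda>l i j. f j l i *\<^sub>R (c i ** c j ** c l)) = 0"
    unfolding sum.distrib[symmetric] scaleR_left_distrib[symmetric] by (simp add: bianchi)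
  moreover have "x + x + x = d + p" if "x + b + e = 0" "x = b + d" "x = e + p" for x b d e p :: "complex ^ 'k ^ 'k"
  proof -
    have "x + x + x = x + (b + d) + (e + p)" using that(2,3) by simp
    also have "\<dots> = (x + b + e) + (d + p)" by (simp add: add_ac)
    finally show ?thesis using that(1) by simp
  qed
  ultimately have "?X + ?X + ?X = ((\<Sum>l\<in>UNIV. \<Sum>i\<in>UNIV. (2 * f i i l) *\<^sub>R c l) - (\<Sum>l\<in>UNIV. \<Sum>j\<in>UNIV. (2 * f l j l) *\<^sub>R c j))
     + (\<Sum>l\<in>UNIV. \<Sum>i\<in>UNIV. (2 * f l l i) *\<^sub>R c i)"
    using X2' X3' by blast
  also have "(\<Sum>l\<in>UNIV. \<Sum>i\<in>UNIV. (2 * f i i l) *\<^sub>R c l) = - (2 *\<^sub>R ?R)"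
    by (subst skew) (simp add: sum_negf scaleR_sum_right)
  also have "(\<Sum>l\<in>UNIV. \<Sum>j\<in>UNIV. (2 * f l j l) *\<^sub>R c j) = 2 *\<^sub>R ?R"
    by (subst sum.swap) (simp add: scaleR_sum_right)
  also have "(\<Sum>l\<in>UNIV. \<Sum>i\<in>UNIV. (2 * f l l i) *\<^sub>R c i) = - (2 *\<^sub>R ?R)"
    by (subst sum.swap, subst skew) (simp add: sum_negf scaleR_sum_right)
  also have "- (2 *\<^sub>R ?R) - 2 *\<^sub>R ?R + - (2 *\<^sub>R ?R) = - (2 *\<^sub>R ?R) + - (2 *\<^sub>R ?R) + - (2 *\<^sub>R ?R)"
    by (simp only: diff_conv_add_uminus)
  finally have "?X + ?X + ?X = - (2 *\<^sub>R ?R) + - (2 *\<^sub>R ?R) + - (2 *\<^sub>R ?R)" .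
  moreover have "x + x + x = 3 *\<^sub>R x" for x :: "complex ^ 'k ^ 'k"
    using scaleR_left_distrib[of 1 1 x] scaleR_left_distrib[of 2 1 x] by simp
  ultimately have "3 *\<^sub>R ?X = 3 *\<^sub>R (- (2 *\<^sub>R ?R))"
    by (simp only:)
  then show ?thesis by (simp only: scaleR_cancel_left) simp
qed

text \<open>The classical octahedron argument: a combination of four Bianchi identities in which the
  two skew symmetries cancel all other terms.\<close>

lemma pair_symmetry:
  fixes r :: "'b \<Rightarrow> 'b \<Rightarrow> 'b \<Rightarrow> 'b \<Rightarrow> real"
  assumes "\<And>k l i j. r k l i j = - r l k i j" "\<And>k l i j. r k l i j = - r k l j i"
    and "\<And>k l i j. r k l i j + r k i j l + r k j l i = 0"
  shows "r k l i j = r i j k l"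
proof -
  have flip: "r b a d c = r a b c d" for a b c d
    using assms(1)[of b a d c] assms(2)[of a b d c] by simp
  show ?thesis
    using assms(3)[of k l i j] assms(3)[of l k j i] assms(3)[of i j k l] assms(3)[of j i l k]
      flip[of k l i j] flip[of j l k i] flip[of k i j l] flip[of l i k j] flip[of i j k l] flip[of k j l i]
    by linarith
qed

text \<open>Contracting three of the four generators with the Bianchi identity leaves the Ricci-type
  contraction \<open>\<rho>\<close> against a product of two generators. Pair symmetry makes
  \<open>\<rho>\<close> symmetric, so only the anticommutator of these two counts, and that is a
  trace.\<close>

lemma lichnerowicz_algebra:
  fixes r :: "'n \<Rightarrow> 'n \<Rightarrow> 'n \<Rightarrow> 'n \<Rightarrow> real"
  assumes skew1: "\<And>k l i j. r k l i j = - r l k i j" and skew2: "\<And>k l i j. r k l i j = - r k l j i"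
    and bianchi: "\<And>k l i j. r k l i j + r k i j l + r k j l i = 0"
  shows "(\<Sum>i\<in>UNIV. \<Sum>j\<in>UNIV. c i ** c j ** (\<Sum>k\<in>UNIV. \<Sum>l\<in>UNIV. r k l i j *\<^sub>R (c k ** c l))) =
    - (2 *\<^sub>R ((\<Sum>i\<in>UNIV. \<Sum>j\<in>UNIV. r i j i j) *\<^sub>R mat 1))" (is "?T = - (2 *\<^sub>R (?s *\<^sub>R mat 1))")
proof -
  define X where "X k = (\<Sum>l\<in>UNIV. \<Sum>i\<in>UNIV. \<Sum>j\<in>UNIV. r k l i j *\<^sub>R (c i ** c j ** c l))" for k
  define \<rho> where "\<rho> k i = (\<Sum>j\<in>UNIV. r k j i j)" for k i
  have X: "X k = - (2 *\<^sub>R (\<Sum>i\<in>UNIV. \<rho> k i *\<^sub>R c i))" for k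
    unfolding X_def \<rho>_def scaleR_sum_left by (rule bianchi_contract) (rule skew2 bianchi)+
  have \<rho>_sym: "\<rho> k i = \<rho> i k" for k i
  proof -
    have "r k j i j = r i j k j" for j
      by (rule pair_symmetry[of r, OF skew1 skew2 bianchi])
    then show ?thesis by (simp add: \<rho>_def)
  qed
  have "?T = (\<Sum>i\<in>UNIV. \<Sum>j\<in>UNIV. \<Sum>k\<in>UNIV. \<Sum>l\<in>UNIV. r k l i j *\<^sub>R (c i ** c j ** c k ** c l))"
    by (simp add: matrix_mult_sums matrix_mult_distribs matrix_mul_assoc)
  also have "\<dots> = (\<Sum>i\<in>UNIV. \<Sum>j\<in>UNIV. \<Sum>l\<in>UNIV. \<Sum>k\<in>UNIV. r k l i j *\<^sub>R (c i ** c j ** c k ** c l))"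
    by (intro sum.cong refl sum.swap)
  \<comment> \<open>Skewness in the first pair exchanges the last two generators, so that the triple
    required by \<open>bianchi_contract\<close> stands on the left.\<close>
  also have "\<dots> = - (\<Sum>i\<in>UNIV. \<Sum>j\<in>UNIV. \<Sum>k\<in>UNIV. \<Sum>l\<in>UNIV. r k l i j *\<^sub>R (c i ** c j ** c l ** c k))"
    by (subst skew1) (simp add: sum_negf)
  also have "(\<Sum>i\<in>UNIV. \<Sum>j\<in>UNIV. \<Sum>k\<in>UNIV. \<Sum>l\<in>UNIV. r k l i j *\<^sub>R (c i ** c j ** c l ** c k)) =
      (\<Sum>k\<in>UNIV. \<Sum>l\<in>UNIV. \<Sum>i\<in>UNIV. \<Sum>j\<in>UNIV. r k l i j *\<^sub>R (c i ** c j ** c l ** c k))"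
  proof -
    have rot: "(\<Sum>i\<in>UNIV. \<Sum>j\<in>UNIV. \<Sum>k\<in>UNIV. h i j k) = (\<Sum>k\<in>UNIV. \<Sum>i\<in>UNIV. \<Sum>j\<in>UNIV. h i j k)"
      for h :: "'n \<Rightarrow> 'n \<Rightarrow> 'n \<Rightarrow> complex ^ 'k ^ 'k"
      by (rule trans[OF sum.cong[OF refl sum.swap] sum.swap])
    show ?thesis by (rule trans[OF rot sum.cong[OF refl rot]])
  qed
  also have "\<dots> = (\<Sum>k\<in>UNIV. X k ** c k)"
    unfolding X_def by (simp add: matrix_mult_sums(1) matrix_mult_distribs)
  also have "\<dots> = (\<Sum>k\<in>UNIV. \<Sum>i\<in>UNIV. - (2 *\<^sub>R (\<rho> k i *\<^sub>R (c i ** c k))))"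
    unfolding X by (simp add: matrix_mult_sums(1) matrix_mult_distribs scaleR_sum_right sum_negf)
  finally have T: "?T = 2 *\<^sub>R (\<Sum>k\<in>UNIV. \<Sum>i\<in>UNIV. \<rho> k i *\<^sub>R (c i ** c k))"
    by (simp add: scaleR_sum_right sum_negf)
  have "2 *\<^sub>R (\<Sum>k\<in>UNIV. \<Sum>i\<in>UNIV. \<rho> k i *\<^sub>R (c i ** c k)) =
     (\<Sum>k\<in>UNIV. \<Sum>i\<in>UNIV. \<rho> k i *\<^sub>R (c i ** c k)) + (\<Sum>k\<in>UNIV. \<Sum>i\<in>UNIV. \<rho> i k *\<^sub>R (c k ** c i))"
    using sum.swap[of "\<lambda>k i. \<rho> k i *\<^sub>R (c i ** c k)" UNIV UNIV] by (simp add: scaleR_2)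
  also have "\<dots> = (\<Sum>k\<in>UNIV. \<Sum>i\<in>UNIV. \<rho> k i *\<^sub>R (c i ** c k + c k ** c i))"
    unfolding sum.distrib[symmetric] scaleR_add_right by (intro sum.cong refl) (simp add: \<rho>_sym)
  also have "\<dots> = (\<Sum>k\<in>UNIV. \<Sum>i\<in>UNIV. if i = k then - (2 *\<^sub>R (\<rho> k i *\<^sub>R mat 1)) else 0)"
    by (intro sum.cong refl) (auto simp: c_anticomm mat_2)
  also have "\<dots> = - (2 *\<^sub>R ((\<Sum>k\<in>UNIV. \<rho> k k) *\<^sub>R mat 1))"
    by (simp add: sum.delta sum_negf scaleR_sum_right scaleR_sum_left)
  finally show ?thesis unfolding T by (simp add: \<rho>_def)
qed

end

section \<open>The Riemannian geometry of a chart\<close>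

lemma matrix_inv_eqI:
  fixes A B :: "real ^ 'n::finite ^ 'n"
  assumes "A ** B = mat 1" "B ** A = mat 1" shows "matrix_inv A = B"
proof -
  have "A ** matrix_inv A = mat 1 \<and> matrix_inv A ** A = mat 1"
    unfolding matrix_inv_def by (rule someI[of _ B]) (use assms in simp)
  then have "matrix_inv A ** (A ** B) = B"
    by (simp add: matrix_mul_assoc)
  then show ?thesis using assms by simp
qed

lemma axis_nth: "axis i x $ j = (if j = i then x else 0)"
  by (simp add: axis_def)

lemma linear_axis_expansion:
  fixes h :: "real ^ 'n::finite \<Rightarrow> 'b::real_vector"
  assumes "linear h" shows "h v = (\<Sum>i\<in>UNIV. v $ i *\<^sub>R h (axis i 1))"
proof -
  have "v = (\<Sum>i\<in>UNIV. v $ i *\<^sub>R axis i 1)"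
    by (simp add: vec_eq_iff axis_def if_distrib sum.delta cong: if_cong)
  then have "h v = h (\<Sum>i\<in>UNIV. v $ i *\<^sub>R axis i 1)" by simp
  then show ?thesis by (simp add: linear_sum[OF assms] linear_scale[OF assms])
qed

text \<open>Alternating the two symmetries returns to the starting term with the opposite sign. This
  is the algebra behind the uniqueness of the Levi-Civita connection.\<close>

lemma symmetric_skew_eq_0:
  fixes z :: "'v \<Rightarrow> 'v \<Rightarrow> 'v \<Rightarrow> real"
  assumes "\<And>u v w. z u v w = z v u w" "\<And>u v w. z u v w = - z u w v"
  shows "z u v w = 0"
proof -
  have "z u v w = - z w u v" using assms(1)[of u w v] assms(2)[of u v w] by linarith
  also have "\<dots> = z v w u" using assms(2)[of w u v] assms(1)[of w v u] by linarith
  also have "\<dots> = - z u v w" using assms(2)[of v w u] assms(1)[of v u w] by linarith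
  finally show ?thesis by linarith
qed

locale spin_manifold =
  fixes X :: "('a, 'm::topological_space, 'n::finite, 'k::finite) spin_mfd"
  assumes atlas: "oriented_atlas X" and riemannian: "riemannian_metric X"
    and frames: "oriented_orthonormal_frames X" and spin: "spin_structure X"

sublocale spin_manifold \<subseteq> clifford_module "gamma X"
  using spin by unfold_locales (simp add: spin_structure_def)

text \<open>\<open>U\<close> below is the coordinate image of the part of the chart domain inside
  \<open>N\<close>. Varying \<open>N\<close> gives one calculus for whole charts, for overlaps and
  for the domain of a local section.\<close>

locale spin_chart = spin_manifold X
  for X :: "('a, 'm::topological_space, 'n::finite, 'k::finite) spin_mfd" +
  fixes a :: 'a and N :: "'m set"
  assumes a: "a \<in> index X" and open_N: "open N"
begin

abbreviation "U \<equiv> chart X a ` (chart_dom X a \<inter> N)"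
abbreviation "c \<equiv> gamma X"
abbreviation "e \<equiv> frame X a"

section \<open>The metric, orthonormal bases and traces\<close>

definition gprod :: "real ^ 'n \<Rightarrow> real ^ 'n \<Rightarrow> real ^ 'n \<Rightarrow> real" where
  "gprod y v w = v \<bullet> (metric X a y *v w)"

lemma open_U: "open U"
proof -
  have h: "open (chart X a ` chart_dom X a)"
    "homeomorphism (chart_dom X a) (chart X a ` chart_dom X a) (chart X a) (point X a)"
    using atlas a unfolding oriented_atlas_def by blast+
  have "openin (top_of_set (chart_dom X a)) (chart_dom X a \<inter> N)"
    using open_N by (auto simp: openin_open)
  then show ?thesis
    using homeomorphism_imp_open_map[OF h(2)] h(1) openin_open_trans by blast
qed

lemma U_subset: "U \<subseteq> chart X a ` chart_dom X a"
  by blast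

lemma smooth_metric: "smooth_on U (metric X a)"
  using riemannian a by (auto simp: riemannian_metric_def tensor02_def intro: smooth_on_subset[OF _ U_subset])

lemma smooth_frame: "smooth_on U (e s)"
  using frames a by (auto simp: oriented_orthonormal_frames_def intro: smooth_on_subset[OF _ U_subset])

lemma metric_transpose: "y \<in> U \<Longrightarrow> transpose (metric X a y) = metric X a y"
  using riemannian a U_subset unfolding riemannian_metric_def by blast

lemma metric_swap: "y \<in> U \<Longrightarrow> metric X a y $ i $ j = metric X a y $ j $ i"
  using arg_cong[OF metric_transpose, of y "\<lambda>A. A $ j $ i"] by (simp add: transpose_def)

lemma gprod_sym: "y \<in> U \<Longrightarrow> gprod y v w = gprod y w v"
  unfolding gprod_def using metric_transpose[of y]
  by (metis dot_lmul_matrix inner_commute transpose_matrix_vector)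

lemma gprod_bilinear:
  "gprod y (v + v') w = gprod y v w + gprod y v' w" "gprod y v (w + w') = gprod y v w + gprod y v w'"
  "gprod y (v - v') w = gprod y v w - gprod y v' w" "gprod y v (w - w') = gprod y v w - gprod y v w'"
  "gprod y (r *\<^sub>R v) w = r * gprod y v w" "gprod y v (r *\<^sub>R w) = r * gprod y v w"
  "gprod y (- v) w = - gprod y v w" "gprod y v (- w) = - gprod y v w"
  "gprod y 0 w = 0" "gprod y v 0 = 0"
  by (simp_all add: gprod_def inner_add_left inner_add_right inner_diff_left inner_diff_right matrix_vector_distribs)

lemma gprod_sum: "gprod y (\<Sum>i\<in>I. f i) w = (\<Sum>i\<in>I. gprod y (f i) w)" "gprod y v (\<Sum>i\<in>I. f i) = (\<Sum>i\<in>I. gprod y v (f i))"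
  by (simp_all add: gprod_def inner_sum_left inner_sum_right matrix_vector_sums)

lemma linear_gprod_left: "linear (\<lambda>v. gprod y v w)"
  by (rule linearI) (simp_all add: gprod_bilinear)

lemma linear_gprod_right: "linear (gprod y v)"
  by (rule linearI) (simp_all add: gprod_bilinear)

lemma gprod_pos: "y \<in> U \<Longrightarrow> v \<noteq> 0 \<Longrightarrow> gprod y v v > 0"
  using riemannian a U_subset unfolding riemannian_metric_def gprod_def by blast

lemma gprod_eqI: "y \<in> U \<Longrightarrow> (\<And>w. gprod y v w = gprod y v' w) \<Longrightarrow> v = v'"
  using gprod_pos[of y "v - v'"] by (force simp: gprod_bilinear)

lemma frame_orthonormal: "y \<in> U \<Longrightarrow> gprod y (e s y) (e t y) = (if s = t then 1 else 0)"
  using frames a U_subset unfolding oriented_orthonormal_frames_def gprod_def by blast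

text \<open>Orthonormality says that the transpose of F times the metric is a left inverse of the
  square matrix F, hence also a right inverse. The basis is arbitrary because the frame of another
  chart, carried back to this one, is needed as well.\<close>

lemma orthonormal_inverse:
  fixes f :: "'n \<Rightarrow> real ^ 'n"
  assumes "y \<in> U" "\<And>s t. gprod y (f s) (f t) = (if s = t then 1 else 0)"
  defines "F \<equiv> (\<chi> i s. f s $ i)"
  shows "F ** (transpose F ** metric X a y) = mat 1"
proof -
  have "((transpose F ** metric X a y) ** F) $ s $ t = gprod y (f s) (f t)" for s t
  proof -
    have "gprod y (f s) (f t) = (\<Sum>i\<in>UNIV. \<Sum>j\<in>UNIV. f s $ i * metric X a y $ i $ j * f t $ j)"
      by (simp add: gprod_def inner_vec_def matrix_vector_mult_def sum_distrib_left mult.assoc)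
    also have "\<dots> = (\<Sum>j\<in>UNIV. \<Sum>i\<in>UNIV. f s $ i * metric X a y $ i $ j * f t $ j)"
      by (rule sum.swap)
    also have "\<dots> = ((transpose F ** metric X a y) ** F) $ s $ t"
      by (simp add: matrix_matrix_mult_def F_def transpose_def sum_distrib_right)
    finally show ?thesis by simp
  qed
  then have "(transpose F ** metric X a y) ** F = mat 1"
    by (simp add: vec_eq_iff assms(2) mat_def)
  then show ?thesis using matrix_left_right_inverse by blast
qed

lemma orthonormal_expansion:
  fixes f :: "'n \<Rightarrow> real ^ 'n"
  assumes "y \<in> U" "\<And>s t. gprod y (f s) (f t) = (if s = t then 1 else 0)"
  shows "v = (\<Sum>s\<in>UNIV. gprod y (f s) v *\<^sub>R f s)"
proof -
  let ?F = "\<chi> i s. f s $ i"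
  have "v = ?F *v (transpose ?F *v (metric X a y *v v))"
    using orthonormal_inverse[OF assms] by (simp add: matrix_vector_mul_assoc matrix_mul_assoc)
  also have "\<dots> = (\<Sum>s\<in>UNIV. gprod y (f s) v *\<^sub>R f s)"
    by (simp add: vec_eq_iff matrix_vector_mult_def[of ?F] matrix_vector_mult_def[of "vec_lambda f"] transpose_def
        gprod_def inner_vec_def mult.commute)
  finally show ?thesis .
qed

lemma linear_orthonormal:
  fixes f :: "'n \<Rightarrow> real ^ 'n"
  assumes "y \<in> U" "\<And>s t. gprod y (f s) (f t) = (if s = t then 1 else 0)" "linear h"
  shows "h v = (\<Sum>s\<in>UNIV. gprod y (f s) v *\<^sub>R h (f s))"
proof -
  have "h v = h (\<Sum>s\<in>UNIV. gprod y (f s) v *\<^sub>R f s)"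
    using orthonormal_expansion[OF assms(1,2), of v] by simp
  then show ?thesis by (simp add: linear_sum[OF assms(3)] linear_scale[OF assms(3)])
qed

lemma linear_frame:
  "y \<in> U \<Longrightarrow> linear h \<Longrightarrow> h v = (\<Sum>s\<in>UNIV. gprod y (e s y) v *\<^sub>R h (e s y))"
  by (rule linear_orthonormal[OF _ frame_orthonormal])

lemma inv_metric_orthonormal:
  fixes f :: "'n \<Rightarrow> real ^ 'n"
  assumes "y \<in> U" "\<And>s t. gprod y (f s) (f t) = (if s = t then 1 else 0)"
  shows "inv_metric X a y $ i $ j = (\<Sum>s\<in>UNIV. f s $ i * f s $ j)"
proof -
  let ?F = "\<chi> i s. f s $ i"
  have 1: "(?F ** transpose ?F) ** metric X a y = mat 1"
    using orthonormal_inverse[OF assms] by (simp add: matrix_mul_assoc)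
  then have "inv_metric X a y = ?F ** transpose ?F"
    unfolding inv_metric_def by (intro matrix_inv_eqI) (simp_all add: matrix_left_right_inverse)
  then show ?thesis by (simp add: matrix_matrix_mult_def transpose_def)
qed

lemma inv_metric_frame: "y \<in> U \<Longrightarrow> inv_metric X a y $ i $ j = (\<Sum>s\<in>UNIV. e s y $ i * e s y $ j)"
  by (rule inv_metric_orthonormal[OF _ frame_orthonormal])

lemma inv_metric_mult:
  assumes "y \<in> U" shows "metric X a y ** inv_metric X a y = mat 1"
proof -
  let ?F = "\<chi> i s. e s y $ i"
  have 1: "(?F ** transpose ?F) ** metric X a y = mat 1"
    using orthonormal_inverse[OF assms frame_orthonormal[OF assms]] by (simp add: matrix_mul_assoc)
  then have "inv_metric X a y = ?F ** transpose ?F"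
    unfolding inv_metric_def by (intro matrix_inv_eqI) (simp_all add: matrix_left_right_inverse)
  with 1 show ?thesis by (simp add: matrix_left_right_inverse)
qed

text \<open>The inverse metric is the sum of the products \<open>f s $ i * f s $ j\<close>. As the
  left-hand side does not mention the basis, any two orthonormal bases give the same trace, and the
  naturality of the operators rests on this.\<close>

lemma trace_orthonormal:
  fixes B :: "real ^ 'n \<Rightarrow> real ^ 'n \<Rightarrow> 'b::real_vector" and f :: "'n \<Rightarrow> real ^ 'n"
  assumes "y \<in> U" "\<And>s t. gprod y (f s) (f t) = (if s = t then 1 else 0)"
    and "\<And>w. linear (\<lambda>v. B v w)" "\<And>v. linear (B v)"
  shows "(\<Sum>i\<in>UNIV. \<Sum>j\<in>UNIV. inv_metric X a y $ i $ j *\<^sub>R B (axis i 1) (axis j 1)) = (\<Sum>s\<in>UNIV. B (f s) (f s))"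
proof -
  have "B (f s) (f s) = (\<Sum>i\<in>UNIV. \<Sum>j\<in>UNIV. (f s $ i * f s $ j) *\<^sub>R B (axis i 1) (axis j 1))" for s
    by (subst linear_axis_expansion[OF assms(3)], subst linear_axis_expansion[OF assms(4)])
      (simp add: scaleR_sum_right)
  then have "(\<Sum>s\<in>UNIV. B (f s) (f s)) = (\<Sum>s\<in>UNIV. \<Sum>i\<in>UNIV. \<Sum>j\<in>UNIV. (f s $ i * f s $ j) *\<^sub>R B (axis i 1) (axis j 1))"
    by simp
  also have "\<dots> = (\<Sum>i\<in>UNIV. \<Sum>s\<in>UNIV. \<Sum>j\<in>UNIV. (f s $ i * f s $ j) *\<^sub>R B (axis i 1) (axis j 1))"
    by (rule sum.swap)
  also have "\<dots> = (\<Sum>i\<in>UNIV. \<Sum>j\<in>UNIV. \<Sum>s\<in>UNIV. (f s $ i * f s $ j) *\<^sub>R B (axis i 1) (axis j 1))"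
    by (rule sum.cong[OF refl sum.swap])
  finally show ?thesis
    by (simp add: inv_metric_orthonormal[OF assms(1,2)] scaleR_sum_left)
qed

lemma trace_frame:
  fixes B :: "real ^ 'n \<Rightarrow> real ^ 'n \<Rightarrow> 'b::real_vector"
  assumes "y \<in> U" "\<And>w. linear (\<lambda>v. B v w)" "\<And>v. linear (B v)"
  shows "(\<Sum>i\<in>UNIV. \<Sum>j\<in>UNIV. inv_metric X a y $ i $ j *\<^sub>R B (axis i 1) (axis j 1)) = (\<Sum>s\<in>UNIV. B (e s y) (e s y))"
  by (rule trace_orthonormal[OF assms(1) frame_orthonormal[OF assms(1)] assms(2,3)])

lemma linear_trace:
  assumes "y \<in> U" "linear h" shows "(\<Sum>i\<in>UNIV. h (axis i 1) $ i) = (\<Sum>s\<in>UNIV. gprod y (e s y) (h (e s y)))"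
proof -
  have "h (axis i 1) $ i = (\<Sum>s\<in>UNIV. gprod y (e s y) (axis i 1) * h (e s y) $ i)" for i
    by (subst linear_frame[OF assms]) simp
  then have "(\<Sum>i\<in>UNIV. h (axis i 1) $ i) = (\<Sum>i\<in>UNIV. \<Sum>s\<in>UNIV. gprod y (e s y) (axis i 1) * h (e s y) $ i)"
    by simp
  also have "\<dots> = (\<Sum>s\<in>UNIV. \<Sum>i\<in>UNIV. gprod y (e s y) (axis i 1) * h (e s y) $ i)" by (rule sum.swap)
  also have "\<dots> = (\<Sum>s\<in>UNIV. gprod y (e s y) (h (e s y)))"
    by (subst (2) linear_axis_expansion[OF linear_gprod_right]) (simp add: mult.commute)
  finally show ?thesis .
qed

section \<open>The Levi-Civita connection in coordinates\<close>

definition Gam :: "real ^ 'n \<Rightarrow> real ^ 'n \<Rightarrow> real ^ 'n \<Rightarrow> real ^ 'n" where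
  "Gam y v w = (\<chi> l. \<Sum>i\<in>UNIV. \<Sum>j\<in>UNIV. christoffel X a l i j y * v $ i * w $ j)"

text \<open>For a constant coordinate field only the second summand survives, so
  \<open>Gam y v w\<close> is the covariant derivative along \<open>v\<close> of the constant field
  \<open>w\<close>.\<close>

lemma levi_civita_Gam: "levi_civita X a V y v = dd v V y + Gam y v (V y)"
  by (simp add: levi_civita_def dd_def Gam_def)

lemma Gam_bilinear:
  "Gam y (v + v') w = Gam y v w + Gam y v' w" "Gam y v (w + w') = Gam y v w + Gam y v w'"
  "Gam y (r *\<^sub>R v) w = r *\<^sub>R Gam y v w" "Gam y v (r *\<^sub>R w) = r *\<^sub>R Gam y v w"
  by (simp_all add: Gam_def vec_eq_iff algebra_simps sum.distrib sum_distrib_left)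

lemma linear_Gam_left: "linear (\<lambda>v. Gam y v w)" and linear_Gam_right: "linear (Gam y v)"
  by (auto intro!: linearI simp: Gam_bilinear)

lemma Gam_axis: "Gam y (axis i 1) (axis j 1) $ l = christoffel X a l i j y"
  by (simp add: Gam_def axis_nth mult_delta_right sum.delta)

lemma dd_metric_entry:
  "y \<in> U \<Longrightarrow> pd i (\<lambda>z. metric X a z $ j $ m) y = dd (axis i 1) (metric X a) y $ j $ m"
  unfolding pd_eq_dd
  by (rule dd_bounded_linear[where h = "\<lambda>A. A $ j $ m"])
    (auto intro!: bounded_linear_compose[OF bounded_linear_vec_nth bounded_linear_vec_nth]
      smooth_on_differentiable[OF smooth_metric])

lemma dd_metric_swap:
  assumes "y \<in> U" shows "dd v (metric X a) y $ i $ j = dd v (metric X a) y $ j $ i"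
proof -
  have d: "metric X a differentiable (at y)" by (rule smooth_on_differentiable[OF smooth_metric assms])
  have "dd v (\<lambda>z. metric X a z $ i $ j) y = dd v (\<lambda>z. metric X a z $ j $ i) y"
    by (rule dd_cong[OF open_U assms metric_swap])
  moreover have "dd v (\<lambda>z. metric X a z $ i $ j) y = dd v (metric X a) y $ i $ j" for i j
    by (rule dd_bounded_linear[where h = "\<lambda>A. A $ i $ j"])
      (auto intro!: bounded_linear_compose[OF bounded_linear_vec_nth bounded_linear_vec_nth] d)
  ultimately show ?thesis by simp
qed

definition dmetric :: "real ^ 'n \<Rightarrow> real ^ 'n \<Rightarrow> real ^ 'n \<Rightarrow> real ^ 'n \<Rightarrow> real" where
  "dmetric y u v w = v \<bullet> (dd u (metric X a) y *v w)"

lemma dmetric_expand: "dmetric y u v w = (\<Sum>i\<in>UNIV. \<Sum>j\<in>UNIV. v $ i * w $ j * dd u (metric X a) y $ i $ j)"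
  by (simp add: dmetric_def inner_vec_def matrix_vector_mult_def sum_distrib_left mult_ac)

lemma dmetric_sym: "y \<in> U \<Longrightarrow> dmetric y u v w = dmetric y u w v"
  unfolding dmetric_expand by (subst sum.swap) (simp add: dd_metric_swap[of y u] mult_ac)

lemma dmetric_linear_3: "linear (dmetric y u v)"
  by (rule linearI) (simp_all add: dmetric_def matrix_vector_distribs inner_add_right)

lemma dmetric_linear_2: "linear (\<lambda>v. dmetric y u v w)"
  by (rule linearI) (simp_all add: dmetric_def inner_add_left)

lemma dmetric_linear_1: "y \<in> U \<Longrightarrow> linear (\<lambda>u. dmetric y u v w)"
  using linear_add[OF linear_dd[OF smooth_on_differentiable[OF smooth_metric]]]
    linear_scale[OF linear_dd[OF smooth_on_differentiable[OF smooth_metric]]]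
  by (intro linearI) (simp_all add: dmetric_def matrix_vector_distribs inner_add_right)

lemma dd_gprod:
  assumes "y \<in> U" "V differentiable (at y)" "W differentiable (at y)"
  shows "dd u (\<lambda>y. gprod y (V y) (W y)) y = gprod y (dd u V y) (W y) + gprod y (V y) (dd u W y) + dmetric y u (V y) (W y)"
proof -
  have d: "metric X a differentiable (at y)" by (rule smooth_on_differentiable[OF smooth_metric assms(1)])
  show ?thesis
    unfolding gprod_def dmetric_def
    by (simp add: dd_bounded_bilinear[OF bounded_bilinear_inner] dd_matrix_vector_mult d assms
        differentiable_matrix_vector_mult inner_add_right algebra_simps)
qed

text \<open>The Koszul formula for constant coordinate fields, whose brackets vanish. Symmetry and
  metric compatibility are both read off from it.\<close>

lemma koszul:
  assumes "y \<in> U"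
  shows "2 * gprod y w (Gam y u v) = dmetric y u v w + dmetric y v u w - dmetric y w u v"
proof -
  define K where "K w = dmetric y u v w + dmetric y v u w - dmetric y w u v" for w
  have linK: "linear K"
    unfolding K_def using dmetric_linear_3 dmetric_linear_1[OF assms]
    by (intro linear_compose_sub linear_compose_add) auto
  have ax: "dmetric y (axis i 1) (axis j 1) (axis m 1) = dd (axis i 1) (metric X a) y $ j $ m" for i j m
    by (simp add: dmetric_expand axis_nth mult_delta_left mult_delta_right sum.delta)
  have KK: "K (axis m 1) = (\<Sum>i\<in>UNIV. \<Sum>j\<in>UNIV. u $ i * v $ j *
     (dd (axis i 1) (metric X a) y $ j $ m + dd (axis j 1) (metric X a) y $ i $ m - dd (axis m 1) (metric X a) y $ i $ j))" for m
  proof -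
    have 1: "dmetric y u v w = (\<Sum>i\<in>UNIV. \<Sum>j\<in>UNIV. u $ i * v $ j * dmetric y (axis i 1) (axis j 1) w)" for u v w
      by (subst linear_axis_expansion[OF dmetric_linear_1[OF assms]], subst linear_axis_expansion[OF dmetric_linear_2])
        (simp add: sum_distrib_left mult_ac)
    have 2: "dmetric y w u v = (\<Sum>i\<in>UNIV. \<Sum>j\<in>UNIV. u $ i * v $ j * dmetric y w (axis i 1) (axis j 1))" for w
      by (subst linear_axis_expansion[OF dmetric_linear_2], subst linear_axis_expansion[OF dmetric_linear_3])
        (simp add: sum_distrib_left mult_ac)
    have 3: "dmetric y v u w = (\<Sum>i\<in>UNIV. \<Sum>j\<in>UNIV. u $ i * v $ j * dmetric y (axis j 1) (axis i 1) w)" for w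
      by (subst 1, subst sum.swap) (simp add: mult_ac)
    show ?thesis
      unfolding K_def 1[of u v] 2[of "axis m 1"] 3[of "axis m 1"] ax
      by (simp add: algebra_simps sum.distrib sum_subtractf)
  qed
  have "2 *\<^sub>R Gam y u v = inv_metric X a y *v (\<chi> m. K (axis m 1))"
  proof -
    have "(2 *\<^sub>R Gam y u v) $ l = (\<Sum>i\<in>UNIV. \<Sum>j\<in>UNIV. \<Sum>m\<in>UNIV. inv_metric X a y $ l $ m * (u $ i * v $ j *
     (dd (axis i 1) (metric X a) y $ j $ m + dd (axis j 1) (metric X a) y $ i $ m - dd (axis m 1) (metric X a) y $ i $ j)))" for l
      using assms by (simp add: Gam_def christoffel_def dd_metric_entry sum_distrib_left sum_distrib_right mult_ac)
    also have "\<dots> l = (\<Sum>i\<in>UNIV. \<Sum>m\<in>UNIV. \<Sum>j\<in>UNIV. inv_metric X a y $ l $ m * (u $ i * v $ j *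
     (dd (axis i 1) (metric X a) y $ j $ m + dd (axis j 1) (metric X a) y $ i $ m - dd (axis m 1) (metric X a) y $ i $ j)))" for l
      by (rule sum.cong[OF refl sum.swap])
    also have "\<dots> l = (\<Sum>m\<in>UNIV. \<Sum>i\<in>UNIV. \<Sum>j\<in>UNIV. inv_metric X a y $ l $ m * (u $ i * v $ j *
     (dd (axis i 1) (metric X a) y $ j $ m + dd (axis j 1) (metric X a) y $ i $ m - dd (axis m 1) (metric X a) y $ i $ j)))" for l
      by (rule sum.swap)
    also have "\<dots> l = (inv_metric X a y *v (\<chi> m. K (axis m 1))) $ l" for l
      by (simp add: matrix_vector_mult_def KK sum_distrib_left)
    finally show ?thesis by (simp add: vec_eq_iff)
  qed
  then have "2 * gprod y w (Gam y u v) = w \<bullet> (metric X a y *v (inv_metric X a y *v (\<chi> m. K (axis m 1))))"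
    by (metis gprod_bilinear(6) gprod_def)
  also have "\<dots> = w \<bullet> (\<chi> m. K (axis m 1))"
    by (simp add: matrix_vector_mul_assoc inv_metric_mult[OF assms])
  also have "\<dots> = K w"
    by (subst linear_axis_expansion[OF linK]) (simp add: inner_vec_def)
  finally show ?thesis by (simp add: K_def)
qed

lemma Gam_sym: "y \<in> U \<Longrightarrow> Gam y u v = Gam y v u"
proof (rule gprod_eqI[of y])
  fix w assume y: "y \<in> U"
  then have "gprod y w (Gam y u v) = gprod y w (Gam y v u)"
    using koszul[OF y, of w u v] koszul[OF y, of w v u] dmetric_sym[OF y, of w u v] by linarith
  then show "gprod y (Gam y u v) w = gprod y (Gam y v u) w" by (simp add: gprod_sym[OF y, of _ w])
qed

text \<open>In the sum of the Koszul formulas for (w, u, v) and (v, u, w) the derivatives of the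
  metric along \<open>v\<close> and \<open>w\<close> cancel.\<close>

lemma Gam_metric: "y \<in> U \<Longrightarrow> dmetric y u v w = gprod y (Gam y u v) w + gprod y v (Gam y u w)"
  using koszul[of y w u v] koszul[of y v u w] gprod_sym[of y w "Gam y u v"] dmetric_sym[of y u v w] by linarith

lemma dd_gprod_levi_civita:
  assumes "y \<in> U" "V differentiable (at y)" "W differentiable (at y)"
  shows "dd u (\<lambda>y. gprod y (V y) (W y)) y = gprod y (levi_civita X a V y u) (W y) + gprod y (V y) (levi_civita X a W y u)"
  using dd_gprod[OF assms] Gam_metric[OF assms(1)] by (simp add: levi_civita_Gam gprod_bilinear)

end

section \<open>The spin connection and its curvature\<close>

context spin_chart begin

text \<open>By orthonormality the inverse metric is a polynomial in the components of the smooth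
  frame, so matrix inversion is never differentiated.\<close>

lemma smooth_inv_metric: "smooth_on U (\<lambda>y. inv_metric X a y $ i $ j)"
  by (rule smooth_on_cong[OF open_U, of "\<lambda>y. \<Sum>s\<in>UNIV. e s y $ i * e s y $ j"])
    (auto simp: inv_metric_frame intro!: smooth_intros open_U smooth_frame)

lemma smooth_christoffel: "smooth_on U (christoffel X a l i j)"
  unfolding christoffel_def[abs_def]
  by (intro smooth_intros open_U smooth_inv_metric smooth_metric)

lemma smooth_Gam:
  "smooth_on U V \<Longrightarrow> smooth_on U W \<Longrightarrow> smooth_on U (\<lambda>y. Gam y (V y) (W y))"
  unfolding Gam_def by (intro smooth_intros open_U smooth_christoffel)

lemma smooth_gprod:
  "smooth_on U V \<Longrightarrow> smooth_on U W \<Longrightarrow> smooth_on U (\<lambda>y. gprod y (V y) (W y))"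
  unfolding gprod_def by (intro smooth_intros open_U smooth_metric)

lemma smooth_dd_along:
  assumes "smooth_on U v" "smooth_on U f" shows "smooth_on U (\<lambda>y. dd (v y) f y)"
proof (rule smooth_on_cong[OF open_U])
  show "smooth_on U (\<lambda>y. \<Sum>i\<in>UNIV. v y $ i *\<^sub>R dd (axis i 1) f y)"
    by (intro smooth_intros open_U assms)
  show "(\<Sum>i\<in>UNIV. v y $ i *\<^sub>R dd (axis i 1) f y) = dd (v y) f y" if "y \<in> U" for y
    by (rule linear_axis_expansion[symmetric, OF linear_dd[OF smooth_on_differentiable[OF assms(2) that]]])
qed

lemma smooth_levi_civita:
  "smooth_on U V \<Longrightarrow> smooth_on U v \<Longrightarrow> smooth_on U (\<lambda>y. levi_civita X a V y (v y))"
  unfolding levi_civita_Gam by (intro smooth_intros open_U smooth_dd_along smooth_Gam)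

lemma conn_form_gprod: "conn_form X a s t y v = gprod y (e s y) (levi_civita X a (e t) y v)"
  by (simp add: conn_form_def gprod_def)

lemma smooth_spin_form: "smooth_on U v \<Longrightarrow> smooth_on U (\<lambda>y. spin_form X a y (v y))"
  unfolding spin_form_def conn_form_gprod
  by (intro smooth_intros open_U smooth_gprod smooth_levi_civita smooth_frame)

lemma clifford_gprod: "clifford X a y v = (\<Sum>s\<in>UNIV. gprod y (e s y) v *\<^sub>R c s)"
  by (simp add: clifford_def clifford_vector_c gprod_def)

lemma smooth_clifford: "smooth_on U v \<Longrightarrow> smooth_on U (\<lambda>y. clifford X a y (v y))"
  unfolding clifford_gprod by (intro smooth_intros open_U smooth_gprod smooth_frame)

lemma linear_clifford: "linear (clifford X a y)"
  by (rule linearI)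
    (simp_all add: clifford_gprod gprod_bilinear scaleR_left_distrib sum.distrib scaleR_sum_right)

lemma clifford_frame: "y \<in> U \<Longrightarrow> clifford X a y (e s y) = c s"
  by (simp add: clifford_gprod frame_orthonormal if_distrib[of "\<lambda>r. r *\<^sub>R _"] if_distribR sum.delta' cong: if_cong)

lemma clifford_relation:
  assumes "y \<in> U"
  shows "clifford X a y v ** clifford X a y w + clifford X a y w ** clifford X a y v = - ((2 * gprod y v w) *\<^sub>R mat 1)"
proof -
  have "clifford X a y v ** clifford X a y w =
      (\<Sum>s\<in>UNIV. \<Sum>t\<in>UNIV. (gprod y (e s y) v * gprod y (e t y) w) *\<^sub>R (c s ** c t))" for v w
    unfolding clifford_gprod
    by (subst matrix_mult_sums(1),
        subst matrix_mult_sums(2))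
      (simp add: matrix_mult_distribs mult.commute)
  note prod = this
  have "clifford X a y w ** clifford X a y v =
      (\<Sum>s\<in>UNIV. \<Sum>t\<in>UNIV. (gprod y (e s y) v * gprod y (e t y) w) *\<^sub>R (c t ** c s))"
    unfolding prod by (rule trans[OF sum.swap]) (simp add: mult.commute)
  then have "clifford X a y v ** clifford X a y w + clifford X a y w ** clifford X a y v =
      (\<Sum>s\<in>UNIV. \<Sum>t\<in>UNIV. (gprod y (e s y) v * gprod y (e t y) w) *\<^sub>R (c s ** c t + c t ** c s))"
    unfolding prod[of v w] by (simp only: scaleR_add_right sum.distrib)
  also have "\<dots> = (\<Sum>s\<in>UNIV. (gprod y (e s y) v * gprod y (e s y) w) *\<^sub>R (- mat 2))"
    by (simp add: c_anticomm if_distrib sum.delta cong: if_cong)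
  also have "\<dots> = - ((2 * (\<Sum>s\<in>UNIV. gprod y (e s y) v * gprod y (e s y) w)) *\<^sub>R mat 1)"
    by (simp add: mat_2 sum_negf scaleR_sum_left sum_distrib_left mult.commute)
  also have "(\<Sum>s\<in>UNIV. gprod y (e s y) v * gprod y (e s y) w) = gprod y v w"
    using linear_frame[OF assms linear_gprod_left[of y w], of v] by simp
  finally show ?thesis .
qed

lemma frame_differentiable: "y \<in> U \<Longrightarrow> e s differentiable (at y)"
  by (rule smooth_on_differentiable[OF smooth_frame])

lemma linear_levi_civita: "V differentiable (at y) \<Longrightarrow> linear (levi_civita X a V y)"
  unfolding levi_civita_Gam[abs_def] by (intro linear_compose_add linear_dd linear_Gam_left)

lemma linear_conn_form: "y \<in> U \<Longrightarrow> linear (conn_form X a s t y)"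
  unfolding conn_form_gprod[abs_def]
  using linear_compose[OF linear_levi_civita[OF frame_differentiable] linear_gprod_right] by (simp add: o_def)

lemma linear_spin_form: "y \<in> U \<Longrightarrow> linear (spin_form X a y)"
  unfolding spin_form_def[abs_def]
  using linear_add[OF linear_conn_form] linear_scale[OF linear_conn_form]
  by (intro linearI) (simp_all add: scaleR_left_distrib sum.distrib scaleR_sum_right scaleR_add_right mult_ac)

text \<open>The products of the frame fields are constant, so their derivatives vanish.\<close>

lemma conn_form_skew: assumes "y \<in> U" shows "conn_form X a s t y v = - conn_form X a t s y v"
proof -
  have "dd v (\<lambda>y. gprod y (e s y) (e t y)) y = dd v (\<lambda>y. if s = t then 1 else 0) y"
    by (rule dd_cong[OF open_U assms]) (simp add: frame_orthonormal)
  then have "gprod y (levi_civita X a (e s) y v) (e t y) + gprod y (e s y) (levi_civita X a (e t) y v) = 0"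
    using dd_gprod_levi_civita[OF assms frame_differentiable frame_differentiable, OF assms assms] by simp
  then show ?thesis
    using gprod_sym[OF assms, of "levi_civita X a (e s) y v"] by (simp add: conn_form_gprod)
qed

lemma levi_civita_frame:
  assumes "y \<in> U" shows "levi_civita X a (e t) y v = (\<Sum>s\<in>UNIV. conn_form X a s t y v *\<^sub>R e s y)"
  unfolding conn_form_gprod by (rule orthonormal_expansion[OF assms frame_orthonormal[OF assms]])

lemma spin_form_in_bivectors: "y \<in> U \<Longrightarrow> spin_form X a y v \<in> bivectors"
  unfolding spin_form_def
  by (intro subspace_neg subspace_scale subspace_bivectors skew_sum_in_bivectors conn_form_skew)

lemma spin_form_commutator:
  assumes "y \<in> U"
  shows "spin_form X a y v ** c u - c u ** spin_form X a y v = (\<Sum>s\<in>UNIV. conn_form X a s u y v *\<^sub>R c s)"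
proof -
  let ?S = "\<Sum>s\<in>UNIV. \<Sum>t\<in>UNIV. conn_form X a s t y v *\<^sub>R (c s ** c t)"
  have "spin_form X a y v ** c u - c u ** spin_form X a y v = - ((1 / 4) *\<^sub>R (?S ** c u - c u ** ?S))"
    by (simp add: spin_form_def matrix_mult_distribs scaleR_diff_right)
  also have "\<dots> = (\<Sum>s\<in>UNIV. conn_form X a s u y v *\<^sub>R c s)"
    by (subst skew_sum_commutator[OF conn_form_skew[OF assms]]) simp
  finally show ?thesis .
qed

section \<open>Covariant derivatives of spinors and of endomorphism fields\<close>

definition nab :: "real ^ 'n \<Rightarrow> (real ^ 'n \<Rightarrow> complex ^ 'k) \<Rightarrow> real ^ 'n \<Rightarrow> complex ^ 'k" where
  "nab v u y = dd v u y + spin_form X a y v *v u y"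

definition endo_nab :: "real ^ 'n \<Rightarrow> (real ^ 'n \<Rightarrow> complex ^ 'k ^ 'k) \<Rightarrow> real ^ 'n \<Rightarrow> complex ^ 'k ^ 'k" where
  "endo_nab v \<Phi> y = dd v \<Phi> y + (spin_form X a y v ** \<Phi> y - \<Phi> y ** spin_form X a y v)"

lemma smooth_nab: "smooth_on U v \<Longrightarrow> smooth_on U u \<Longrightarrow> smooth_on U (\<lambda>y. nab (v y) u y)"
  unfolding nab_def by (intro smooth_intros open_U smooth_dd_along smooth_spin_form)

lemma smooth_nab_const: "smooth_on U u \<Longrightarrow> smooth_on U (nab v u)"
  using smooth_nab[OF smooth_on_const, of u v] by simp

lemma nab_cong: "y \<in> U \<Longrightarrow> (\<And>z. z \<in> U \<Longrightarrow> f z = g z) \<Longrightarrow> nab v f y = nab v g y"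
  unfolding nab_def using dd_cong[OF open_U, of y f g v] by simp

lemma endo_nab_cong: "y \<in> U \<Longrightarrow> (\<And>z. z \<in> U \<Longrightarrow> f z = g z) \<Longrightarrow> endo_nab v f y = endo_nab v g y"
  unfolding endo_nab_def using dd_cong[OF open_U, of y f g v] by simp

lemma linear_nab: "y \<in> U \<Longrightarrow> smooth_on U u \<Longrightarrow> linear (\<lambda>v. nab v u y)"
  unfolding nab_def
  using linear_add[OF linear_spin_form] linear_scale[OF linear_spin_form]
  by (intro linear_compose_add linear_dd smooth_on_differentiable[of U u y] linearI)
    (simp_all add: matrix_vector_distribs)

lemma linear_endo_nab: "y \<in> U \<Longrightarrow> smooth_on U \<Phi> \<Longrightarrow> linear (\<lambda>v. endo_nab v \<Phi> y)"
  unfolding endo_nab_def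
  using linear_add[OF linear_spin_form] linear_scale[OF linear_spin_form]
  by (intro linear_compose_add linear_dd smooth_on_differentiable[of U \<Phi> y] linearI)
    (simp_all add: matrix_mult_distribs scaleR_diff_right)

lemma nab_add:
  "f differentiable (at y) \<Longrightarrow> g differentiable (at y) \<Longrightarrow> nab v (\<lambda>y. f y + g y) y = nab v f y + nab v g y"
  by (simp add: nab_def dd_add matrix_vector_distribs)

lemma nab_diff:
  "f differentiable (at y) \<Longrightarrow> g differentiable (at y) \<Longrightarrow> nab v (\<lambda>y. f y - g y) y = nab v f y - nab v g y"
  by (simp add: nab_def dd_diff matrix_vector_distribs)

lemma nab_sum:
  "(\<And>i. i \<in> I \<Longrightarrow> f i differentiable (at y)) \<Longrightarrow> nab v (\<lambda>y. \<Sum>i\<in>I. f i y) y = (\<Sum>i\<in>I. nab v (f i) y)"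
  by (simp add: nab_def dd_sum sum.distrib matrix_vector_sums(2))

lemma nab_scaleR:
  "h differentiable (at y) \<Longrightarrow> f differentiable (at y) \<Longrightarrow>
    nab v (\<lambda>y. h y *\<^sub>R f y) y = dd v h y *\<^sub>R f y + h y *\<^sub>R nab v f y"
  by (simp add: nab_def dd_scaleR matrix_vector_distribs scaleR_add_right add_ac)

lemma nab_mult:
  "\<Phi> differentiable (at y) \<Longrightarrow> f differentiable (at y) \<Longrightarrow>
    nab v (\<lambda>y. \<Phi> y *v f y) y = endo_nab v \<Phi> y *v f y + \<Phi> y *v nab v f y"
  by (simp add: nab_def endo_nab_def dd_matrix_vector_mult matrix_vector_distribs matrix_vector_mul_assoc)

lemma endo_nab_mult:
  "\<Phi> differentiable (at y) \<Longrightarrow> \<Psi> differentiable (at y) \<Longrightarrow>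
    endo_nab v (\<lambda>y. \<Phi> y ** \<Psi> y) y = endo_nab v \<Phi> y ** \<Psi> y + \<Phi> y ** endo_nab v \<Psi> y"
  by (simp add: endo_nab_def dd_matrix_mult matrix_mult_distribs matrix_mul_assoc)

lemma endo_nab_add:
  "\<Phi> differentiable (at y) \<Longrightarrow> \<Psi> differentiable (at y) \<Longrightarrow> endo_nab v (\<lambda>y. \<Phi> y + \<Psi> y) y = endo_nab v \<Phi> y + endo_nab v \<Psi> y"
  by (simp add: endo_nab_def dd_add matrix_mult_distribs)

lemma endo_nab_c: "y \<in> U \<Longrightarrow> endo_nab v (\<lambda>_. c t) y = (\<Sum>r\<in>UNIV. conn_form X a r t y v *\<^sub>R c r)"
  by (simp add: endo_nab_def spin_form_commutator)

text \<open>Clifford multiplication is parallel. The connection matrix enters through the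
  derivatives of the components of \<open>V\<close> in the frame and, with the opposite sign,
  through the commutator of the spin connection with the generators.\<close>

lemma clifford_parallel:
  assumes "y \<in> U" "V differentiable (at y)"
  shows "endo_nab v (\<lambda>y. clifford X a y (V y)) y = clifford X a y (levi_civita X a V y v)"
proof -
  have dgip: "(\<lambda>z. gprod z (e s z) (V z)) differentiable (at y)" for s
    unfolding gprod_def
    by (intro differentiable_bounded_bilinear[OF bounded_bilinear_inner]
        differentiable_matrix_vector_mult frame_differentiable assms
        smooth_on_differentiable[OF smooth_metric])
  have 1: "dd v (\<lambda>y. clifford X a y (V y)) y = (\<Sum>s\<in>UNIV. dd v (\<lambda>y. gprod y (e s y) (V y)) y *\<^sub>R c s)"
    unfolding clifford_gprod
    by (subst dd_sum) (auto simp: dd_scaleR dgip intro!: differentiable_scaleR_fun dgip)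
  have "gprod y (levi_civita X a (e s) y v) (V y) = - (\<Sum>r\<in>UNIV. gprod y (e r y) (V y) * conn_form X a s r y v)" for s
    unfolding levi_civita_frame[OF assms(1)] gprod_sum
    by (subst conn_form_skew[OF assms(1)]) (simp add: gprod_bilinear sum_negf mult.commute)
  then have 2: "dd v (\<lambda>y. gprod y (e s y) (V y)) y =
      gprod y (e s y) (levi_civita X a V y v) - (\<Sum>r\<in>UNIV. gprod y (e r y) (V y) * conn_form X a s r y v)" for s
    using dd_gprod_levi_civita[OF assms(1) frame_differentiable[OF assms(1)] assms(2)] by simp
  have "spin_form X a y v ** clifford X a y (V y) - clifford X a y (V y) ** spin_form X a y v =
      (\<Sum>r\<in>UNIV. gprod y (e r y) (V y) *\<^sub>R (spin_form X a y v ** c r - c r ** spin_form X a y v))"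
    by (simp add: clifford_gprod matrix_mult_sums matrix_mult_distribs scaleR_diff_right sum_subtractf)
  also have "\<dots> = (\<Sum>r\<in>UNIV. \<Sum>s\<in>UNIV. (gprod y (e r y) (V y) * conn_form X a s r y v) *\<^sub>R c s)"
    by (simp add: spin_form_commutator[OF assms(1)] scaleR_sum_right)
  also have "\<dots> = (\<Sum>s\<in>UNIV. \<Sum>r\<in>UNIV. (gprod y (e r y) (V y) * conn_form X a s r y v) *\<^sub>R c s)"
    by (rule sum.swap)
  finally have 3: "spin_form X a y v ** clifford X a y (V y) - clifford X a y (V y) ** spin_form X a y v =
      (\<Sum>s\<in>UNIV. (\<Sum>r\<in>UNIV. gprod y (e r y) (V y) * conn_form X a s r y v) *\<^sub>R c s)"
    by (simp add: scaleR_sum_left)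
  show ?thesis
    unfolding endo_nab_def 1 2 3 sum.distrib[symmetric] scaleR_left_distrib[symmetric]
    by (simp add: clifford_gprod)
qed

section \<open>Curvature of the spin connection and of the metric\<close>

definition spin_curv :: "real ^ 'n \<Rightarrow> real ^ 'n \<Rightarrow> real ^ 'n \<Rightarrow> complex ^ 'k ^ 'k" where
  "spin_curv y v w = dd v (\<lambda>z. spin_form X a z w) y - dd w (\<lambda>z. spin_form X a z v) y +
     (spin_form X a y v ** spin_form X a y w - spin_form X a y w ** spin_form X a y v)"

definition riem :: "real ^ 'n \<Rightarrow> real ^ 'n \<Rightarrow> real ^ 'n \<Rightarrow> real ^ 'n \<Rightarrow> real ^ 'n" where
  "riem y v w z = levi_civita X a (\<lambda>y. Gam y w z) y v - levi_civita X a (\<lambda>y. Gam y v z) y w"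

lemma spin_form_differentiable: "y \<in> U \<Longrightarrow> (\<lambda>z. spin_form X a z v) differentiable (at y)"
  by (rule smooth_on_differentiable[OF smooth_spin_form[OF smooth_on_const]])

text \<open>The directions are constant coordinate fields, which commute, so no bracket term
  appears. Second derivatives cancel by \<open>dd_swap\<close> and first derivatives cancel
  crosswise.\<close>

lemma nab_commutator:
  assumes "y \<in> U" "smooth_on U u"
  shows "nab v (nab w u) y - nab w (nab v u) y = spin_curv y v w *v u y"
proof -
  have du: "u differentiable (at y)" "dd w u differentiable (at y)" for w
    by (auto intro!: smooth_on_differentiable[OF _ assms(1)] smooth_intros assms)
  have "dd v (nab w u) y = dd v (dd w u) y + (spin_form X a y w *v dd v u y + dd v (\<lambda>z. spin_form X a z w) y *v u y)" for v w
    unfolding nab_def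
    by (subst dd_add) (auto simp: dd_matrix_vector_mult spin_form_differentiable assms du
        intro!: differentiable_matrix_vector_mult)
  then have "nab v (nab w u) y - nab w (nab v u) y =
      (dd v (dd w u) y + (spin_form X a y w *v dd v u y + dd v (\<lambda>z. spin_form X a z w) y *v u y) +
        spin_form X a y v *v (dd w u y + spin_form X a y w *v u y)) -
      (dd w (dd v u) y + (spin_form X a y v *v dd w u y + dd w (\<lambda>z. spin_form X a z v) y *v u y) +
        spin_form X a y w *v (dd v u y + spin_form X a y v *v u y))"
    by (simp add: nab_def)
  then show ?thesis
    using dd_swap[OF open_U assms(2,1), of v w]
    by (simp add: spin_curv_def matrix_vector_distribs matrix_vector_mul_assoc)
qed

lemma endo_nab_commutator:
  assumes "y \<in> U" "smooth_on U \<Phi>"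
  shows "endo_nab v (endo_nab w \<Phi>) y - endo_nab w (endo_nab v \<Phi>) y = spin_curv y v w ** \<Phi> y - \<Phi> y ** spin_curv y v w"
proof -
  have du: "\<Phi> differentiable (at y)" "dd w \<Phi> differentiable (at y)" for w
    by (auto intro!: smooth_on_differentiable[OF _ assms(1)] smooth_intros assms)
  have "dd v (endo_nab w \<Phi>) y = dd v (dd w \<Phi>) y +
     ((spin_form X a y w ** dd v \<Phi> y + dd v (\<lambda>z. spin_form X a z w) y ** \<Phi> y) -
      (\<Phi> y ** dd v (\<lambda>z. spin_form X a z w) y + dd v \<Phi> y ** spin_form X a y w))" for v w
    unfolding endo_nab_def
    by (subst dd_add, simp add: du, intro differentiable_diff differentiable_matrix_mult du
        spin_form_differentiable assms, subst dd_diff)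
      (auto simp: dd_matrix_mult spin_form_differentiable assms du
        intro!: differentiable_matrix_mult)
  then have "endo_nab v (endo_nab w \<Phi>) y - endo_nab w (endo_nab v \<Phi>) y =
      (dd v (dd w \<Phi>) y +
     ((spin_form X a y w ** dd v \<Phi> y + dd v (\<lambda>z. spin_form X a z w) y ** \<Phi> y) -
      (\<Phi> y ** dd v (\<lambda>z. spin_form X a z w) y + dd v \<Phi> y ** spin_form X a y w)) +
       (spin_form X a y v ** endo_nab w \<Phi> y - endo_nab w \<Phi> y ** spin_form X a y v)) -
      (dd w (dd v \<Phi>) y +
     ((spin_form X a y v ** dd w \<Phi> y + dd w (\<lambda>z. spin_form X a z v) y ** \<Phi> y) -
      (\<Phi> y ** dd w (\<lambda>z. spin_form X a z v) y + dd w \<Phi> y ** spin_form X a y v)) +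
       (spin_form X a y w ** endo_nab v \<Phi> y - endo_nab v \<Phi> y ** spin_form X a y w))"
    by (simp add: endo_nab_def)
  then show ?thesis
    using dd_swap[OF open_U assms(2,1), of v w]
    by (simp add: spin_curv_def endo_nab_def matrix_mult_distribs matrix_mul_assoc)
qed

lemma levi_civita_const: "levi_civita X a (\<lambda>_. z) y v = Gam y v z"
  by (simp add: levi_civita_Gam)

lemma Gam_differentiable: "y \<in> U \<Longrightarrow> (\<lambda>y. Gam y w z) differentiable (at y)"
  by (rule smooth_on_differentiable[OF smooth_Gam[OF smooth_on_const smooth_on_const]])

text \<open>By \<open>clifford_parallel\<close>, used twice, the second covariant derivatives of
  Clifford multiplication by a constant field are Clifford multiplications by those of the field.
  Antisymmetrising gives the spin curvature on one side and the Riemann tensor on the other.\<close>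

lemma spin_curv_clifford:
  assumes "y \<in> U"
  shows "spin_curv y v w ** clifford X a y z - clifford X a y z ** spin_curv y v w = clifford X a y (riem y v w z)"
proof -
  have 1: "endo_nab v (endo_nab w (\<lambda>y. clifford X a y z)) y = clifford X a y (levi_civita X a (\<lambda>y. Gam y w z) y v)" for v w
  proof -
    have "endo_nab v (endo_nab w (\<lambda>y. clifford X a y z)) y = endo_nab v (\<lambda>y. clifford X a y (Gam y w z)) y"
      by (rule endo_nab_cong[OF assms]) (simp add: clifford_parallel[of _ "\<lambda>_. z"] levi_civita_const)
    also have "\<dots> = clifford X a y (levi_civita X a (\<lambda>y. Gam y w z) y v)"
      by (rule clifford_parallel[OF assms Gam_differentiable[OF assms]])
    finally show ?thesis .
  qed
  show ?thesis
    using endo_nab_commutator[OF assms smooth_clifford[OF smooth_on_const], of v w z]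
    by (simp add: 1 riem_def linear_diff[OF linear_clifford])
qed

text \<open>The spin connection takes values in a Lie algebra; derivatives stay in this subspace and
  the quadratic term is a commutator.\<close>

lemma spin_curv_in_bivectors: assumes "y \<in> U" shows "spin_curv y v w \<in> bivectors"
  unfolding spin_curv_def
  by (intro subspace_add subspace_diff subspace_bivectors bivectors_commutator spin_form_in_bivectors assms
      dd_in_subspace[OF subspace_bivectors open_U assms] spin_form_differentiable)

lemma riem_skew: "riem y v w z = - riem y w v z"
  by (simp add: riem_def)

text \<open>The symmetry of the Christoffel symbols holds throughout \<open>U\<close> and may
  therefore be differentiated; the six terms then cancel in pairs.\<close>

lemma riem_bianchi:
  assumes "y \<in> U" shows "riem y v w z + riem y w z v + riem y z v w = 0"
proof -
  have "levi_civita X a (\<lambda>y. Gam y v w) y z = levi_civita X a (\<lambda>y. Gam y w v) y z" for v w z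
    using dd_cong[OF open_U assms, of "\<lambda>y. Gam y v w" "\<lambda>y. Gam y w v" z, OF Gam_sym] Gam_sym[OF assms, of v w] by (simp add: levi_civita_Gam)
  from this[of w z v] this[of z v w] this[of v w z] show ?thesis
    unfolding riem_def by simp
qed

lemma linear_levi_civita_field:
  assumes "y \<in> U" "\<And>z. z \<in> U \<Longrightarrow> linear (V z)" "\<And>w. smooth_on U (\<lambda>z. V z w)"
  shows "linear (\<lambda>w. levi_civita X a (\<lambda>z. V z w) y v)"
proof (rule linearI)
  have d: "(\<lambda>z. V z w) differentiable (at y)" for w
    by (rule smooth_on_differentiable[OF assms(3,1)])
  show "levi_civita X a (\<lambda>z. V z (w + w')) y v = levi_civita X a (\<lambda>z. V z w) y v + levi_civita X a (\<lambda>z. V z w') y v" for w w'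
    using dd_cong[OF open_U assms(1), of "\<lambda>z. V z (w + w')" "\<lambda>z. V z w + V z w'" v] assms(1) d
    by (simp add: levi_civita_Gam linear_add[OF assms(2)] dd_add Gam_bilinear)
  show "levi_civita X a (\<lambda>z. V z (r *\<^sub>R w)) y v = r *\<^sub>R levi_civita X a (\<lambda>z. V z w) y v" for r w
    using dd_cong[OF open_U assms(1), of "\<lambda>z. V z (r *\<^sub>R w)" "\<lambda>z. r *\<^sub>R V z w" v] assms(1) d
    by (simp add: levi_civita_Gam linear_scale[OF assms(2)] dd_bounded_linear[OF bounded_linear_scaleR_right]
        Gam_bilinear scaleR_add_right)
qed

lemma linear_riem:
  assumes "y \<in> U"
  shows "linear (\<lambda>v. riem y v w z)" "linear (\<lambda>w. riem y v w z)" "linear (\<lambda>z. riem y v w z)"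
  unfolding riem_def
  by (intro linear_compose_sub linear_levi_civita Gam_differentiable linear_levi_civita_field assms
      linear_Gam_left linear_Gam_right smooth_Gam smooth_on_const)+

text \<open>The Ricci contraction is the trace of an endomorphism and the contraction with the
  inverse metric is a metric trace; both can be evaluated in the frame.\<close>

lemma scalar_curvature_frame:
  assumes "y \<in> U"
  shows "scalar_curvature X a y = (\<Sum>i\<in>UNIV. \<Sum>j\<in>UNIV. gprod y (e i y) (riem y (e i y) (e j y) (e j y)))"
proof -
  have riem: "riemann X a l k i j y = riem y (axis i 1) (axis j 1) (axis k 1) $ l" for l k i j
  proof -
    have "pd i (christoffel X a l j k) y = dd (axis i 1) (\<lambda>y. Gam y (axis j 1) (axis k 1)) y $ l" for i j k
      unfolding pd_eq_dd
      by (subst dd_bounded_linear[OF bounded_linear_vec_nth Gam_differentiable[OF assms], symmetric]) (simp add: Gam_axis)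
    moreover have "Gam y (axis i 1) w $ l = (\<Sum>m\<in>UNIV. christoffel X a l i m y * w $ m)" for i w
      by (subst linear_axis_expansion[OF linear_Gam_right]) (simp add: Gam_axis mult.commute)
    ultimately show ?thesis
      by (simp add: riemann_def riem_def levi_civita_Gam Gam_axis sum_subtractf)
  qed
  have B: "linear (\<lambda>w. \<Sum>i\<in>UNIV. riem y (axis i 1) w z $ i)" "linear (\<lambda>z. \<Sum>i\<in>UNIV. riem y (axis i 1) w z $ i)" for w z
    by (auto intro!: linear_compose_sum linear_compose[OF _ bounded_linear.linear[OF bounded_linear_vec_nth], unfolded o_def]
        linear_riem assms)
  have "scalar_curvature X a y = (\<Sum>j\<in>UNIV. \<Sum>k\<in>UNIV. inv_metric X a y $ j $ k *\<^sub>R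
      (\<Sum>i\<in>UNIV. riem y (axis i 1) (axis j 1) (axis k 1) $ i))"
    by (simp add: scalar_curvature_def ricci_def riem)
  also have "\<dots> = (\<Sum>s\<in>UNIV. \<Sum>i\<in>UNIV. riem y (axis i 1) (e s y) (e s y) $ i)"
    by (rule trace_frame[OF assms]) (rule B)+
  also have "\<dots> = (\<Sum>s\<in>UNIV. \<Sum>i\<in>UNIV. gprod y (e i y) (riem y (e i y) (e s y) (e s y)))"
    by (intro sum.cong refl linear_trace[OF assms] linear_riem[OF assms])
  also have "\<dots> = (\<Sum>i\<in>UNIV. \<Sum>s\<in>UNIV. gprod y (e i y) (riem y (e i y) (e s y) (e s y)))"
    by (rule sum.swap)
  finally show ?thesis .
qed

lemma mat_1_nonzero: "(mat 1 :: complex ^ 'k ^ 'k) \<noteq> 0"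
proof
  assume "(mat 1 :: complex ^ 'k ^ 'k) = 0"
  then have "(mat 1 :: complex ^ 'k ^ 'k) $ undefined $ undefined = 0" by simp
  then show False by (simp add: mat_def)
qed

lemma riem_gprod_skew:
  assumes "y \<in> U" shows "gprod y z' (riem y v w z) = - gprod y z (riem y v w z')"
proof -
  let ?c = "clifford X a y" and ?F = "spin_curv y v w"
  have "?F ** (?c z ** ?c z' + ?c z' ** ?c z) - (?c z ** ?c z' + ?c z' ** ?c z) ** ?F = 0"
    by (simp add: clifford_relation[OF assms] matrix_mult_distribs)
  moreover have "?F ** (?c z ** ?c z' + ?c z' ** ?c z) - (?c z ** ?c z' + ?c z' ** ?c z) ** ?F =
      ((?F ** ?c z - ?c z ** ?F) ** ?c z' + ?c z' ** (?F ** ?c z - ?c z ** ?F)) +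
      ((?F ** ?c z' - ?c z' ** ?F) ** ?c z + ?c z ** (?F ** ?c z' - ?c z' ** ?F))"
    by (simp add: matrix_mult_distribs matrix_mul_assoc)
  ultimately have "(?c (riem y v w z) ** ?c z' + ?c z' ** ?c (riem y v w z)) + (?c (riem y v w z') ** ?c z + ?c z ** ?c (riem y v w z')) = 0"
    by (simp add: spin_curv_clifford[OF assms])
  then have "- ((2 * gprod y (riem y v w z) z' + 2 * gprod y (riem y v w z') z) *\<^sub>R (mat 1 :: complex ^ 'k ^ 'k)) = 0"
    by (simp add: clifford_relation[OF assms] scaleR_left_distrib)
  then have "2 * gprod y (riem y v w z) z' + 2 * gprod y (riem y v w z') z = 0"
    using mat_1_nonzero by simp
  then show ?thesis using gprod_sym[OF assms, of z'] gprod_sym[OF assms, of z] by simp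
qed

text \<open>The coefficient -1/4 of the curvature times the -2 of
  \<open>lichnerowicz_algebra\<close> gives one half. It becomes one quarter when the square of the
  Dirac operator is symmetrised.\<close>

lemma spin_curv_frame_contract:
  assumes "y \<in> U"
  shows "(\<Sum>i\<in>UNIV. \<Sum>j\<in>UNIV. c i ** c j ** spin_curv y (e i y) (e j y)) = (scalar_curvature X a y / 2) *\<^sub>R mat 1"
proof -
  define r where "r k l i j = gprod y (e k y) (riem y (e i y) (e j y) (e l y))" for k l i j
  have skew1: "r k l i j = - r l k i j" for k l i j
    unfolding r_def by (rule riem_gprod_skew[OF assms])
  have skew2: "r k l i j = - r k l j i" for k l i j
    unfolding r_def by (subst riem_skew) (simp add: gprod_bilinear)
  have bianchi: "r k l i j + r k i j l + r k j l i = 0" for k l i j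
    using riem_bianchi[OF assms, of "e i y" "e j y" "e l y"]
    unfolding r_def gprod_bilinear(2)[symmetric] by (simp add: add_ac gprod_bilinear)
  \<comment> \<open>The commutators of the curvature with the generators are known, and
    \<open>bivectors_contract\<close> rebuilds four times the curvature from them.\<close>
  have F: "spin_curv y (e i y) (e j y) = - ((1 / 4) *\<^sub>R (\<Sum>k\<in>UNIV. \<Sum>l\<in>UNIV. r k l i j *\<^sub>R (c k ** c l)))" for i j
  proof -
    have "4 *\<^sub>R spin_curv y (e i y) (e j y) = (\<Sum>l\<in>UNIV. c l ** clifford X a y (riem y (e i y) (e j y) (e l y)))"
      using bivectors_contract[OF spin_curv_in_bivectors[OF assms], of "e i y" "e j y"]
        spin_curv_clifford[OF assms, of "e i y" "e j y"] by (simp add: clifford_frame[OF assms, symmetric])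
    also have "\<dots> = (\<Sum>l\<in>UNIV. \<Sum>k\<in>UNIV. r k l i j *\<^sub>R (c l ** c k))"
      unfolding clifford_gprod by (simp add: r_def matrix_mult_sums matrix_mult_distribs)
    also have "\<dots> = - (\<Sum>l\<in>UNIV. \<Sum>k\<in>UNIV. r l k i j *\<^sub>R (c l ** c k))"
      by (subst skew1) (simp add: sum_negf)
    finally have "(1 / 4) *\<^sub>R (4 *\<^sub>R spin_curv y (e i y) (e j y)) = (1 / 4) *\<^sub>R (- (\<Sum>l\<in>UNIV. \<Sum>k\<in>UNIV. r l k i j *\<^sub>R (c l ** c k)))"
      by simp
    then show ?thesis by simp
  qed
  have "(\<Sum>i\<in>UNIV. \<Sum>j\<in>UNIV. c i ** c j ** spin_curv y (e i y) (e j y)) =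
     - ((1 / 4) *\<^sub>R (\<Sum>i\<in>UNIV. \<Sum>j\<in>UNIV. c i ** c j ** (\<Sum>k\<in>UNIV. \<Sum>l\<in>UNIV. r k l i j *\<^sub>R (c k ** c l))))"
    unfolding F by (simp only: matrix_mult_distribs sum_negf scaleR_sum_right[of "1 / 4", symmetric])
  also have "\<dots> = ((\<Sum>i\<in>UNIV. \<Sum>j\<in>UNIV. r i j i j) / 2) *\<^sub>R mat 1"
    by (subst lichnerowicz_algebra[OF skew1 skew2 bianchi]) simp
  finally show ?thesis by (simp add: scalar_curvature_frame[OF assms] r_def)
qed

end

section \<open>The Lichnerowicz formula with potentials\<close>

context spin_chart begin

text \<open>The second covariant derivative. The correction along \<open>Gam y v w\<close> accounts
  for the covariant derivative of the constant field \<open>w\<close>.\<close>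

definition hess :: "real ^ 'n \<Rightarrow> real ^ 'n \<Rightarrow> (real ^ 'n \<Rightarrow> complex ^ 'k) \<Rightarrow> real ^ 'n \<Rightarrow> complex ^ 'k" where
  "hess v w u y = nab v (nab w u) y - nab (Gam y v w) u y"

definition dirac_loc :: "(real ^ 'n \<Rightarrow> complex ^ 'k) \<Rightarrow> real ^ 'n \<Rightarrow> complex ^ 'k" where
  "dirac_loc u y = (\<Sum>s\<in>UNIV. c s *v nab (e s y) u y)"

lemma dirac_eq_loc: "dirac X \<psi> a y = dirac_loc (\<psi> a) y"
  by (simp add: dirac_def dirac_loc_def nab_def dd_def)

lemma smooth_dirac_loc: "smooth_on U u \<Longrightarrow> smooth_on U (dirac_loc u)"
  unfolding dirac_loc_def[abs_def] by (intro smooth_intros open_U smooth_nab smooth_frame)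

lemma nab_differentiable: "y \<in> U \<Longrightarrow> smooth_on U u \<Longrightarrow> nab v u differentiable (at y)"
  by (rule smooth_on_differentiable[OF smooth_nab_const])

lemma linear_nab_nab:
  assumes "y \<in> U" "smooth_on U u" shows "linear (\<lambda>w. nab v (nab w u) y)"
proof (rule linearI)
  note d = nab_differentiable[OF assms]
  show "nab v (nab (w + w') u) y = nab v (nab w u) y + nab v (nab w' u) y" for w w'
    using nab_cong[OF assms(1), of "nab (w + w') u" "\<lambda>z. nab w u z + nab w' u z" v]
    by (simp add: linear_add[OF linear_nab[OF _ assms(2)]] nab_add d)
  show "nab v (nab (r *\<^sub>R w) u) y = r *\<^sub>R nab v (nab w u) y" for r w
    using nab_cong[OF assms(1), of "nab (r *\<^sub>R w) u" "\<lambda>z. r *\<^sub>R nab w u z" v]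
    by (simp add: linear_scale[OF linear_nab[OF _ assms(2)]] nab_scaleR d)
qed

lemma linear_hess:
  assumes "y \<in> U" "smooth_on U u" shows "linear (\<lambda>v. hess v w u y)" "linear (\<lambda>w. hess v w u y)"
  unfolding hess_def
  by (intro linear_compose_sub linear_nab_nab assms linear_nab smooth_nab_const
      linear_compose[OF linear_Gam_left linear_nab, unfolded o_def]
      linear_compose[OF linear_Gam_right linear_nab, unfolded o_def])+

text \<open>In coordinates only the components of \<open>V\<close> are differentiated in addition.
  Needed because the frame fields are not constant.\<close>

lemma nab_nab_along:
  assumes "y \<in> U" and dV: "V differentiable (at y)" and "smooth_on U u"
  shows "nab v (\<lambda>z. nab (V z) u z) y = nab v (nab (V y) u) y + nab (dd v V y) u y"
proof -
  have dVi: "(\<lambda>z. V z $ i) differentiable (at y)" for i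
    by (rule differentiable_bounded_linear[OF bounded_linear_vec_nth dV])
  note dn = nab_differentiable[OF assms(1,3)]
  have "nab v (\<lambda>z. nab (V z) u z) y = nab v (\<lambda>z. \<Sum>i\<in>UNIV. V z $ i *\<^sub>R nab (axis i 1) u z) y"
    by (rule nab_cong[OF assms(1)]) (rule linear_axis_expansion[OF linear_nab[OF _ assms(3)]])
  also have "\<dots> = (\<Sum>i\<in>UNIV. dd v (\<lambda>z. V z $ i) y *\<^sub>R nab (axis i 1) u y + V y $ i *\<^sub>R nab v (nab (axis i 1) u) y)"
    by (subst nab_sum) (auto simp: nab_scaleR dVi dn intro!: differentiable_scaleR_fun)
  also have "\<dots> = (\<Sum>i\<in>UNIV. dd v V y $ i *\<^sub>R nab (axis i 1) u y) + (\<Sum>i\<in>UNIV. V y $ i *\<^sub>R nab v (nab (axis i 1) u) y)"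
    by (simp add: sum.distrib dd_bounded_linear[OF bounded_linear_vec_nth dV])
  finally show ?thesis
    using linear_axis_expansion[OF linear_nab[OF assms(1,3)], of "dd v V y"]
      linear_axis_expansion[OF linear_nab_nab[OF assms(1,3)], of v "V y"] by simp
qed

text \<open>Takes over the role of a normal frame: differentiating the generators and
  differentiating the frame fields both produce the connection matrix, and the two contributions
  cancel after an exchange of summation indices because the matrix is skew.\<close>

lemma nab_dirac_loc:
  assumes "y \<in> U" "smooth_on U u"
  shows "nab v (dirac_loc u) y = (\<Sum>t\<in>UNIV. c t *v hess v (e t y) u y)"
proof -
  let ?N = "\<lambda>t. nab (e t y) u y" and ?w = "\<lambda>r t. conn_form X a r t y v"
  have d: "(\<lambda>z. nab (e t z) u z) differentiable (at y)" for t
    by (rule smooth_on_differentiable[OF smooth_nab[OF smooth_frame assms(2)] assms(1)])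
  have t: "nab v (\<lambda>z. c t *v nab (e t z) u z) y =
      c t *v hess v (e t y) u y + ((\<Sum>r\<in>UNIV. ?w r t *\<^sub>R (c r *v ?N t)) + (\<Sum>r\<in>UNIV. ?w r t *\<^sub>R (c t *v ?N r)))" for t
  proof -
    have lin: "nab (Gam y v (e t y)) u y + nab (dd v (e t) y) u y = (\<Sum>r\<in>UNIV. ?w r t *\<^sub>R ?N r)"
    proof -
      have "nab (Gam y v (e t y)) u y + nab (dd v (e t) y) u y = nab (levi_civita X a (e t) y v) u y"
        by (simp add: levi_civita_Gam linear_add[OF linear_nab[OF assms]])
      then show ?thesis
        by (simp add: levi_civita_frame[OF assms(1)] linear_sum[OF linear_nab[OF assms]] linear_scale[OF linear_nab[OF assms]])
    qed
    have "nab v (\<lambda>z. c t *v nab (e t z) u z) y =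
        (\<Sum>r\<in>UNIV. ?w r t *\<^sub>R (c r *v ?N t)) + c t *v (nab v (nab (e t y) u) y + nab (dd v (e t) y) u y)"
      by (simp add: nab_mult d endo_nab_c assms nab_nab_along[OF assms(1) frame_differentiable[OF assms(1)] assms(2)]
          matrix_vector_sums(1) matrix_vector_distribs)
    also have "nab v (nab (e t y) u) y + nab (dd v (e t) y) u y = hess v (e t y) u y + (\<Sum>r\<in>UNIV. ?w r t *\<^sub>R ?N r)"
      unfolding hess_def lin[symmetric] by simp
    finally show ?thesis
      by (simp add: matrix_vector_distribs matrix_vector_sums(2))
  qed
  have "(\<Sum>t\<in>UNIV. \<Sum>r\<in>UNIV. ?w r t *\<^sub>R (c t *v ?N r)) = (\<Sum>t\<in>UNIV. \<Sum>r\<in>UNIV. ?w t r *\<^sub>R (c r *v ?N t))"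
    by (rule sum.swap)
  also have "\<dots> = - (\<Sum>t\<in>UNIV. \<Sum>r\<in>UNIV. ?w r t *\<^sub>R (c r *v ?N t))"
    by (subst conn_form_skew[OF assms(1)]) (simp add: sum_negf)
  finally have cancel: "(\<Sum>t\<in>UNIV. (\<Sum>r\<in>UNIV. ?w r t *\<^sub>R (c r *v ?N t)) + (\<Sum>r\<in>UNIV. ?w r t *\<^sub>R (c t *v ?N r))) = 0"
    by (simp add: sum.distrib)
  have "nab v (dirac_loc u) y = (\<Sum>t\<in>UNIV. nab v (\<lambda>z. c t *v nab (e t z) u z) y)"
    unfolding dirac_loc_def[abs_def]
    by (rule nab_sum) (intro differentiable_matrix_vector_mult d differentiable_const)
  then show ?thesis unfolding t sum.distrib[of "\<lambda>t. c t *v hess v (e t y) u y"] cancel by simp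
qed

lemma hess_commutator:
  assumes "y \<in> U" "smooth_on U u"
  shows "hess v w u y - hess w v u y = spin_curv y v w *v u y"
  using nab_commutator[OF assms, of v w] Gam_sym[OF assms(1), of v w] by (simp add: hess_def)

text \<open>The double sum is added to its copy with exchanged indices. The symmetric part of the
  Hessian meets the anticommutator of the generators and leaves a trace; the antisymmetric part is
  curvature.\<close>

theorem lichnerowicz:
  assumes "y \<in> U" "smooth_on U u"
  shows "dirac_loc (dirac_loc u) y = - (\<Sum>s\<in>UNIV. hess (e s y) (e s y) u y) + (scalar_curvature X a y / 4) *\<^sub>R u y"
proof -
  let ?H = "\<lambda>s t. hess (e s y) (e t y) u y" and ?F = "\<lambda>s t. spin_curv y (e s y) (e t y)"
  have D: "dirac_loc (dirac_loc u) y = (\<Sum>s\<in>UNIV. \<Sum>t\<in>UNIV. (c s ** c t) *v ?H s t)"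
    unfolding dirac_loc_def[of "dirac_loc u"] nab_dirac_loc[OF assms]
    by (simp add: matrix_vector_sums(2) matrix_vector_mul_assoc)
  have "dirac_loc (dirac_loc u) y = (\<Sum>s\<in>UNIV. \<Sum>t\<in>UNIV. (c t ** c s) *v ?H t s)"
    unfolding D by (rule sum.swap)
  with D have "dirac_loc (dirac_loc u) y + dirac_loc (dirac_loc u) y = (\<Sum>s\<in>UNIV. \<Sum>t\<in>UNIV. (c s ** c t) *v ?H s t + (c t ** c s) *v ?H t s)"
    by (simp only: sum.distrib)
  \<comment> \<open>\<open>?H t s\<close> is replaced by \<open>?H s t\<close> plus the curvature
    term.\<close>
  also have "\<dots> = (\<Sum>s\<in>UNIV. \<Sum>t\<in>UNIV. (c s ** c t + c t ** c s) *v ?H s t + (c t ** c s) *v (?F t s *v u y))"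
    by (simp add: hess_commutator[OF assms, symmetric] matrix_vector_distribs)
  also have "\<dots> = (\<Sum>s\<in>UNIV. \<Sum>t\<in>UNIV. (c s ** c t + c t ** c s) *v ?H s t) +
      (\<Sum>s\<in>UNIV. \<Sum>t\<in>UNIV. (c t ** c s ** ?F t s) *v u y)"
    by (simp add: sum.distrib matrix_vector_mul_assoc)
  also have "(\<Sum>s\<in>UNIV. \<Sum>t\<in>UNIV. (c t ** c s ** ?F t s) *v u y) = (\<Sum>t\<in>UNIV. \<Sum>s\<in>UNIV. (c t ** c s ** ?F t s) *v u y)"
    by (rule sum.swap)
  also have "\<dots> = (scalar_curvature X a y / 2) *\<^sub>R u y"
    using arg_cong[OF spin_curv_frame_contract[OF assms(1)], of "\<lambda>A. A *v u y"]
    by (simp add: matrix_vector_sums(1) matrix_vector_distribs)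
  also have "(\<Sum>s\<in>UNIV. \<Sum>t\<in>UNIV. (c s ** c t + c t ** c s) *v ?H s t) = (\<Sum>s\<in>UNIV. \<Sum>t\<in>UNIV. if s = t then - (2 *\<^sub>R ?H s t) else 0)"
    by (intro sum.cong refl) (simp add: c_anticomm mat_2 matrix_vector_distribs)
  also have "\<dots> = - (2 *\<^sub>R (\<Sum>s\<in>UNIV. ?H s s))"
    by (simp add: sum.delta sum_negf scaleR_sum_right)
  finally have "2 *\<^sub>R dirac_loc (dirac_loc u) y = 2 *\<^sub>R (- (\<Sum>s\<in>UNIV. ?H s s) + (scalar_curvature X a y / 4) *\<^sub>R u y)"
    unfolding scaleR_2[symmetric] scaleR_add_right by simp
  then show ?thesis by (simp only: scaleR_cancel_left) simp
qed

section \<open>The twisted connection that completes the square\<close>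

definition pot :: "(real ^ 'n \<Rightarrow> complex ^ 'k ^ 'k) \<Rightarrow> (real ^ 'n \<Rightarrow> complex ^ 'k ^ 'k) \<Rightarrow> real ^ 'n \<Rightarrow> real ^ 'n \<Rightarrow> complex ^ 'k ^ 'k" where
  "pot \<Phi> \<Psi> y v = clifford X a y v ** \<Phi> y + \<Psi> y ** clifford X a y v"

text \<open>The factor 1/2 occurs because the potential meets a first derivative twice in the
  Hessian, once from each of the two covariant derivatives.\<close>

definition tw_nab :: "(real ^ 'n \<Rightarrow> complex ^ 'k ^ 'k) \<Rightarrow> (real ^ 'n \<Rightarrow> complex ^ 'k ^ 'k) \<Rightarrow> real ^ 'n \<Rightarrow>
    (real ^ 'n \<Rightarrow> complex ^ 'k) \<Rightarrow> real ^ 'n \<Rightarrow> complex ^ 'k" where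
  "tw_nab \<Phi> \<Psi> v u y = nab v u y - (1 / 2) *\<^sub>R (pot \<Phi> \<Psi> y v *v u y)"

definition tw_hess :: "(real ^ 'n \<Rightarrow> complex ^ 'k ^ 'k) \<Rightarrow> (real ^ 'n \<Rightarrow> complex ^ 'k ^ 'k) \<Rightarrow> real ^ 'n \<Rightarrow> real ^ 'n \<Rightarrow>
    (real ^ 'n \<Rightarrow> complex ^ 'k) \<Rightarrow> real ^ 'n \<Rightarrow> complex ^ 'k" where
  "tw_hess \<Phi> \<Psi> v w u y = tw_nab \<Phi> \<Psi> v (tw_nab \<Phi> \<Psi> w u) y - tw_nab \<Phi> \<Psi> (Gam y v w) u y"

lemma linear_pot: "linear (pot \<Phi> \<Psi> y)"
  unfolding pot_def[abs_def]
  using linear_add[OF linear_clifford] linear_scale[OF linear_clifford]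
  by (intro linearI) (simp_all add: matrix_mult_distribs scaleR_add_right)

lemma smooth_pot:
  "smooth_on U \<Phi> \<Longrightarrow> smooth_on U \<Psi> \<Longrightarrow> smooth_on U v \<Longrightarrow> smooth_on U (\<lambda>y. pot \<Phi> \<Psi> y (v y))"
  unfolding pot_def by (intro smooth_intros open_U smooth_clifford)

lemma smooth_tw_nab:
  "smooth_on U \<Phi> \<Longrightarrow> smooth_on U \<Psi> \<Longrightarrow> smooth_on U v \<Longrightarrow> smooth_on U u \<Longrightarrow> smooth_on U (\<lambda>y. tw_nab \<Phi> \<Psi> (v y) u y)"
  unfolding tw_nab_def by (intro smooth_intros open_U smooth_pot smooth_nab)

text \<open>Clifford multiplication by the constant \<open>w\<close> differentiates to that by
  \<open>Gam y v w\<close>. This part of the derivative of the potential cancels against the twisted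
  derivative along \<open>Gam y v w\<close>, so only derivatives of \<Phi> and \<Psi>
  survive.\<close>

lemma tw_hess_eq:
  assumes "y \<in> U" "smooth_on U u" "smooth_on U \<Phi>" "smooth_on U \<Psi>"
  shows "tw_hess \<Phi> \<Psi> v w u y = hess v w u y
    - (1 / 2) *\<^sub>R ((clifford X a y w ** endo_nab v \<Phi> y + endo_nab v \<Psi> y ** clifford X a y w) *v u y)
    - (1 / 2) *\<^sub>R (pot \<Phi> \<Psi> y w *v nab v u y) - (1 / 2) *\<^sub>R (pot \<Phi> \<Psi> y v *v nab w u y)
    + (1 / 4) *\<^sub>R ((pot \<Phi> \<Psi> y v ** pot \<Phi> \<Psi> y w) *v u y)"
proof -
  have du: "u differentiable (at y)" and d\<Phi>: "\<Phi> differentiable (at y)" and d\<Psi>: "\<Psi> differentiable (at y)"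
    by (auto intro: smooth_on_differentiable[OF _ assms(1)] assms)
  have dcl: "(\<lambda>y. clifford X a y w) differentiable (at y)" for w
    by (rule smooth_on_differentiable[OF smooth_clifford[OF smooth_on_const] assms(1)])
  have dpot: "(\<lambda>y. pot \<Phi> \<Psi> y w) differentiable (at y)" for w
    by (rule smooth_on_differentiable[OF smooth_pot[OF assms(3,4) smooth_on_const] assms(1)])
  have ncl: "endo_nab v (\<lambda>y. clifford X a y w) y = clifford X a y (Gam y v w)"
    using clifford_parallel[OF assms(1), of "\<lambda>_. w" v] by (simp add: levi_civita_const)
  have ndp: "endo_nab v (\<lambda>y. pot \<Phi> \<Psi> y w) y =
      pot \<Phi> \<Psi> y (Gam y v w) + (clifford X a y w ** endo_nab v \<Phi> y + endo_nab v \<Psi> y ** clifford X a y w)"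
    unfolding pot_def
    by (subst endo_nab_add) (auto simp: endo_nab_mult d\<Phi> d\<Psi> dcl ncl
        intro!: differentiable_matrix_mult)
  have "nab v (tw_nab \<Phi> \<Psi> w u) y = nab v (nab w u) y - nab v (\<lambda>y. (1 / 2) *\<^sub>R (pot \<Phi> \<Psi> y w *v u y)) y"
    unfolding tw_nab_def[abs_def]
    by (intro nab_diff nab_differentiable assms differentiable_bounded_linear[OF bounded_linear_scaleR_right]
        differentiable_matrix_vector_mult dpot du)
  also have "nab v (\<lambda>y. (1 / 2) *\<^sub>R (pot \<Phi> \<Psi> y w *v u y)) y =
     (1 / 2) *\<^sub>R (endo_nab v (\<lambda>y. pot \<Phi> \<Psi> y w) y *v u y + pot \<Phi> \<Psi> y w *v nab v u y)"
    by (subst nab_scaleR) (auto simp: nab_mult dpot du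
        intro!: differentiable_matrix_vector_mult)
  finally have "nab v (tw_nab \<Phi> \<Psi> w u) y = nab v (nab w u) y -
     (1 / 2) *\<^sub>R ((pot \<Phi> \<Psi> y (Gam y v w) + (clifford X a y w ** endo_nab v \<Phi> y + endo_nab v \<Psi> y ** clifford X a y w)) *v u y
        + pot \<Phi> \<Psi> y w *v nab v u y)"
    unfolding ndp .
  then show ?thesis
    unfolding tw_hess_def hess_def tw_nab_def
    by (simp add: matrix_vector_distribs scaleR_add_right scaleR_diff_right matrix_vector_mul_assoc)
qed

lemma linear_tw_hess:
  assumes "y \<in> U" "smooth_on U u" "smooth_on U \<Phi>" "smooth_on U \<Psi>"
  shows "linear (\<lambda>v. tw_hess \<Phi> \<Psi> v w u y)" "linear (\<lambda>w. tw_hess \<Phi> \<Psi> v w u y)"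
  unfolding tw_hess_eq[OF assms]
  using linear_add[OF linear_pot] linear_scale[OF linear_pot] linear_add[OF linear_clifford] linear_scale[OF linear_clifford]
    linear_add[OF linear_endo_nab[OF assms(1,3)]] linear_scale[OF linear_endo_nab[OF assms(1,3)]]
    linear_add[OF linear_endo_nab[OF assms(1,4)]] linear_scale[OF linear_endo_nab[OF assms(1,4)]]
    linear_add[OF linear_nab[OF assms(1,2)]] linear_scale[OF linear_nab[OF assms(1,2)]]
  by (intro linear_compose_sub linear_compose_add linear_hess assms linearI;
      simp add: matrix_mult_distribs matrix_vector_distribs scaleR_add_right add_ac)+

lemma linear_tw_nab: "y \<in> U \<Longrightarrow> smooth_on U u \<Longrightarrow> linear (\<lambda>v. tw_nab \<Phi> \<Psi> v u y)"
  unfolding tw_nab_def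
  by (intro linear_compose_sub linear_nab linearI)
    (simp_all add: linear_add[OF linear_pot] linear_scale[OF linear_pot] matrix_vector_distribs scaleR_add_right)

text \<open>Serves the change of chart, where constant fields become variable. The potential of the
  outer derivative is not differentiated, so the product rule is needed for \<open>nab\<close>
  only.\<close>

lemma tw_nab_tw_nab_along:
  assumes "y \<in> U" "V differentiable (at y)" "smooth_on U u" "smooth_on U \<Phi>" "smooth_on U \<Psi>"
  shows "tw_nab \<Phi> \<Psi> v (\<lambda>z. tw_nab \<Phi> \<Psi> (V z) u z) y = tw_nab \<Phi> \<Psi> v (tw_nab \<Phi> \<Psi> (V y) u) y + tw_nab \<Phi> \<Psi> (dd v V y) u y"
proof -
  have sm: "smooth_on U (tw_nab \<Phi> \<Psi> w u)" for w
    using smooth_tw_nab[OF assms(4,5) smooth_on_const assms(3), of w] by simp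
  have d: "tw_nab \<Phi> \<Psi> w u differentiable (at y)" for w
    by (rule smooth_on_differentiable[OF sm assms(1)])
  have dVi: "(\<lambda>z. V z $ i) differentiable (at y)" for i
    by (rule differentiable_bounded_linear[OF bounded_linear_vec_nth assms(2)])
  have ex: "tw_nab \<Phi> \<Psi> (V z) u z = (\<Sum>i\<in>UNIV. V z $ i *\<^sub>R tw_nab \<Phi> \<Psi> (axis i 1) u z)" if "z \<in> U" for z
    by (rule linear_axis_expansion[OF linear_tw_nab[OF that assms(3)]])
  have "nab v (\<lambda>z. tw_nab \<Phi> \<Psi> (V z) u z) y = nab v (\<lambda>z. \<Sum>i\<in>UNIV. V z $ i *\<^sub>R tw_nab \<Phi> \<Psi> (axis i 1) u z) y"
    by (rule nab_cong[OF assms(1) ex])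
  also have "\<dots> = (\<Sum>i\<in>UNIV. dd v V y $ i *\<^sub>R tw_nab \<Phi> \<Psi> (axis i 1) u y + V y $ i *\<^sub>R nab v (tw_nab \<Phi> \<Psi> (axis i 1) u) y)"
    by (subst nab_sum) (auto simp: nab_scaleR dVi d dd_bounded_linear[OF bounded_linear_vec_nth assms(2)]
        intro!: differentiable_scaleR_fun)
  also have "\<dots> = tw_nab \<Phi> \<Psi> (dd v V y) u y + (\<Sum>i\<in>UNIV. V y $ i *\<^sub>R nab v (tw_nab \<Phi> \<Psi> (axis i 1) u) y)"
    using linear_axis_expansion[OF linear_tw_nab[OF assms(1,3)], of \<Phi> \<Psi> "dd v V y"] by (simp add: sum.distrib)
  also have "(\<Sum>i\<in>UNIV. V y $ i *\<^sub>R nab v (tw_nab \<Phi> \<Psi> (axis i 1) u) y) = nab v (\<lambda>z. \<Sum>i\<in>UNIV. V y $ i *\<^sub>R tw_nab \<Phi> \<Psi> (axis i 1) u z) y"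
    by (subst nab_sum) (auto simp: nab_scaleR d intro!: differentiable_scaleR_fun)
  also have "\<dots> = nab v (tw_nab \<Phi> \<Psi> (V y) u) y"
    by (rule nab_cong[OF assms(1)]) (rule linear_axis_expansion[symmetric, OF linear_tw_nab[OF _ assms(3)]])
  finally show ?thesis unfolding tw_nab_def[of \<Phi> \<Psi> v] by simp
qed

text \<open>On the diagonal the two first-order terms of \<open>tw_hess_eq\<close> coincide and add
  up to the one produced by the potentials. The derivative of \<Phi> has weight 1 from the product
  rule and -1/2 from the Hessian, that of \<Psi> has weight -1/2 only, which explains the
  antisymmetric expression with factor 1/2.\<close>

theorem lichnerowicz_potential:
  assumes "y \<in> U" "smooth_on U u" "smooth_on U \<Phi>" "smooth_on U \<Psi>"
  shows "dirac_loc (\<lambda>z. dirac_loc u z + \<Phi> z *v u z) y + \<Psi> y *v (dirac_loc u y + \<Phi> y *v u y) =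
    - (\<Sum>s\<in>UNIV. tw_hess \<Phi> \<Psi> (e s y) (e s y) u y) +
    ((scalar_curvature X a y / 4) *\<^sub>R mat 1
      + (1 / 4) *\<^sub>R (\<Sum>s\<in>UNIV. msq (c s ** \<Phi> y + \<Psi> y ** c s))
      + (1 / 2) *\<^sub>R (\<Sum>s\<in>UNIV. c s ** endo_nab (e s y) \<Phi> y - endo_nab (e s y) \<Psi> y ** c s)
      + \<Psi> y ** \<Phi> y) *v u y"
proof -
  let ?N = "\<lambda>s. nab (e s y) u y"
  have d: "\<Phi> differentiable (at y)" "u differentiable (at y)" "dirac_loc u differentiable (at y)"
    by (auto intro!: smooth_on_differentiable[OF _ assms(1)] assms smooth_dirac_loc)
  have "dirac_loc (\<lambda>z. dirac_loc u z + \<Phi> z *v u z) y = (\<Sum>s\<in>UNIV. c s *v (nab (e s y) (dirac_loc u) y + (endo_nab (e s y) \<Phi> y *v u y + \<Phi> y *v ?N s)))"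
    unfolding dirac_loc_def[of "\<lambda>z. dirac_loc u z + \<Phi> z *v u z"]
    by (simp add: nab_add nab_mult d differentiable_matrix_vector_mult)
  also have "\<dots> = dirac_loc (dirac_loc u) y + (\<Sum>s\<in>UNIV. (c s ** endo_nab (e s y) \<Phi> y) *v u y + (c s ** \<Phi> y) *v ?N s)"
    unfolding dirac_loc_def[of "dirac_loc u"] sum.distrib[symmetric] by (simp add: matrix_vector_distribs matrix_vector_mul_assoc)
  finally have 1: "dirac_loc (\<lambda>z. dirac_loc u z + \<Phi> z *v u z) y + \<Psi> y *v (dirac_loc u y + \<Phi> y *v u y) =
     dirac_loc (dirac_loc u) y + (\<Sum>s\<in>UNIV. (c s ** endo_nab (e s y) \<Phi> y) *v u y + (c s ** \<Phi> y + \<Psi> y ** c s) *v ?N s) + (\<Psi> y ** \<Phi> y) *v u y"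
    by (simp add: dirac_loc_def[of u] matrix_vector_sums(2) matrix_vector_distribs
        matrix_vector_mul_assoc sum.distrib)
  have "tw_hess \<Phi> \<Psi> (e s y) (e s y) u y = hess (e s y) (e s y) u y
    - (1 / 2) *\<^sub>R ((c s ** endo_nab (e s y) \<Phi> y + endo_nab (e s y) \<Psi> y ** c s) *v u y)
    - (c s ** \<Phi> y + \<Psi> y ** c s) *v ?N s + (1 / 4) *\<^sub>R (msq (c s ** \<Phi> y + \<Psi> y ** c s) *v u y)" for s
  proof -
    have half: "x - (1 / 2) *\<^sub>R z - (1 / 2) *\<^sub>R z = x - z" for x z :: "complex ^ 'k"
      using scaleR_left_distrib[of "1 / 2" "1 / 2" z] by (simp add: diff_diff_eq)
    show ?thesis
      unfolding tw_hess_eq[OF assms] pot_def clifford_frame[OF assms(1)] msq_def half ..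
  qed
  then have 2: "hess (e s y) (e s y) u y = tw_hess \<Phi> \<Psi> (e s y) (e s y) u y
    + (1 / 2) *\<^sub>R ((c s ** endo_nab (e s y) \<Phi> y + endo_nab (e s y) \<Psi> y ** c s) *v u y)
    + (c s ** \<Phi> y + \<Psi> y ** c s) *v ?N s - (1 / 4) *\<^sub>R (msq (c s ** \<Phi> y + \<Psi> y ** c s) *v u y)" for s
    by simp
  have 3: "(c s ** endo_nab (e s y) \<Phi> y) *v u y - (1 / 2) *\<^sub>R ((c s ** endo_nab (e s y) \<Phi> y + endo_nab (e s y) \<Psi> y ** c s) *v u y) =
     (1 / 2) *\<^sub>R ((c s ** endo_nab (e s y) \<Phi> y - endo_nab (e s y) \<Psi> y ** c s) *v u y)" for s
  proof -
    have "x - (1 / 2) *\<^sub>R (x + z) = (1 / 2) *\<^sub>R (x - z)" for x z :: "complex ^ 'k"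
      using scaleR_left_distrib[of "1 / 2" "1 / 2" x] by (simp add: scaleR_add_right scaleR_diff_right diff_eq_eq)
    then show ?thesis by (simp add: matrix_vector_distribs)
  qed
  have "dirac_loc (\<lambda>z. dirac_loc u z + \<Phi> z *v u z) y + \<Psi> y *v (dirac_loc u y + \<Phi> y *v u y) =
    - (\<Sum>s\<in>UNIV. tw_hess \<Phi> \<Psi> (e s y) (e s y) u y) +
    (\<Sum>s\<in>UNIV. ((c s ** endo_nab (e s y) \<Phi> y) *v u y - (1 / 2) *\<^sub>R ((c s ** endo_nab (e s y) \<Phi> y + endo_nab (e s y) \<Psi> y ** c s) *v u y))
       + (1 / 4) *\<^sub>R (msq (c s ** \<Phi> y + \<Psi> y ** c s) *v u y)) + (scalar_curvature X a y / 4) *\<^sub>R u y + (\<Psi> y ** \<Phi> y) *v u y"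
    unfolding 1 lichnerowicz[OF assms(1,2)] 2 by (simp add: sum.distrib sum_subtractf)
  also have "\<dots> = - (\<Sum>s\<in>UNIV. tw_hess \<Phi> \<Psi> (e s y) (e s y) u y) +
    ((scalar_curvature X a y / 4) *\<^sub>R mat 1
      + (1 / 4) *\<^sub>R (\<Sum>s\<in>UNIV. msq (c s ** \<Phi> y + \<Psi> y ** c s))
      + (1 / 2) *\<^sub>R (\<Sum>s\<in>UNIV. c s ** endo_nab (e s y) \<Phi> y - endo_nab (e s y) \<Psi> y ** c s)
      + \<Psi> y ** \<Phi> y) *v u y"
    unfolding 3 sum.distrib scaleR_sum_right[symmetric] matrix_vector_sums(1)[symmetric]
    by (simp add: matrix_vector_distribs)
  finally show ?thesis .
qed

end

section \<open>Change of trivialization\<close>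

text \<open>As \<open>N\<close> lies in both chart domains, the transition map is a bijection
  between the two coordinate images, and the local calculus is available on either side under the
  prefixes \<open>A\<close> and \<open>B\<close>.\<close>

locale spin_transition = spin_manifold X
  for X :: "('a, 'm::topological_space, 'n::finite, 'k::finite) spin_mfd" +
  fixes a b :: 'a and N :: "'m set"
  assumes a: "a \<in> index X" and b: "b \<in> index X" and open_N: "open N"
    and N: "N \<subseteq> chart_dom X a \<inter> chart_dom X b"

sublocale spin_transition \<subseteq> A: spin_chart X a N
  by unfold_locales (rule a open_N)+

sublocale spin_transition \<subseteq> B: spin_chart X b N
  by unfold_locales (rule b open_N)+

lemma (in spin_manifold) point_chart: "a \<in> index X \<Longrightarrow> x \<in> chart_dom X a \<Longrightarrow> point X a (chart X a x) = x"
  using atlas unfolding oriented_atlas_def by (meson homeomorphism_apply1)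

lemma (in spin_manifold) spin_transition_flip: "spin_transition X a b N \<Longrightarrow> spin_transition X b a N"
  unfolding spin_transition_def spin_transition_axioms_def by blast

context spin_transition begin

section \<open>The transition map and its derivative\<close>

abbreviation "\<phi> \<equiv> transition X a b"
abbreviation "\<phi>' \<equiv> transition X b a"

lemma UE:
  assumes "y \<in> A.U" obtains x where "x \<in> N" "y = chart X a x" "\<phi> y = chart X b x"
  using assms N point_chart[OF a] by (auto simp: transition_def)

lemma transition_in: "y \<in> A.U \<Longrightarrow> \<phi> y \<in> B.U"
  using N by (elim UE) auto

lemma transition_inverse: "y \<in> A.U \<Longrightarrow> \<phi>' (\<phi> y) = y"
  using N point_chart[OF b] point_chart[OF a] by (auto simp: transition_def)

lemma smooth_transition: "smooth_on A.U \<phi>"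
proof (rule smooth_on_subset)
  show "smooth_on (chart X a ` (chart_dom X a \<inter> chart_dom X b)) \<phi>"
    using atlas a b unfolding oriented_atlas_def by blast
  show "A.U \<subseteq> chart X a ` (chart_dom X a \<inter> chart_dom X b)" using N by blast
qed

lemma transition_differentiable: "y \<in> A.U \<Longrightarrow> \<phi> differentiable (at y)"
  by (rule smooth_on_differentiable[OF smooth_transition])

abbreviation J :: "real ^ 'n \<Rightarrow> real ^ 'n \<Rightarrow> real ^ 'n" where
  "J y v \<equiv> dd v \<phi> y"

lemma jac_dd: "x \<in> N \<Longrightarrow> jac X a b x *v v = J (chart X a x) v"
  unfolding jac_def
  by (rule dd_has_derivative[symmetric], rule jacobian_works[THEN iffD1], rule transition_differentiable)
    (use N in auto)

lemma flip: "spin_transition X b a N"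
  using spin_transition_flip spin_transition_axioms by blast

lemmas transition_differentiable' = spin_transition.transition_differentiable[OF flip]

lemma J_inverse: assumes "y \<in> A.U" shows "dd (J y v) \<phi>' (\<phi> y) = v"
proof -
  have "dd v (\<lambda>z. \<phi>' (\<phi> z)) y = dd v (\<lambda>z. z) y"
    by (rule dd_cong[OF A.open_U assms transition_inverse])
  also have "dd v (\<lambda>z. z) y = v" by (rule dd_has_derivative) simp
  finally show ?thesis
    using dd_compose[of \<phi> y \<phi>' v] transition_differentiable[OF assms] transition_differentiable'[OF transition_in[OF assms]]
    by simp
qed

lemma J_inverse': assumes "y \<in> A.U" shows "J y (dd w \<phi>' (\<phi> y)) = w"
  using spin_transition.J_inverse[OF flip transition_in[OF assms]] by (simp add: transition_inverse[OF assms])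

lemma tensor_transition:
  assumes "tensor02 X p" "y \<in> A.U"
  shows "v \<bullet> (p a y *v w) = J y v \<bullet> (p b (\<phi> y) *v J y w)"
proof -
  obtain x where x: "x \<in> N" "y = chart X a x" "\<phi> y = chart X b x" using assms(2) by (rule UE)
  have "p a y = transpose (jac X a b x) ** p b (\<phi> y) ** jac X a b x"
    unfolding x(3) unfolding x(2) using assms(1) a b x(1) N unfolding tensor02_def by blast
  then have "v \<bullet> (p a y *v w) = v \<bullet> (transpose (jac X a b x) *v (p b (\<phi> y) *v (jac X a b x *v w)))"
    by (simp add: matrix_vector_mul_assoc matrix_mul_assoc)
  also have "\<dots> = (jac X a b x *v v) \<bullet> (p b (\<phi> y) *v (jac X a b x *v w))"
    by (metis dot_lmul_matrix transpose_matrix_vector transpose_transpose)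
  finally show ?thesis unfolding jac_dd[OF x(1)] x(2) .
qed

lemma gprod_transition: "y \<in> A.U \<Longrightarrow> A.gprod y v w = B.gprod (\<phi> y) (J y v) (J y w)"
  using tensor_transition[of "metric X"] riemannian by (simp add: A.gprod_def B.gprod_def riemannian_metric_def)

lemma dd_J_differentiable: "y \<in> A.U \<Longrightarrow> (\<lambda>z. J z v) differentiable (at y)"
  by (rule smooth_on_differentiable[of A.U]) (use smooth_on_dd[OF smooth_transition, of v] in simp_all)

text \<open>The difference of the two sides is symmetric in \<open>u, v\<close>; both connections being metric, it
  is also skew in the sense of \<open>symmetric_skew_eq_0\<close>.\<close>

lemma Gam_transition:
  assumes "y \<in> A.U"
  shows "dd u (\<lambda>z. J z v) y + B.Gam (\<phi> y) (J y u) (J y v) = J y (A.Gam y u v)"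
proof -
  define T where "T u v = dd u (\<lambda>z. J z v) y + B.Gam (\<phi> y) (J y u) (J y v)" for u v
  define z where "z u v w = B.gprod (\<phi> y) (T u v - J y (A.Gam y u v)) (J y w)" for u v w
  note B = transition_in[OF assms]
  note gsym = B.gprod_sym[OF B]
  have T_sym: "T u v = T v u" for u v
    using dd_swap[OF A.open_U smooth_transition assms, of u v] B.Gam_sym[OF B] by (simp add: T_def)
  \<comment> \<open>The identity \<open>gprod_transition\<close> for constant \<open>v\<close> and
    \<open>w\<close>, differentiated along \<open>u\<close>; both sides are then rewritten by the
    metric compatibility of their chart.\<close>
  have metric: "B.gprod (\<phi> y) (J y (A.Gam y u v)) (J y w) + B.gprod (\<phi> y) (J y v) (J y (A.Gam y u w)) =
      B.gprod (\<phi> y) (T u v) (J y w) + B.gprod (\<phi> y) (J y v) (T u w)" for u v w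
  proof -
    have dm: "metric X b differentiable (at (\<phi> y))"
      by (rule smooth_on_differentiable[OF B.smooth_metric B])
    have dmv: "(\<lambda>z. metric X b (\<phi> z)) differentiable (at y)"
      by (rule differentiable_compose_at[OF transition_differentiable[OF assms] dm])
    have "A.dmetric y u v w = dd u (\<lambda>z. A.gprod z v w) y"
      using A.dd_gprod[OF assms, of "\<lambda>_. v" "\<lambda>_. w" u] by (simp add: A.gprod_bilinear)
    also have "\<dots> = dd u (\<lambda>z. J z v \<bullet> (metric X b (\<phi> z) *v J z w)) y"
      by (rule dd_cong[OF A.open_U assms]) (simp add: gprod_transition B.gprod_def)
    also have "\<dots> = B.gprod (\<phi> y) (dd u (\<lambda>z. J z v) y) (J y w) + B.gprod (\<phi> y) (J y v) (dd u (\<lambda>z. J z w) y)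
        + B.dmetric (\<phi> y) (J y u) (J y v) (J y w)"
      unfolding B.gprod_def B.dmetric_def
      by (simp add: dd_bounded_bilinear[OF bounded_bilinear_inner] dd_matrix_vector_mult dmv dd_J_differentiable assms
          differentiable_matrix_vector_mult inner_add_right
          dd_compose[OF transition_differentiable[OF assms] dm])
    finally show ?thesis
      unfolding A.Gam_metric[OF assms] B.Gam_metric[OF B] gprod_transition[OF assms] T_def
      by (simp add: B.gprod_bilinear)
  qed
  have "z u v w = 0" for u v w
  proof (rule symmetric_skew_eq_0[of z])
    show "z u v w = z v u w" for u v w
      unfolding z_def T_sym[of u v] A.Gam_sym[OF assms, of u v] ..
    show "z u v w = - z u w v" for u v w
      using metric[of u v w] gsym[of "J y v"] by (simp add: z_def B.gprod_bilinear)
  qed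
  then have "B.gprod (\<phi> y) (T u v - J y (A.Gam y u v)) w = B.gprod (\<phi> y) 0 w" for w
    using J_inverse'[OF assms, of w] unfolding z_def by (metis B.gprod_bilinear(9))
  from B.gprod_eqI[OF B this] show ?thesis by (simp add: T_def)
qed

section \<open>The lift to the spin group\<close>

abbreviation "G \<equiv> (\<lambda>y. lift X a b (point X a y))"

lemma lift_props:
  assumes "y \<in> A.U"
  shows "G y \<in> spin_group (gamma X)"
    and "G y ** gamma X s = clifford X a y (dd (frame X b s (\<phi> y)) \<phi>' (\<phi> y)) ** G y"
proof -
  obtain x where x: "x \<in> N" "y = chart X a x" "\<phi> y = chart X b x" using assms(1) by (rule UE)
  have p: "point X a y = x" using x N point_chart[OF a] by auto
  have xx: "x \<in> chart_dom X a \<inter> chart_dom X b" using x N by auto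
  show "G y \<in> spin_group (gamma X)"
    unfolding p using spin a b xx unfolding spin_structure_def by blast
  have "lift X a b x ** gamma X s = clifford X a (chart X a x) (jac X b a x *v frame X b s (chart X b x)) ** lift X a b x"
    using spin a b xx unfolding spin_structure_def by blast
  then show "G y ** gamma X s = clifford X a y (dd (frame X b s (\<phi> y)) \<phi>' (\<phi> y)) ** G y"
    unfolding p spin_transition.jac_dd[OF flip x(1)] x(2)[symmetric] x(3)[symmetric] .
qed

lemma smooth_G: "smooth_on A.U G"
proof (rule smooth_on_subset)
  show "smooth_on (chart X a ` (chart_dom X a \<inter> chart_dom X b)) G"
    using spin a b unfolding spin_structure_def by blast
  show "A.U \<subseteq> chart X a ` (chart_dom X a \<inter> chart_dom X b)" using N by blast
qed

lemma G_differentiable: "y \<in> A.U \<Longrightarrow> G differentiable (at y)"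
  by (rule smooth_on_differentiable[OF smooth_G])

lemma G_unitary:
  assumes "y \<in> A.U" shows "G y ** adj (G y) = mat 1" "adj (G y) ** G y = mat 1"
proof -
  show *: "G y ** adj (G y) = mat 1"
    by (rule spin_group_unitary[OF lift_props(1)[OF assms]])
  then show "adj (G y) ** G y = mat 1"
    by (simp add: matrix_left_right_inverse)
qed

text \<open>The spin structure gives this for the frame vectors of \<open>b\<close>, carried back to
  \<open>a\<close>; both sides are linear in \<open>v\<close>.\<close>

lemma clifford_transition:
  assumes "y \<in> A.U"
  shows "G y ** clifford X b (\<phi> y) (J y v) = clifford X a y v ** G y"
proof -
  note B = transition_in[OF assms]
  let ?K = "\<lambda>w. dd w \<phi>' (\<phi> y)"
  have linK: "linear ?K" by (rule linear_dd[OF transition_differentiable'[OF B]])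
  have "v = ?K (J y v)" using J_inverse[OF assms] by simp
  also have "\<dots> = (\<Sum>s\<in>UNIV. B.gprod (\<phi> y) (frame X b s (\<phi> y)) (J y v) *\<^sub>R ?K (frame X b s (\<phi> y)))"
    by (rule B.linear_frame[OF B linK])
  finally have "v = (\<Sum>s\<in>UNIV. B.gprod (\<phi> y) (frame X b s (\<phi> y)) (J y v) *\<^sub>R ?K (frame X b s (\<phi> y)))" .
  from arg_cong[OF this, of "clifford X a y"] have v: "clifford X a y v =
      (\<Sum>s\<in>UNIV. B.gprod (\<phi> y) (frame X b s (\<phi> y)) (J y v) *\<^sub>R clifford X a y (?K (frame X b s (\<phi> y))))"
    by (simp only: linear_sum[OF A.linear_clifford] linear_scale[OF A.linear_clifford])
  have "G y ** clifford X b (\<phi> y) (J y v) =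
      (\<Sum>s\<in>UNIV. B.gprod (\<phi> y) (frame X b s (\<phi> y)) (J y v) *\<^sub>R (G y ** gamma X s))"
    unfolding B.clifford_gprod by (simp add: matrix_mult_sums matrix_mult_distribs)
  then show ?thesis
    unfolding v lift_props(2)[OF assms] by (simp add: matrix_mult_sums matrix_mult_distribs)
qed

text \<open>The difference of the two sides, multiplied by the inverse of the lift, is a skew element of
  the real even Clifford algebra that commutes with Clifford multiplication.\<close>

lemma dd_G:
  assumes "y \<in> A.U"
  shows "dd v G y = G y ** spin_form X b (\<phi> y) (J y v) - spin_form X a y v ** G y"
proof -
  note B = transition_in[OF assms]
  define S S' dG sb sa where "S = G y" and "S' = adj (G y)" and "dG = dd v G y"
    and "sb = spin_form X b (\<phi> y) (J y v)" and "sa = spin_form X a y v"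
  have inv: "S ** S' = mat 1" "S' ** S = mat 1" by (simp_all add: S_def S'_def G_unitary[OF assms])
  have invm: "S ** (S' ** M) = M" "S' ** (S ** M) = M" for M by (simp_all add: matrix_mul_assoc inv)
  \<comment> \<open>\<open>S'\<close> is the inverse of \<open>S\<close>, so the claim says that
    \<open>E ** S\<close> vanishes.\<close>
  define E where "E = dG ** S' - S ** sb ** S' + sa"
  have comm: "E ** clifford X a y w = clifford X a y w ** E" for w
  proof -
    \<comment> \<open>The constant field \<open>w\<close> of the chart \<open>a\<close>, expressed
      in the chart \<open>b\<close>, where it is in general variable.\<close>
    define V where "V z' = dd w \<phi> (\<phi>' z')" for z'
    have V: "V (\<phi> z) = J z w" if "z \<in> A.U" for z by (simp add: V_def transition_inverse[OF that])
    have dV: "V differentiable (at (\<phi> y))"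
      unfolding V_def
      by (rule differentiable_compose_at[OF transition_differentiable'[OF B]])
        (simp add: transition_inverse[OF assms] dd_J_differentiable assms)
    have ddV: "dd (J y v) V (\<phi> y) = dd v (\<lambda>z. J z w) y"
      using dd_compose[OF transition_differentiable[OF assms] dV, where v = v]
        dd_cong[OF A.open_U assms, of "\<lambda>z. V (\<phi> z)" "\<lambda>z. J z w" v, OF V] by simp
    let ?K = "\<lambda>z'. clifford X b z' (V z')"
    have dK: "?K differentiable (at (\<phi> y))"
      unfolding B.clifford_gprod B.gprod_def
      by (intro differentiable_sum ballI finite_class.finite_UNIV differentiable_scaleR_fun
          differentiable_bounded_bilinear[OF bounded_bilinear_inner]
          differentiable_matrix_vector_mult differentiable_const
          B.frame_differentiable B dV smooth_on_differentiable[OF B.smooth_metric B])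
    let ?C = "clifford X a y w" and ?Cb = "clifford X b (\<phi> y) (J y w)"
    have Kb: "dd (J y v) ?K (\<phi> y) = clifford X b (\<phi> y) (J y (A.Gam y v w)) - (sb ** ?Cb - ?Cb ** sb)"
      using B.clifford_parallel[OF B dV, of "J y v"]
      by (simp add: B.endo_nab_def V[OF assms] B.levi_civita_Gam ddV Gam_transition[OF assms] sb_def algebra_simps)
    have dC: "(\<lambda>z. clifford X a z w) differentiable (at y)"
      by (rule smooth_on_differentiable[OF A.smooth_clifford[OF smooth_on_const] assms])
    have Ka: "dd v (\<lambda>z. clifford X a z w) y = clifford X a y (A.Gam y v w) - (sa ** ?C - ?C ** sa)"
      using A.clifford_parallel[OF assms, of "\<lambda>_. w" v]
      by (simp add: A.endo_nab_def A.levi_civita_const sa_def algebra_simps)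
    \<comment> \<open>The derivative of \<open>clifford_transition\<close>. The Levi-Civita terms on
      both sides match by \<open>Gam_transition\<close> and \<open>clifford_transition\<close>, and
      the rest says that \<open>E\<close> commutes with Clifford multiplication.\<close>
    have "dd v (\<lambda>z. G z ** ?K (\<phi> z)) y = dd v (\<lambda>z. clifford X a z w ** G z) y"
      by (rule dd_cong[OF A.open_U assms]) (simp add: V clifford_transition)
    then have "S ** (clifford X b (\<phi> y) (J y (A.Gam y v w)) - (sb ** ?Cb - ?Cb ** sb)) + dG ** ?Cb =
        ?C ** dG + (clifford X a y (A.Gam y v w) - (sa ** ?C - ?C ** sa)) ** S"
      by (simp add: dd_matrix_mult G_differentiable assms dC
          differentiable_compose_at[OF transition_differentiable[OF assms] dK]
          dd_compose[OF transition_differentiable[OF assms] dK] Ka Kb V S_def dG_def)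
    then have "dG ** ?Cb - S ** sb ** ?Cb + S ** ?Cb ** sb = ?C ** dG - sa ** ?C ** S + ?C ** sa ** S"
      using clifford_transition[OF assms, of "A.Gam y v w"]
      by (simp add: S_def[symmetric] matrix_mult_distribs matrix_mul_assoc algebra_simps)
    moreover have SC: "S ** ?Cb = ?C ** S" and "?Cb = S' ** ?C ** S"
      using clifford_transition[OF assms, of w] invm(2)[of ?Cb]
      by (simp_all add: S_def[symmetric] matrix_mul_assoc[symmetric])
    ultimately have "dG ** S' ** ?C ** S - S ** sb ** S' ** ?C ** S + ?C ** S ** sb = ?C ** dG - sa ** ?C ** S + ?C ** sa ** S"
      by (simp add: matrix_mul_assoc inv(1))
    then have "(dG ** S' ** ?C ** S - S ** sb ** S' ** ?C ** S + ?C ** S ** sb) ** S' = (?C ** dG - sa ** ?C ** S + ?C ** sa ** S) ** S'"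
      by simp
    then have "dG ** S' ** ?C - S ** sb ** S' ** ?C + ?C ** S ** sb ** S' = ?C ** dG ** S' - sa ** ?C + ?C ** sa"
      by (simp add: matrix_mult_distribs matrix_mul_assoc[symmetric] inv)
    then show ?thesis
      by (simp add: E_def matrix_mult_distribs matrix_mul_assoc algebra_simps)
  qed
  have "gamma X i ** E = E ** gamma X i" for i
    using comm[of "frame X a i y"] by (simp add: A.clifford_frame[OF assms])
  moreover have "E \<in> even_part"
  proof -
    have "dG \<in> even_part"
      unfolding dG_def
      by (rule dd_in_subspace[OF subspace_even_part A.open_U assms _ G_differentiable[OF assms]])
        (rule spin_group_even_part[OF lift_props(1)])
    moreover have "S \<in> even_part" "S' \<in> even_part"
      using lift_props(1)[OF assms]
      by (simp_all add: S_def S'_def spin_group_even_part spin_group_adj_even_part)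
    moreover have "sa \<in> even_part" "sb \<in> even_part"
      unfolding sa_def sb_def
      by (intro bivectors_even_part A.spin_form_in_bivectors B.spin_form_in_bivectors assms B)+
    ultimately show ?thesis
      unfolding E_def by (intro subspace_add subspace_diff subspace_even_part mult_in_even_part)
  qed
  moreover have "adj E = - E"
  proof -
    \<comment> \<open>Differentiating the unitarity of the lift shows that \<open>dG ** S'\<close>
      is skew.\<close>
    have "dd v (\<lambda>z. G z ** adj (G z)) y = dd v (\<lambda>z. mat 1) y"
      by (rule dd_cong[OF A.open_U assms G_unitary(1)])
    then have "S ** adj dG + dG ** S' = 0"
      by (simp add: dd_matrix_mult G_differentiable assms differentiable_bounded_linear[OF bounded_linear_adj]
          dd_bounded_linear[OF bounded_linear_adj] S_def S'_def dG_def)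
    then have "S ** adj dG = - (dG ** S')" by (simp add: eq_neg_iff_add_eq_0)
    moreover have "adj sa = - sa" "adj sb = - sb"
      unfolding sa_def sb_def by (intro bivectors_skew A.spin_form_in_bivectors B.spin_form_in_bivectors assms B)+
    ultimately show ?thesis
      by (simp add: E_def linear_add[OF linear_adj] linear_diff[OF linear_adj] adj_mult S'_def S_def[symmetric]
          matrix_mult_distribs matrix_mul_assoc)
  qed
  ultimately have "E = 0" by (intro even_central_skew_eq_0)
  then have "(dG ** S' - S ** sb ** S' + sa) ** S = 0" by (simp add: E_def matrix_mult_zeros)
  then have "dG - S ** sb + sa ** S = 0"
    by (simp add: matrix_mult_distribs matrix_mul_assoc[symmetric] inv)
  then show ?thesis by (simp add: dG_def S_def sb_def sa_def algebra_simps)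
qed

lemma nab_transition:
  assumes "y \<in> A.U" "\<xi> differentiable (at (\<phi> y))"
  shows "A.nab v (\<lambda>z. G z *v \<xi> (\<phi> z)) y = G y *v B.nab (J y v) \<xi> (\<phi> y)"
  unfolding A.nab_def B.nab_def
  by (simp add: dd_matrix_vector_mult G_differentiable assms dd_G
      differentiable_compose_at[OF transition_differentiable[OF assms(1)] assms(2)]
      dd_compose[OF transition_differentiable[OF assms(1)] assms(2)]
      matrix_vector_distribs matrix_vector_mul_assoc)

section \<open>Naturality of the Dirac operator and of the twisted Laplacian\<close>

lemma frame_pullback_orthonormal:
  assumes "y \<in> A.U"
  shows "A.gprod y (dd (frame X b s (\<phi> y)) \<phi>' (\<phi> y)) (dd (frame X b t (\<phi> y)) \<phi>' (\<phi> y)) = (if s = t then 1 else 0)"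
  by (simp add: gprod_transition[OF assms] J_inverse'[OF assms] B.frame_orthonormal[OF transition_in[OF assms]])

text \<open>Both sums equal the trace against the inverse metric of the chart \<open>a\<close>, one
  through the frame of \<open>a\<close> and one through the frame of \<open>b\<close> carried
  back.\<close>

lemma frame_trace:
  fixes Q :: "real ^ 'n \<Rightarrow> real ^ 'n \<Rightarrow> 'b::real_vector"
  assumes "y \<in> A.U" "\<And>w. linear (\<lambda>v. Q v w)" "\<And>v. linear (Q v)"
  shows "(\<Sum>s\<in>UNIV. Q (dd (frame X b s (\<phi> y)) \<phi>' (\<phi> y)) (dd (frame X b s (\<phi> y)) \<phi>' (\<phi> y))) =
    (\<Sum>s\<in>UNIV. Q (frame X a s y) (frame X a s y))"
  using A.trace_orthonormal[OF assms(1) frame_pullback_orthonormal[OF assms(1)] assms(2,3)]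
    A.trace_frame[OF assms] by simp

text \<open>Moving the lift past the generators turns them into Clifford multiplication by the frame
  of \<open>b\<close> carried back, and the resulting trace may be taken in the frame of
  \<open>a\<close> instead.\<close>

lemma dirac_loc_transition:
  assumes "y \<in> A.U" "smooth_on A.U u" "smooth_on B.U \<xi>" "\<And>z. z \<in> A.U \<Longrightarrow> u z = G z *v \<xi> (\<phi> z)"
  shows "A.dirac_loc u y = G y *v B.dirac_loc \<xi> (\<phi> y)"
proof -
  note B = transition_in[OF assms(1)]
  have d: "\<xi> differentiable (at (\<phi> y))" by (rule smooth_on_differentiable[OF assms(3) B])
  let ?f = "\<lambda>s. dd (frame X b s (\<phi> y)) \<phi>' (\<phi> y)"
  have "A.nab v u y = A.nab v (\<lambda>z. G z *v \<xi> (\<phi> z)) y" for v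
    by (rule A.nab_cong[OF assms(1,4)])
  then have nab: "A.nab v u y = G y *v B.nab (J y v) \<xi> (\<phi> y)" for v
    by (simp add: nab_transition[OF assms(1) d])
  have "G y *v B.dirac_loc \<xi> (\<phi> y) = (\<Sum>s\<in>UNIV. (G y ** gamma X s) *v B.nab (J y (?f s)) \<xi> (\<phi> y))"
    by (simp add: B.dirac_loc_def matrix_vector_sums matrix_vector_mul_assoc J_inverse'[OF assms(1)])
  also have "\<dots> = (\<Sum>s\<in>UNIV. clifford X a y (?f s) *v A.nab (?f s) u y)"
    by (simp add: lift_props(2)[OF assms(1)] nab matrix_vector_mul_assoc)
  also have "\<dots> = (\<Sum>s\<in>UNIV. clifford X a y (frame X a s y) *v A.nab (frame X a s y) u y)"
  proof (rule frame_trace[OF assms(1), where Q = "\<lambda>v w. clifford X a y v *v A.nab w u y"])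
    show "linear (\<lambda>v. clifford X a y v *v A.nab w u y)" for w
      by (rule linearI) (simp_all add: linear_add[OF A.linear_clifford] linear_scale[OF A.linear_clifford] matrix_vector_distribs)
    show "linear (\<lambda>w. clifford X a y v *v A.nab w u y)" for v
      by (rule linearI) (simp_all add: linear_add[OF A.linear_nab[OF assms(1,2)]]
          linear_scale[OF A.linear_nab[OF assms(1,2)]] matrix_vector_distribs)
  qed
  also have "\<dots> = A.dirac_loc u y"
    by (simp add: A.dirac_loc_def A.clifford_frame[OF assms(1)])
  finally show ?thesis by simp
qed

lemma pot_transition:
  assumes "y \<in> A.U" "\<Phi>a y ** G y = G y ** \<Phi>b (\<phi> y)" "\<Psi>a y ** G y = G y ** \<Psi>b (\<phi> y)"
  shows "A.pot \<Phi>a \<Psi>a y v ** G y = G y ** B.pot \<Phi>b \<Psi>b (\<phi> y) (J y v)"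
proof -
  note cl = clifford_transition[OF assms(1), of v]
  have "A.pot \<Phi>a \<Psi>a y v ** G y = clifford X a y v ** (\<Phi>a y ** G y) + \<Psi>a y ** (clifford X a y v ** G y)"
    by (simp add: A.pot_def matrix_mult_distribs matrix_mul_assoc)
  also have "\<dots> = (clifford X a y v ** G y) ** \<Phi>b (\<phi> y) + (\<Psi>a y ** G y) ** clifford X b (\<phi> y) (J y v)"
    by (simp add: assms(2) cl[symmetric] matrix_mul_assoc)
  also have "\<dots> = G y ** B.pot \<Phi>b \<Psi>b (\<phi> y) (J y v)"
    unfolding assms(3) cl[symmetric] by (simp add: B.pot_def matrix_mult_distribs matrix_mul_assoc)
  finally show ?thesis .
qed

lemma tw_nab_transition:
  assumes "y \<in> A.U" "\<xi> differentiable (at (\<phi> y))"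
    "\<Phi>a y ** G y = G y ** \<Phi>b (\<phi> y)" "\<Psi>a y ** G y = G y ** \<Psi>b (\<phi> y)"
    "\<And>z. z \<in> A.U \<Longrightarrow> u z = G z *v \<xi> (\<phi> z)"
  shows "A.tw_nab \<Phi>a \<Psi>a v u y = G y *v B.tw_nab \<Phi>b \<Psi>b (J y v) \<xi> (\<phi> y)"
proof -
  have "A.nab v u y = A.nab v (\<lambda>z. G z *v \<xi> (\<phi> z)) y"
    by (rule A.nab_cong[OF assms(1,5)])
  then show ?thesis
    by (simp add: A.tw_nab_def B.tw_nab_def nab_transition[OF assms(1,2)] assms(1,5) matrix_vector_distribs
        matrix_vector_mul_assoc pot_transition[where \<Phi>a = \<Phi>a and \<Phi>b = \<Phi>b and \<Psi>a = \<Psi>a and \<Psi>b = \<Psi>b, OF assms(1,3,4)])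
qed

text \<open>The constant field \<open>w\<close> of \<open>a\<close> is variable in \<open>b\<close>.
  The derivative of its components adds a first-order term, which is exactly the inhomogeneous term
  in the transformation law of the Christoffel symbols.\<close>

lemma tw_hess_transition:
  assumes "y \<in> A.U" "smooth_on A.U u" "smooth_on B.U \<xi>" "\<And>z. z \<in> A.U \<Longrightarrow> u z = G z *v \<xi> (\<phi> z)"
    and smooth: "smooth_on A.U \<Phi>a" "smooth_on A.U \<Psi>a" "smooth_on B.U \<Phi>b" "smooth_on B.U \<Psi>b"
    and natural: "\<And>z. z \<in> A.U \<Longrightarrow> \<Phi>a z ** G z = G z ** \<Phi>b (\<phi> z)" "\<And>z. z \<in> A.U \<Longrightarrow> \<Psi>a z ** G z = G z ** \<Psi>b (\<phi> z)"
  shows "A.tw_hess \<Phi>a \<Psi>a v w u y = G y *v B.tw_hess \<Phi>b \<Psi>b (J y v) (J y w) \<xi> (\<phi> y)"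
proof -
  note B = transition_in[OF assms(1)]
  have d\<xi>: "\<xi> differentiable (at (\<phi> z))" if "z \<in> A.U" for z
    by (rule smooth_on_differentiable[OF assms(3) transition_in[OF that]])
  define V where "V z' = dd w \<phi> (\<phi>' z')" for z'
  have V: "V (\<phi> z) = J z w" if "z \<in> A.U" for z by (simp add: V_def transition_inverse[OF that])
  have dV: "V differentiable (at (\<phi> y))"
    unfolding V_def
    by (rule differentiable_compose_at[OF transition_differentiable'[OF B]])
      (simp add: transition_inverse[OF assms(1)] dd_J_differentiable assms(1))
  have ddV: "dd (J y v) V (\<phi> y) = dd v (\<lambda>z. J z w) y"
    using dd_compose[OF transition_differentiable[OF assms(1)] dV, where v = v]
      dd_cong[OF A.open_U assms(1), of "\<lambda>z. V (\<phi> z)" "\<lambda>z. J z w" v, OF V] by simp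
  let ?K = "\<lambda>z'. B.tw_nab \<Phi>b \<Psi>b (V z') \<xi> z'"
  have dK: "?K differentiable (at (\<phi> y))"
  proof (rule differentiable_cong_open[OF _ B.open_U B])
    have "B.tw_nab \<Phi>b \<Psi>b (axis i 1) \<xi> differentiable (at (\<phi> y))" for i
      by (rule smooth_on_differentiable[OF _ B])
        (use B.smooth_tw_nab[OF smooth(3,4) smooth_on_const assms(3), of "axis i 1"] in simp)
    then show "(\<lambda>z'. \<Sum>i\<in>UNIV. V z' $ i *\<^sub>R B.tw_nab \<Phi>b \<Psi>b (axis i 1) \<xi> z') differentiable (at (\<phi> y))"
      by (intro differentiable_sum ballI finite_class.finite_UNIV differentiable_scaleR_fun
          differentiable_bounded_linear[OF bounded_linear_vec_nth dV]) simp_all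
    show "(\<Sum>i\<in>UNIV. V z' $ i *\<^sub>R B.tw_nab \<Phi>b \<Psi>b (axis i 1) \<xi> z') = ?K z'" if "z' \<in> B.U" for z'
      by (rule linear_axis_expansion[symmetric, OF B.linear_tw_nab[OF that assms(3)]])
  qed
  have first: "A.tw_nab \<Phi>a \<Psi>a w u z = G z *v ?K (\<phi> z)" if "z \<in> A.U" for z
    using tw_nab_transition[where \<Phi>a = \<Phi>a and \<Phi>b = \<Phi>b and \<Psi>a = \<Psi>a and \<Psi>b = \<Psi>b, OF that d\<xi>[OF that] natural(1)[OF that] natural(2)[OF that] assms(4), of w] V[OF that] by simp
  have "A.tw_nab \<Phi>a \<Psi>a v (A.tw_nab \<Phi>a \<Psi>a w u) y = G y *v B.tw_nab \<Phi>b \<Psi>b (J y v) ?K (\<phi> y)"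
    by (rule tw_nab_transition[where \<Phi>a = \<Phi>a and \<Phi>b = \<Phi>b and \<Psi>a = \<Psi>a and \<Psi>b = \<Psi>b, OF assms(1) dK natural(1)[OF assms(1)] natural(2)[OF assms(1)] first])
  also have "B.tw_nab \<Phi>b \<Psi>b (J y v) ?K (\<phi> y) =
      B.tw_nab \<Phi>b \<Psi>b (J y v) (B.tw_nab \<Phi>b \<Psi>b (J y w) \<xi>) (\<phi> y) + B.tw_nab \<Phi>b \<Psi>b (dd v (\<lambda>z. J z w) y) \<xi> (\<phi> y)"
    using B.tw_nab_tw_nab_along[OF B dV assms(3) smooth(3,4), of "J y v"] by (simp add: V[OF assms(1)] ddV)
  finally have 1: "A.tw_nab \<Phi>a \<Psi>a v (A.tw_nab \<Phi>a \<Psi>a w u) y = G y *v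
    (B.tw_nab \<Phi>b \<Psi>b (J y v) (B.tw_nab \<Phi>b \<Psi>b (J y w) \<xi>) (\<phi> y) + B.tw_nab \<Phi>b \<Psi>b (dd v (\<lambda>z. J z w) y) \<xi> (\<phi> y))" .
  \<comment> \<open>\<open>Gam_transition\<close> splits this correction into the same inhomogeneous
    term, which cancels, and the correction that belongs to the chart \<open>b\<close>.\<close>
  have "A.tw_nab \<Phi>a \<Psi>a (A.Gam y v w) u y = G y *v B.tw_nab \<Phi>b \<Psi>b (J y (A.Gam y v w)) \<xi> (\<phi> y)"
    by (rule tw_nab_transition[where \<Phi>a = \<Phi>a and \<Phi>b = \<Phi>b and \<Psi>a = \<Psi>a and \<Psi>b = \<Psi>b, OF assms(1) d\<xi>[OF assms(1)] natural(1)[OF assms(1)] natural(2)[OF assms(1)] assms(4)])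
  also have "B.tw_nab \<Phi>b \<Psi>b (J y (A.Gam y v w)) \<xi> (\<phi> y) =
     B.tw_nab \<Phi>b \<Psi>b (dd v (\<lambda>z. J z w) y) \<xi> (\<phi> y) + B.tw_nab \<Phi>b \<Psi>b (B.Gam (\<phi> y) (J y v) (J y w)) \<xi> (\<phi> y)"
    by (simp add: Gam_transition[OF assms(1), symmetric] linear_add[OF B.linear_tw_nab[OF B assms(3)]])
  finally show ?thesis
    unfolding A.tw_hess_def B.tw_hess_def 1 by (simp add: matrix_vector_distribs)
qed

lemma tw_hess_trace_transition:
  assumes "y \<in> A.U" "smooth_on A.U u" "smooth_on B.U \<xi>" "\<And>z. z \<in> A.U \<Longrightarrow> u z = G z *v \<xi> (\<phi> z)"
    and smooth: "smooth_on A.U \<Phi>a" "smooth_on A.U \<Psi>a" "smooth_on B.U \<Phi>b" "smooth_on B.U \<Psi>b"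
    and natural: "\<And>z. z \<in> A.U \<Longrightarrow> \<Phi>a z ** G z = G z ** \<Phi>b (\<phi> z)" "\<And>z. z \<in> A.U \<Longrightarrow> \<Psi>a z ** G z = G z ** \<Psi>b (\<phi> z)"
  shows "(\<Sum>s\<in>UNIV. A.tw_hess \<Phi>a \<Psi>a (frame X a s y) (frame X a s y) u y) =
    G y *v (\<Sum>s\<in>UNIV. B.tw_hess \<Phi>b \<Psi>b (frame X b s (\<phi> y)) (frame X b s (\<phi> y)) \<xi> (\<phi> y))"
proof -
  let ?f = "\<lambda>s. dd (frame X b s (\<phi> y)) \<phi>' (\<phi> y)"
  have "(\<Sum>s\<in>UNIV. A.tw_hess \<Phi>a \<Psi>a (frame X a s y) (frame X a s y) u y) = (\<Sum>s\<in>UNIV. A.tw_hess \<Phi>a \<Psi>a (?f s) (?f s) u y)"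
    by (rule frame_trace[OF assms(1), where Q = "\<lambda>v w. A.tw_hess \<Phi>a \<Psi>a v w u y", symmetric])
      (rule A.linear_tw_hess[OF assms(1,2) smooth(1,2)])+
  also have "\<dots> = (\<Sum>s\<in>UNIV. G y *v B.tw_hess \<Phi>b \<Psi>b (frame X b s (\<phi> y)) (frame X b s (\<phi> y)) \<xi> (\<phi> y))"
  proof (rule sum.cong[OF refl])
    fix s
    have "A.tw_hess \<Phi>a \<Psi>a (?f s) (?f s) u y = G y *v B.tw_hess \<Phi>b \<Psi>b (J y (?f s)) (J y (?f s)) \<xi> (\<phi> y)"
      by (rule tw_hess_transition[OF assms])
    then show "A.tw_hess \<Phi>a \<Psi>a (?f s) (?f s) u y = G y *v B.tw_hess \<Phi>b \<Psi>b (frame X b s (\<phi> y)) (frame X b s (\<phi> y)) \<xi> (\<phi> y)"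
      unfolding J_inverse'[OF assms(1)] .
  qed
  finally show ?thesis by (simp add: matrix_vector_sums)
qed

end

section \<open>Sections, connections and Laplacians on the spinor bundle\<close>

context spin_transition begin

lemma section_transition:
  assumes "spinor_section X W \<psi>" "N \<subseteq> W" "z \<in> A.U"
  shows "\<psi> a z = G z *v \<psi> b (\<phi> z)"
proof -
  obtain x where x: "x \<in> N" "z = chart X a x" "\<phi> z = chart X b x" using assms(3) by (rule UE)
  have "point X a z = x" using x N point_chart[OF a] by auto
  moreover have "\<psi> a (chart X a x) = lift X a b x *v \<psi> b (chart X b x)"
    using assms(1,2) a b N x(1) unfolding spinor_section_def by blast
  ultimately show ?thesis using x by simp
qed

lemma endo_transition:
  assumes "spinor_endo X \<Phi>" "z \<in> A.U"
  shows "\<Phi> a z ** G z = G z ** \<Phi> b (\<phi> z)"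
proof -
  obtain x where x: "x \<in> N" "z = chart X a x" "\<phi> z = chart X b x" using assms(2) by (rule UE)
  have "point X a z = x" using x N point_chart[OF a] by auto
  moreover have "\<Phi> a (chart X a x) ** lift X a b x = lift X a b x ** \<Phi> b (chart X b x)"
    using assms(1) a b N x(1) unfolding spinor_endo_def by blast
  ultimately show ?thesis using x by simp
qed

end

context spin_chart begin

lemma smooth_section: "spinor_section X W \<psi> \<Longrightarrow> N \<subseteq> W \<Longrightarrow> smooth_on U (\<psi> a)"
  using a unfolding spinor_section_def by (blast intro: smooth_on_subset)

lemma smooth_endo: "spinor_endo X \<Phi> \<Longrightarrow> smooth_on U (\<Phi> a)"
  using a unfolding spinor_endo_def by (blast intro: smooth_on_subset)

lemma endo_deriv_endo_nab: "endo_deriv X \<Phi> j a y = endo_nab (e j y) (\<Phi> a) y"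
  by (simp add: endo_deriv_def endo_nab_def dd_def)

end

context spin_manifold begin

lemma spin_chartI: "a \<in> index X \<Longrightarrow> open N \<Longrightarrow> spin_chart X a N"
  by unfold_locales

lemma spin_transitionI:
  "a \<in> index X \<Longrightarrow> b \<in> index X \<Longrightarrow> open N \<Longrightarrow> N \<subseteq> chart_dom X a \<inter> chart_dom X b \<Longrightarrow> spin_transition X a b N"
  by unfold_locales

lemma open_chart_dom: "a \<in> index X \<Longrightarrow> open (chart_dom X a)"
  using atlas unfolding oriented_atlas_def by blast

lemma spinor_sectionI:
  assumes "open W" "\<And>a. a \<in> index X \<Longrightarrow> smooth_on (chart X a ` (chart_dom X a \<inter> W)) (\<psi> a)"
    and "\<And>a b x. a \<in> index X \<Longrightarrow> b \<in> index X \<Longrightarrow> x \<in> chart_dom X a \<Longrightarrow> x \<in> chart_dom X b \<Longrightarrow> x \<in> W \<Longrightarrow>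
      \<psi> a (chart X a x) = lift X a b x *v \<psi> b (chart X b x)"
  shows "spinor_section X W \<psi>"
  using assms unfolding spinor_section_def by blast

definition dirac_pot ::
    "('a \<Rightarrow> real ^ 'n \<Rightarrow> complex ^ 'k ^ 'k) \<Rightarrow> ('a \<Rightarrow> real ^ 'n \<Rightarrow> complex ^ 'k) \<Rightarrow> 'a \<Rightarrow> real ^ 'n \<Rightarrow> complex ^ 'k" where
  "dirac_pot \<Phi> \<psi> a y = dirac X \<psi> a y + \<Phi> a y *v \<psi> a y"

text \<open>Having sections as values lets two such operators be composed and makes the composite
  natural, from which the naturality of its zeroth order term is deduced.\<close>

lemma section_dirac_pot:
  assumes "spinor_section X W \<psi>" "spinor_endo X \<Phi>"
  shows "spinor_section X W (dirac_pot \<Phi> \<psi>)"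
proof (rule spinor_sectionI)
  show W: "open W" using assms(1) by (simp add: spinor_section_def)
  show "smooth_on (chart X a ` (chart_dom X a \<inter> W)) (dirac_pot \<Phi> \<psi> a)" if a: "a \<in> index X" for a
  proof -
    interpret A: spin_chart X a W by (rule spin_chartI[OF a W])
    note s = A.smooth_section[OF assms(1) order_refl]
    have "dirac_pot \<Phi> \<psi> a = (\<lambda>y. A.dirac_loc (\<psi> a) y + \<Phi> a y *v \<psi> a y)"
      by (simp add: fun_eq_iff dirac_pot_def A.dirac_eq_loc)
    then show ?thesis
      by (auto intro!: smooth_intros A.open_U A.smooth_dirac_loc s A.smooth_endo assms)
  qed
  show "dirac_pot \<Phi> \<psi> a (chart X a x) = lift X a b x *v dirac_pot \<Phi> \<psi> b (chart X b x)"
    if a: "a \<in> index X" and b: "b \<in> index X" and x: "x \<in> chart_dom X a" "x \<in> chart_dom X b" "x \<in> W" for a b x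
  proof -
    define N where "N = chart_dom X a \<inter> chart_dom X b \<inter> W"
    interpret T: spin_transition X a b N
      by (rule spin_transitionI[OF a b]) (auto simp: N_def intro: open_chart_dom a b W)
    have NW: "N \<subseteq> W" by (auto simp: N_def)
    have y: "chart X a x \<in> T.A.U" using x by (auto simp: N_def)
    have p: "point X a (chart X a x) = x" using point_chart[OF a x(1)] .
    have t: "transition X a b (chart X a x) = chart X b x" by (simp add: transition_def p)
    have "T.A.dirac_loc (\<psi> a) (chart X a x) = lift X a b x *v T.B.dirac_loc (\<psi> b) (chart X b x)"
      using T.dirac_loc_transition[OF y T.A.smooth_section[OF assms(1) NW] T.B.smooth_section[OF assms(1) NW]
          T.section_transition[OF assms(1) NW]] by (simp add: p t)
    moreover have "\<Phi> a (chart X a x) *v \<psi> a (chart X a x) = lift X a b x *v (\<Phi> b (chart X b x) *v \<psi> b (chart X b x))"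
      using T.section_transition[OF assms(1) NW y] T.endo_transition[OF assms(2) y]
      by (simp add: p t matrix_vector_mul_assoc)
    ultimately show ?thesis
      by (simp add: dirac_pot_def T.A.dirac_eq_loc T.B.dirac_eq_loc matrix_vector_distribs)
  qed
qed

definition twisted_form ::
    "('a \<Rightarrow> real ^ 'n \<Rightarrow> complex ^ 'k ^ 'k) \<Rightarrow> ('a \<Rightarrow> real ^ 'n \<Rightarrow> complex ^ 'k ^ 'k) \<Rightarrow>
      'a \<Rightarrow> 'n \<Rightarrow> real ^ 'n \<Rightarrow> complex ^ 'k ^ 'k" where
  "twisted_form \<Phi> \<Psi> a i y = (if a \<in> index X \<and> y \<in> chart X a ` chart_dom X a
     then spin_form X a y (axis i 1) - (1 / 2) *\<^sub>R
       (clifford X a y (axis i 1) ** \<Phi> a y + \<Psi> a y ** clifford X a y (axis i 1)) else 0)"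

end

context spin_chart begin

lemma cov_twisted_form:
  "y \<in> U \<Longrightarrow> cov (twisted_form \<Phi> \<Psi>) a i u y = tw_nab (\<Phi> a) (\<Psi> a) (axis i 1) u y"
  using a U_subset
  by (auto simp: cov_def twisted_form_def tw_nab_def nab_def pot_def pd_eq_dd matrix_vector_distribs)

lemma connection_laplacian_twisted_form:
  assumes "y \<in> U" "smooth_on U (\<psi> a)" "smooth_on U (\<Phi> a)" "smooth_on U (\<Psi> a)"
  shows "connection_laplacian X (twisted_form \<Phi> \<Psi>) \<psi> a y = (\<Sum>s\<in>UNIV. tw_hess (\<Phi> a) (\<Psi> a) (e s y) (e s y) (\<psi> a) y)"
proof -
  let ?T = "tw_nab (\<Phi> a) (\<Psi> a)"
  have cov2: "cov (twisted_form \<Phi> \<Psi>) a i (cov (twisted_form \<Phi> \<Psi>) a j (\<psi> a)) y = ?T (axis i 1) (?T (axis j 1) (\<psi> a)) y" for i j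
  proof -
    \<comment> \<open>The inner covariant derivative is known only on \<open>U\<close>; as
      \<open>U\<close> is open, this suffices for differentiating once more.\<close>
    have "nab v (cov (twisted_form \<Phi> \<Psi>) a j (\<psi> a)) y = nab v (?T (axis j 1) (\<psi> a)) y" for v
      by (rule nab_cong[OF assms(1) cov_twisted_form])
    then show ?thesis
      unfolding cov_twisted_form[OF assms(1)] tw_nab_def[of _ _ "axis i 1"] using cov_twisted_form[OF assms(1)] by simp
  qed
  have "(\<Sum>l\<in>UNIV. christoffel X a l i j y *\<^sub>R cov (twisted_form \<Phi> \<Psi>) a l (\<psi> a) y) =
      ?T (Gam y (axis i 1) (axis j 1)) (\<psi> a) y" for i j
    unfolding cov_twisted_form[OF assms(1)] Gam_axis[symmetric]
    by (rule linear_axis_expansion[symmetric, OF linear_tw_nab[OF assms(1,2)]])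
  with cov2 have "connection_laplacian X (twisted_form \<Phi> \<Psi>) \<psi> a y =
      (\<Sum>i\<in>UNIV. \<Sum>j\<in>UNIV. inv_metric X a y $ i $ j *\<^sub>R tw_hess (\<Phi> a) (\<Psi> a) (axis i 1) (axis j 1) (\<psi> a) y)"
    by (simp add: connection_laplacian_def tw_hess_def)
  also have "\<dots> = (\<Sum>s\<in>UNIV. tw_hess (\<Phi> a) (\<Psi> a) (e s y) (e s y) (\<psi> a) y)"
    by (rule trace_frame[OF assms(1), where B = "\<lambda>v w. tw_hess (\<Phi> a) (\<Psi> a) v w (\<psi> a) y"])
      (rule linear_tw_hess[OF assms])+
  finally show ?thesis .
qed

lemma smooth_connection_laplacian_twisted_form:
  assumes "smooth_on U (\<psi> a)" "smooth_on U (\<Phi> a)" "smooth_on U (\<Psi> a)"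
  shows "smooth_on U (connection_laplacian X (twisted_form \<Phi> \<Psi>) \<psi> a)"
proof (rule smooth_on_cong[OF open_U])
  have "smooth_on U (\<lambda>y. tw_nab (\<Phi> a) (\<Psi> a) (axis j 1) (\<psi> a) y)" for j
    by (rule smooth_tw_nab[OF assms(2,3) smooth_on_const assms(1)])
  then have "smooth_on U (\<lambda>y. tw_hess (\<Phi> a) (\<Psi> a) (axis i 1) (axis j 1) (\<psi> a) y)" for i j
    unfolding tw_hess_def
    by (intro smooth_intros open_U smooth_tw_nab assms smooth_Gam)
  then show "smooth_on U (\<lambda>y. \<Sum>i\<in>UNIV. \<Sum>j\<in>UNIV. inv_metric X a y $ i $ j *\<^sub>R tw_hess (\<Phi> a) (\<Psi> a) (axis i 1) (axis j 1) (\<psi> a) y)"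
    by (intro smooth_intros open_U smooth_inv_metric)
  fix y assume y: "y \<in> U"
  show "(\<Sum>i\<in>UNIV. \<Sum>j\<in>UNIV. inv_metric X a y $ i $ j *\<^sub>R tw_hess (\<Phi> a) (\<Psi> a) (axis i 1) (axis j 1) (\<psi> a) y) =
      connection_laplacian X (twisted_form \<Phi> \<Psi>) \<psi> a y"
    unfolding connection_laplacian_twisted_form[where \<psi> = \<psi> and \<Phi> = \<Phi> and \<Psi> = \<Psi>, OF y assms]
    by (rule trace_frame[OF y, where B = "\<lambda>v w. tw_hess (\<Phi> a) (\<Psi> a) v w (\<psi> a) y"])
      (rule linear_tw_hess[OF y assms])+
qed

end

context spin_manifold begin

lemma spinor_connection_twisted_form:
  assumes "spinor_endo X \<Phi>" "spinor_endo X \<Psi>"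
  shows "spinor_connection X (twisted_form \<Phi> \<Psi>)"
  unfolding spinor_connection_def
proof (intro conjI allI impI ballI)
  show "twisted_form \<Phi> \<Psi> a i y = 0" if "a \<notin> index X \<or> y \<notin> chart X a ` chart_dom X a" for a i y
    using that by (auto simp: twisted_form_def)
  show "smooth_on (chart X a ` chart_dom X a) (twisted_form \<Phi> \<Psi> a i)" if a: "a \<in> index X" for a i
  proof -
    interpret A: spin_chart X a UNIV by (rule spin_chartI[OF a open_UNIV])
    have "smooth_on A.U (twisted_form \<Phi> \<Psi> a i)"
    proof (rule smooth_on_cong[OF A.open_U])
      show "smooth_on A.U (\<lambda>y. spin_form X a y (axis i 1) - (1 / 2) *\<^sub>R A.pot (\<Phi> a) (\<Psi> a) y (axis i 1))"
        by (intro smooth_intros A.open_U A.smooth_spin_form A.smooth_pot A.smooth_endo assms)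
    qed (use a in \<open>auto simp: twisted_form_def A.pot_def\<close>)
    then show ?thesis by simp
  qed
  fix W \<psi> a b x i
  assume s: "spinor_section X W \<psi>" and a: "a \<in> index X" and b: "b \<in> index X"
    and x: "x \<in> chart_dom X a \<inter> chart_dom X b \<inter> W"
  let ?\<theta> = "twisted_form \<Phi> \<Psi>"
  define N where "N = chart_dom X a \<inter> chart_dom X b \<inter> W"
  have W: "open W" using s by (simp add: spinor_section_def)
  interpret T: spin_transition X a b N
    by (rule spin_transitionI[OF a b]) (auto simp: N_def intro: open_chart_dom a b W)
  have NW: "N \<subseteq> W" and xN: "x \<in> N" using x by (auto simp: N_def)
  have y: "chart X a x \<in> T.A.U" using x by (auto simp: N_def)
  have p: "point X a (chart X a x) = x" using point_chart[OF a] x by auto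
  have t: "transition X a b (chart X a x) = chart X b x" by (simp add: transition_def p)
  have yb: "chart X b x \<in> T.B.U" using T.transition_in[OF y] by (simp add: t)
  \<comment> \<open>The \<open>i\<close>-th coordinate vector of the chart \<open>b\<close>,
    expressed in the chart \<open>a\<close>; its components form a column of the Jacobian.\<close>
  let ?v = "dd (axis i 1) (transition X b a) (chart X b x)"
  have "T.A.tw_nab (\<Phi> a) (\<Psi> a) ?v (\<psi> a) (chart X a x) =
      lift X a b x *v T.B.tw_nab (\<Phi> b) (\<Psi> b) (axis i 1) (\<psi> b) (chart X b x)"
    using T.tw_nab_transition[where \<Phi>a = "\<Phi> a" and \<Phi>b = "\<Phi> b" and \<Psi>a = "\<Psi> a" and \<Psi>b = "\<Psi> b" and u = "\<psi> a" and \<xi> = "\<psi> b" and v = ?v,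
        OF y smooth_on_differentiable[OF T.B.smooth_section[OF s NW] T.transition_in[OF y]]
        T.endo_transition[OF assms(1) y] T.endo_transition[OF assms(2) y] T.section_transition[OF s NW]]
      T.J_inverse'[OF y, of "axis i 1"] by (simp add: p t)
  moreover have "T.A.tw_nab (\<Phi> a) (\<Psi> a) ?v (\<psi> a) (chart X a x) =
     (\<Sum>j\<in>UNIV. jac X b a x $ j $ i *\<^sub>R cov ?\<theta> a j (\<psi> a) (chart X a x))"
  proof -
    have "?v $ j = jac X b a x $ j $ i" for j
      using spin_transition.jac_dd[OF T.flip xN, of "axis i 1", symmetric]
      by (simp add: matrix_vector_mult_basis column_def)
    then show ?thesis
      by (subst linear_axis_expansion[OF T.A.linear_tw_nab[OF y T.A.smooth_section[OF s NW]]])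
        (simp add: T.A.cov_twisted_form[OF y])
  qed
  ultimately show "lift X a b x *v cov ?\<theta> b i (\<psi> b) (chart X b x) =
      (\<Sum>j\<in>UNIV. jac X b a x $ j $ i *\<^sub>R cov ?\<theta> a j (\<psi> a) (chart X a x))"
    by (simp add: T.B.cov_twisted_form[OF yb])
qed

lemma laplacian_transition:
  assumes "spinor_endo X \<Phi>" "spinor_endo X \<Psi>" and s: "spinor_section X W \<psi>"
    and a: "a \<in> index X" and b: "b \<in> index X" and x: "x \<in> chart_dom X a \<inter> chart_dom X b \<inter> W"
  shows "connection_laplacian X (twisted_form \<Phi> \<Psi>) \<psi> a (chart X a x) =
    lift X a b x *v connection_laplacian X (twisted_form \<Phi> \<Psi>) \<psi> b (chart X b x)"
proof -
  define N where "N = chart_dom X a \<inter> chart_dom X b \<inter> W"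
  have W: "open W" using s by (simp add: spinor_section_def)
  interpret T: spin_transition X a b N
    by (rule spin_transitionI[OF a b]) (auto simp: N_def intro: open_chart_dom a b W)
  have NW: "N \<subseteq> W" using x by (auto simp: N_def)
  have y: "chart X a x \<in> T.A.U" using x by (auto simp: N_def)
  have p: "point X a (chart X a x) = x" using point_chart[OF a] x by auto
  have t: "transition X a b (chart X a x) = chart X b x" by (simp add: transition_def p)
  have yb: "chart X b x \<in> T.B.U" using T.transition_in[OF y] by (simp add: t)
  note smA = T.A.smooth_section[OF s NW] T.A.smooth_endo[OF assms(1)] T.A.smooth_endo[OF assms(2)]
  note smB = T.B.smooth_section[OF s NW] T.B.smooth_endo[OF assms(1)] T.B.smooth_endo[OF assms(2)]
  show ?thesis
    unfolding T.A.connection_laplacian_twisted_form[where \<psi> = \<psi> and \<Phi> = \<Phi> and \<Psi> = \<Psi>, OF y smA]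
      T.B.connection_laplacian_twisted_form[where \<psi> = \<psi> and \<Phi> = \<Phi> and \<Psi> = \<Psi>, OF yb smB]
    using T.tw_hess_trace_transition[where \<Phi>a = "\<Phi> a" and \<Phi>b = "\<Phi> b" and \<Psi>a = "\<Psi> a" and \<Psi>b = "\<Psi> b" and u = "\<psi> a" and \<xi> = "\<psi> b",
        OF y smA(1) smB(1) T.section_transition[OF s NW] smA(2,3) smB(2,3)
        T.endo_transition[OF assms(1)] T.endo_transition[OF assms(2)]]
    by (simp add: p t)
qed

section \<open>Test sections\<close>

lemma lift_cocycle:
  "a \<in> index X \<Longrightarrow> b \<in> index X \<Longrightarrow> d \<in> index X \<Longrightarrow> x \<in> chart_dom X a \<Longrightarrow> x \<in> chart_dom X b \<Longrightarrow> x \<in> chart_dom X d \<Longrightarrow>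
    lift X a b x ** lift X b d x = lift X a d x"
  using spin unfolding spin_structure_def by blast

text \<open>The cocycle condition with all indices equal makes this matrix idempotent, and it is
  invertible.\<close>

lemma lift_self:
  assumes "a \<in> index X" "x \<in> chart_dom X a" shows "lift X a a x = mat 1"
proof -
  interpret T: spin_transition X a a "chart_dom X a"
    by (rule spin_transitionI) (auto simp: assms open_chart_dom)
  have y: "chart X a x \<in> T.A.U" using assms(2) by blast
  have inv: "adj (lift X a a x) ** lift X a a x = mat 1"
    using T.G_unitary(2)[OF y] by (simp add: point_chart[OF assms])
  have "lift X a a x = adj (lift X a a x) ** (lift X a a x ** lift X a a x)"
    by (simp add: matrix_mul_assoc inv)
  also have "\<dots> = mat 1"
    using lift_cocycle[OF assms(1,1,1,2,2,2)] inv by simp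
  finally show ?thesis .
qed

definition test_section ::
    "'a \<Rightarrow> (real ^ 'n \<Rightarrow> real) \<Rightarrow> complex ^ 'k \<Rightarrow> 'a \<Rightarrow> real ^ 'n \<Rightarrow> complex ^ 'k" where
  "test_section b h u d z = h (transition X d b z) *\<^sub>R (lift X d b (point X d z) *v u)"

lemma test_section:
  assumes b: "b \<in> index X"
    and h: "\<And>d. d \<in> index X \<Longrightarrow> smooth_on (chart X d ` (chart_dom X d \<inter> chart_dom X b)) (\<lambda>z. h (transition X d b z))"
  shows "spinor_section X (chart_dom X b) (test_section b h u)"
proof (rule spinor_sectionI)
  show "open (chart_dom X b)" by (rule open_chart_dom[OF b])
  show "smooth_on (chart X d ` (chart_dom X d \<inter> chart_dom X b)) (test_section b h u d)" if d: "d \<in> index X" for d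
  proof -
    interpret D: spin_chart X d "chart_dom X b" by (rule spin_chartI[OF d open_chart_dom[OF b]])
    have "smooth_on D.U (\<lambda>y. lift X d b (point X d y))"
      using spin d b unfolding spin_structure_def by blast
    then show ?thesis
      unfolding test_section_def[abs_def] by (intro smooth_intros D.open_U h d)
  qed
  show "test_section b h u d (chart X d x) = lift X d d' x *v test_section b h u d' (chart X d' x)"
    if "d \<in> index X" "d' \<in> index X" "x \<in> chart_dom X d" "x \<in> chart_dom X d'" "x \<in> chart_dom X b" for d d' x
    using that b by (simp add: test_section_def transition_def point_chart matrix_vector_distribs
        matrix_vector_mul_assoc lift_cocycle)
qed

lemma test_section_self:
  "b \<in> index X \<Longrightarrow> z \<in> chart X b ` chart_dom X b \<Longrightarrow> test_section b h u b z = h z *\<^sub>R u"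
  by (auto simp: test_section_def transition_def point_chart lift_self)

section \<open>The zeroth order term and the associated connection\<close>

definition lichnerowicz_endo ::
    "('a \<Rightarrow> real ^ 'n \<Rightarrow> complex ^ 'k ^ 'k) \<Rightarrow> ('a \<Rightarrow> real ^ 'n \<Rightarrow> complex ^ 'k ^ 'k) \<Rightarrow> 'a \<Rightarrow> real ^ 'n \<Rightarrow> complex ^ 'k ^ 'k" where
  "lichnerowicz_endo \<Phi> \<Psi> a y = (scalar_curvature X a y / 4) *\<^sub>R mat 1
      + (1 / 4) *\<^sub>R (\<Sum>s\<in>UNIV. msq (gamma X s ** \<Phi> a y + \<Psi> a y ** gamma X s))
      + (1 / 2) *\<^sub>R (\<Sum>s\<in>UNIV. gamma X s ** endo_deriv X \<Phi> s a y - endo_deriv X \<Psi> s a y ** gamma X s)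
      + \<Psi> a y ** \<Phi> a y"

lemma dirac_pot_square:
  assumes "spinor_endo X \<Phi>" "spinor_endo X \<Psi>" "spinor_section X W \<psi>" "a \<in> index X" "y \<in> chart X a ` (chart_dom X a \<inter> W)"
  shows "dirac_pot \<Psi> (dirac_pot \<Phi> \<psi>) a y =
    - connection_laplacian X (twisted_form \<Phi> \<Psi>) \<psi> a y + lichnerowicz_endo \<Phi> \<Psi> a y *v \<psi> a y"
proof -
  have W: "open W" using assms(3) by (simp add: spinor_section_def)
  interpret A: spin_chart X a W by (rule spin_chartI[OF assms(4) W])
  note sm = A.smooth_section[OF assms(3) order_refl] A.smooth_endo[OF assms(1)] A.smooth_endo[OF assms(2)]
  have "dirac_pot \<Phi> \<psi> a = (\<lambda>z. A.dirac_loc (\<psi> a) z + \<Phi> a z *v \<psi> a z)"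
    by (simp add: fun_eq_iff dirac_pot_def A.dirac_eq_loc)
  then have "dirac_pot \<Psi> (dirac_pot \<Phi> \<psi>) a y =
      A.dirac_loc (\<lambda>z. A.dirac_loc (\<psi> a) z + \<Phi> a z *v \<psi> a z) y + \<Psi> a y *v (A.dirac_loc (\<psi> a) y + \<Phi> a y *v \<psi> a y)"
    by (simp add: dirac_pot_def[of \<Psi>] A.dirac_eq_loc)
  then show ?thesis
    unfolding A.lichnerowicz_potential[OF assms(5) sm]
      A.connection_laplacian_twisted_form[where \<psi> = \<psi> and \<Phi> = \<Phi> and \<Psi> = \<Psi>, OF assms(5) sm]
      lichnerowicz_endo_def A.endo_deriv_endo_nab .
qed

text \<open>On a section that is constant in a trivialization, the endomorphism is the sum of the
  composed operator and the Laplacian applied to it. Both terms are smooth and natural, and such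
  sections take every value.\<close>

lemma spinor_endo_lichnerowicz:
  assumes "spinor_endo X \<Phi>" "spinor_endo X \<Psi>"
  shows "spinor_endo X (lichnerowicz_endo \<Phi> \<Psi>)"
  unfolding spinor_endo_def
proof (intro conjI ballI)
  let ?R = "lichnerowicz_endo \<Phi> \<Psi>" and ?L = "\<lambda>\<psi>. dirac_pot \<Psi> (dirac_pot \<Phi> \<psi>)"
    and ?\<Delta> = "connection_laplacian X (twisted_form \<Phi> \<Psi>)"
  have test: "spinor_section X (chart_dom X b) (test_section b (\<lambda>_. 1) u)" if "b \<in> index X" for b u
    by (rule test_section[OF that smooth_on_const])
  have L: "spinor_section X W (?L \<psi>)" if "spinor_section X W \<psi>" for W \<psi>
    by (intro section_dirac_pot assms that)
  have R: "?R a y *v \<psi> a y = ?L \<psi> a y + ?\<Delta> \<psi> a y"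
    if "spinor_section X W \<psi>" "a \<in> index X" "y \<in> chart X a ` (chart_dom X a \<inter> W)" for W \<psi> a y
    using dirac_pot_square[OF assms that] by simp
  show "smooth_on (chart X a ` chart_dom X a) (?R a)" if a: "a \<in> index X" for a
  proof -
    interpret A: spin_chart X a "chart_dom X a" by (rule spin_chartI[OF a open_chart_dom[OF a]])
    \<comment> \<open>Smoothness is obtained column by column, from the test sections with constant
      value \<open>u\<close>.\<close>
    have col: "smooth_on A.U (\<lambda>y. ?R a y *v u)" for u
    proof (rule smooth_on_cong[OF A.open_U])
      let ?\<psi> = "test_section a (\<lambda>_. 1) u"
      show "smooth_on A.U (\<lambda>y. ?L ?\<psi> a y + ?\<Delta> ?\<psi> a y)"
        using A.smooth_section[OF L[OF test[OF a, of u]] order_refl]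
          A.smooth_connection_laplacian_twisted_form[where \<psi> = ?\<psi> and \<Phi> = \<Phi> and \<Psi> = \<Psi>,
            OF A.smooth_section[OF test[OF a, of u] order_refl] A.smooth_endo[OF assms(1)] A.smooth_endo[OF assms(2)]]
        by (intro smooth_intros A.open_U) simp_all
      show "?L ?\<psi> a y + ?\<Delta> ?\<psi> a y = ?R a y *v u" if y: "y \<in> A.U" for y
        using R[OF test[OF a, of u] a y] test_section_self[OF a, of y "\<lambda>_. 1" u] y by simp
    qed
    have "smooth_on A.U (\<lambda>y. \<chi> r s. (?R a y *v axis s 1) $ r)"
      by (intro smooth_intros A.open_U col)
    moreover have "(\<lambda>y. \<chi> r s. (?R a y *v axis s 1) $ r) = ?R a"
      by (simp add: fun_eq_iff vec_eq_iff matrix_vector_mult_def axis_nth mult_delta_right sum.delta)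
    ultimately show ?thesis by simp
  qed
  fix a b x assume a: "a \<in> index X" and b: "b \<in> index X" and x: "x \<in> chart_dom X a \<inter> chart_dom X b"
  have "(?R a (chart X a x) ** lift X a b x) *v u = (lift X a b x ** ?R b (chart X b x)) *v u" for u
  proof -
    let ?\<psi> = "test_section b (\<lambda>_. 1) u"
    have x': "x \<in> chart_dom X a \<inter> chart_dom X b \<inter> chart_dom X b" using x by blast
    have "?R a (chart X a x) *v ?\<psi> a (chart X a x) = ?L ?\<psi> a (chart X a x) + ?\<Delta> ?\<psi> a (chart X a x)"
      by (rule R[OF test[OF b] a]) (use x in blast)
    also have "?L ?\<psi> a (chart X a x) = lift X a b x *v ?L ?\<psi> b (chart X b x)"
      using L[OF test[OF b, of u]] a b x' unfolding spinor_section_def by blast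
    also have "?\<Delta> ?\<psi> a (chart X a x) = lift X a b x *v ?\<Delta> ?\<psi> b (chart X b x)"
      by (rule laplacian_transition[OF assms test[OF b] a b x'])
    also have "lift X a b x *v ?L ?\<psi> b (chart X b x) + lift X a b x *v ?\<Delta> ?\<psi> b (chart X b x) =
        lift X a b x *v (?R b (chart X b x) *v ?\<psi> b (chart X b x))"
      using R[OF test[OF b, of u] b, of "chart X b x"] x by (simp add: matrix_vector_distribs)
    finally have "?R a (chart X a x) *v ?\<psi> a (chart X a x) = lift X a b x *v (?R b (chart X b x) *v ?\<psi> b (chart X b x))" .
    moreover have "?\<psi> a (chart X a x) = lift X a b x *v u" "?\<psi> b (chart X b x) = u"
      using a b x by (auto simp: test_section_def point_chart lift_self)
    ultimately show ?thesis by (simp add: matrix_vector_mul_assoc)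
  qed
  then show "?R a (chart X a x) ** lift X a b x = lift X a b x ** ?R b (chart X b x)"
    by (simp add: matrix_eq)
qed

lemma associated_connection_twisted_form:
  assumes "spinor_endo X \<Phi>" "spinor_endo X \<Psi>"
  shows "associated_connection X (dirac_pot \<Psi> \<circ> dirac_pot \<Phi>) (twisted_form \<Phi> \<Psi>)"
  unfolding associated_connection_def
proof (intro conjI exI[of _ "\<lambda>a y. - lichnerowicz_endo \<Phi> \<Psi> a y"] allI impI ballI)
  show "spinor_connection X (twisted_form \<Phi> \<Psi>)" by (rule spinor_connection_twisted_form[OF assms])
  show "spinor_endo X (\<lambda>a y. - lichnerowicz_endo \<Phi> \<Psi> a y)"
    using spinor_endo_lichnerowicz[OF assms] unfolding spinor_endo_def
  proof (intro conjI ballI; elim conjE)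
    fix a assume a: "a \<in> index X" and sm: "\<forall>a\<in>index X. smooth_on (chart X a ` chart_dom X a) (lichnerowicz_endo \<Phi> \<Psi> a)"
    interpret A: spin_chart X a UNIV by (rule spin_chartI[OF a open_UNIV])
    show "smooth_on (chart X a ` chart_dom X a) (\<lambda>y. - lichnerowicz_endo \<Phi> \<Psi> a y)"
      using smooth_on_minus[OF A.open_U, of "lichnerowicz_endo \<Phi> \<Psi> a"] sm a by simp
  qed (simp add: matrix_mult_distribs)
  show "(dirac_pot \<Psi> \<circ> dirac_pot \<Phi>) \<psi> a y =
      - (connection_laplacian X (twisted_form \<Phi> \<Psi>) \<psi> a y + - lichnerowicz_endo \<Phi> \<Psi> a y *v \<psi> a y)"
    if "spinor_section X W \<psi>" "a \<in> index X" "y \<in> chart X a ` (chart_dom X a \<inter> W)" for W \<psi> a y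
    using dirac_pot_square[OF assms that] by (simp add: matrix_vector_distribs)
qed

text \<open>On a section that vanishes to first order like the \<open>k\<close>-th coordinate times
  \<open>u\<close>, the Laplacians of the two connections differ by twice the sum over j of g^kj
  (\<theta>_j - \<theta>'_j) u, while the operator is the same. The inverse metric is invertible and
  \<open>u\<close> is arbitrary.\<close>

lemma associated_connection_unique:
  assumes "associated_connection X L \<theta>" "associated_connection X L \<theta>'"
  shows "\<theta> = \<theta>'"
proof (intro ext)
  fix a j y0
  show "\<theta> a j y0 = \<theta>' a j y0"
  proof (cases "a \<in> index X \<and> y0 \<in> chart X a ` chart_dom X a")
    case False
    then show ?thesis
      using assms unfolding associated_connection_def spinor_connection_def by metis
  next
    case True
    then have a: "a \<in> index X" by blast
    interpret A: spin_chart X a "chart_dom X a" by (rule spin_chartI[OF a open_chart_dom[OF a]])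
    have y0: "y0 \<in> A.U" using True by simp
    \<comment> \<open>Vanishes at \<open>y0\<close>, which removes zeroth order terms there, and its
      differential is the \<open>k\<close>-th coordinate covector.\<close>
    define h where "h k z = z $ k - y0 $ k" for k :: 'n and z :: "real ^ 'n"
    define \<psi> where "\<psi> k u = test_section a (h k) u" for k u
    have sec: "spinor_section X (chart_dom X a) (\<psi> k u)" for k u
      unfolding \<psi>_def
    proof (rule test_section[OF a])
      fix d assume d: "d \<in> index X"
      interpret D: spin_chart X d "chart_dom X a" by (rule spin_chartI[OF d open_chart_dom[OF a]])
      have "smooth_on D.U (transition X d a)"
        using atlas a d unfolding oriented_atlas_def by blast
      then show "smooth_on D.U (\<lambda>z. h k (transition X d a z))"
        unfolding h_def by (intro smooth_intros D.open_U)
    qed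
    have \<psi>a: "\<psi> k u a z = h k z *\<^sub>R u" if "z \<in> A.U" for k u z
      unfolding \<psi>_def using test_section_self[OF a, of z "h k" u] that by simp
    have dh: "h k differentiable (at z)" and ddh: "dd (axis i 1) (h k) z = (if i = k then 1 else 0)" for i k z
    proof -
      have "(h k has_derivative (\<lambda>v. v $ k)) (at z)"
        unfolding h_def[abs_def] by (auto intro!: derivative_eq_intros bounded_linear_imp_has_derivative bounded_linear_vec_nth)
      then show "h k differentiable (at z)" "dd (axis i 1) (h k) z = (if i = k then 1 else 0)"
        by (auto simp: differentiable_def dd_has_derivative axis_nth)
    qed
    \<comment> \<open>Since \<open>h k\<close> vanishes at \<open>y0\<close>, one covariant
      derivative has to differentiate it and the connection form of the other acts on
      \<open>u\<close>: two terms, with \<open>i\<close> and \<open>j\<close> exchanged. The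
      Christoffel term does not involve the connection.\<close>
    have lap: "connection_laplacian X \<eta> (\<psi> k u) a y0 =
        (\<Sum>i\<in>UNIV. \<Sum>j\<in>UNIV. inv_metric X a y0 $ i $ j *\<^sub>R
          ((if i = k then \<eta> a j y0 *v u else 0) + (if j = k then \<eta> a i y0 *v u else 0) - christoffel X a k i j y0 *\<^sub>R u))"
      if "spinor_connection X \<eta>" for \<eta> k u
    proof -
      have d\<eta>: "\<eta> a j differentiable (at z)" if "z \<in> A.U" for j z
      proof -
        have "smooth_on (chart X a ` chart_dom X a) (\<eta> a j)"
          using \<open>spinor_connection X \<eta>\<close> a unfolding spinor_connection_def by blast
        then show ?thesis using that by (auto intro: smooth_on_differentiable)
      qed
      have cov1: "cov \<eta> a j (\<psi> k u a) z = (if j = k then u else 0) + h k z *\<^sub>R (\<eta> a j z *v u)" if "z \<in> A.U" for j z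
      proof -
        have "pd j (\<psi> k u a) z = dd (axis j 1) (\<lambda>z. h k z *\<^sub>R u) z"
          unfolding pd_eq_dd by (rule dd_cong[OF A.open_U that \<psi>a])
        then show ?thesis
          by (simp add: cov_def \<psi>a[OF that] dd_scaleR dh ddh matrix_vector_distribs)
      qed
      have cov2: "cov \<eta> a i (cov \<eta> a j (\<psi> k u a)) y0 = (if i = k then \<eta> a j y0 *v u else 0) + (if j = k then \<eta> a i y0 *v u else 0)" for i j
      proof -
        have dm: "(\<lambda>z. \<eta> a j z *v u) differentiable (at y0)"
          by (intro differentiable_matrix_vector_mult d\<eta> y0 differentiable_const)
        have "pd i (cov \<eta> a j (\<psi> k u a)) y0 = dd (axis i 1) (\<lambda>z. (if j = k then u else 0) + h k z *\<^sub>R (\<eta> a j z *v u)) y0"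
          unfolding pd_eq_dd by (rule dd_cong[OF A.open_U y0 cov1])
        also have "\<dots> = (if i = k then \<eta> a j y0 *v u else 0)"
          by (subst dd_add) (auto simp: dd_scaleR dh ddh dm h_def[of k y0]
              intro!: differentiable_scaleR_fun dh dm)
        finally show ?thesis
          by (simp add: cov_def[of \<eta> a i] cov1[OF y0] h_def)
      qed
      have "(\<Sum>l\<in>UNIV. christoffel X a l i j y0 *\<^sub>R cov \<eta> a l (\<psi> k u a) y0) = christoffel X a k i j y0 *\<^sub>R u" for i j
        by (simp add: cov1[OF y0] h_def if_distrib[of "\<lambda>v. _ *\<^sub>R v"] sum.delta cong: if_cong)
      then show ?thesis by (simp add: connection_laplacian_def cov2)
    qed
    have conn: "spinor_connection X \<theta>" "spinor_connection X \<theta>'"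
      using assms unfolding associated_connection_def by blast+
    have eq: "connection_laplacian X \<theta> (\<psi> k u) a y0 = connection_laplacian X \<theta>' (\<psi> k u) a y0" for k u
    proof -
      \<comment> \<open>Each connection comes with its own endomorphism \<open>E\<close>, but that
        acts on the value of the section at \<open>y0\<close>, which is zero.\<close>
      have *: "L (\<psi> k u) a y0 = - connection_laplacian X \<eta> (\<psi> k u) a y0" if ac: "associated_connection X L \<eta>" for \<eta>
      proof -
        obtain E where "\<And>W \<psi> a y. spinor_section X W \<psi> \<Longrightarrow> a \<in> index X \<Longrightarrow> y \<in> chart X a ` (chart_dom X a \<inter> W) \<Longrightarrow>
              L \<psi> a y = - (connection_laplacian X \<eta> \<psi> a y + E a y *v \<psi> a y)"
          using ac unfolding associated_connection_def by blast
        from this[OF sec a y0] show ?thesis by (simp add: \<psi>a[OF y0] h_def)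
      qed
      show ?thesis using *[OF assms(1)] *[OF assms(2)] by simp
    qed
    have "\<theta> a l y0 *v u = \<theta>' a l y0 *v u" for l u
    proof -
      define M where "M j = (\<theta> a j y0 - \<theta>' a j y0) *v u" for j
      have gsym: "inv_metric X a y0 $ i $ j = inv_metric X a y0 $ j $ i" for i j
        by (simp add: A.inv_metric_frame[OF y0] mult.commute)
      have zero: "(\<Sum>j\<in>UNIV. inv_metric X a y0 $ k $ j *\<^sub>R M j) = 0" for k
      proof -
        have "(\<Sum>i\<in>UNIV. \<Sum>j\<in>UNIV. inv_metric X a y0 $ i $ j *\<^sub>R ((if i = k then M j else 0) + (if j = k then M i else 0))) = 0"
        proof -
          have "(\<Sum>i\<in>UNIV. \<Sum>j\<in>UNIV. inv_metric X a y0 $ i $ j *\<^sub>R ((if i = k then M j else 0) + (if j = k then M i else 0))) =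
             connection_laplacian X \<theta> (\<psi> k u) a y0 - connection_laplacian X \<theta>' (\<psi> k u) a y0"
            unfolding lap[OF conn(1)] lap[OF conn(2)] sum_subtractf[symmetric] scaleR_diff_right[symmetric]
            by (intro sum.cong refl arg_cong2[of _ _ _ _ "(*\<^sub>R)"]) (simp add: M_def matrix_vector_distribs)
          then show ?thesis using eq by simp
        qed
        also have "(\<Sum>i\<in>UNIV. \<Sum>j\<in>UNIV. inv_metric X a y0 $ i $ j *\<^sub>R ((if i = k then M j else 0) + (if j = k then M i else 0))) =
            (\<Sum>i\<in>UNIV. \<Sum>j\<in>UNIV. if i = k then inv_metric X a y0 $ i $ j *\<^sub>R M j else 0) +
            (\<Sum>i\<in>UNIV. \<Sum>j\<in>UNIV. if j = k then inv_metric X a y0 $ i $ j *\<^sub>R M i else 0)"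
          unfolding sum.distrib[symmetric] by (intro sum.cong refl) (simp add: scaleR_add_right)
        also have "(\<Sum>i\<in>UNIV. \<Sum>j\<in>UNIV. if i = k then inv_metric X a y0 $ i $ j *\<^sub>R M j else 0) =
            (\<Sum>j\<in>UNIV. inv_metric X a y0 $ k $ j *\<^sub>R M j)"
          by (rule trans[OF sum.swap]) (simp add: sum.delta)
        also have "(\<Sum>i\<in>UNIV. \<Sum>j\<in>UNIV. if j = k then inv_metric X a y0 $ i $ j *\<^sub>R M i else 0) =
            (\<Sum>j\<in>UNIV. inv_metric X a y0 $ k $ j *\<^sub>R M j)"
          by (simp add: sum.delta gsym[of k])
        finally have "2 *\<^sub>R (\<Sum>j\<in>UNIV. inv_metric X a y0 $ k $ j *\<^sub>R M j) = 0"
          by (simp only: scaleR_2)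
        then show ?thesis by simp
      qed
      \<comment> \<open>Multiplying by the metric undoes the contraction with the inverse
        metric.\<close>
      have "M l = (\<Sum>j\<in>UNIV. (metric X a y0 ** inv_metric X a y0) $ l $ j *\<^sub>R M j)"
        by (simp add: A.inv_metric_mult[OF y0] mat_def if_distrib[of "\<lambda>r. r *\<^sub>R _"] sum.delta cong: if_cong)
      also have "\<dots> = (\<Sum>j\<in>UNIV. \<Sum>k\<in>UNIV. metric X a y0 $ l $ k *\<^sub>R (inv_metric X a y0 $ k $ j *\<^sub>R M j))"
        by (simp add: matrix_matrix_mult_def scaleR_sum_left)
      also have "\<dots> = (\<Sum>k\<in>UNIV. metric X a y0 $ l $ k *\<^sub>R (\<Sum>j\<in>UNIV. inv_metric X a y0 $ k $ j *\<^sub>R M j))"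
        unfolding scaleR_sum_right by (rule sum.swap)
      also have "\<dots> = 0" by (simp add: zero)
      finally show ?thesis by (simp add: M_def matrix_vector_distribs)
    qed
    then show ?thesis by (simp add: matrix_eq)
  qed
qed

end

section \<open>The Dirac-Witten potential\<close>

text \<open>A sum over ordered pairs refers to the order of the frame indices and is no trace. As an
  unrestricted double sum it becomes one and can be carried from one frame to another.\<close>

lemma sum_less_skew:
  fixes q :: "'n::{finite,linorder} \<Rightarrow> 'n \<Rightarrow> 'b::real_vector"
  assumes "\<And>u. q u u = 0" "\<And>u v. q u v = q v u"
  shows "(\<Sum>(u, v) | u < v. q u v) = (1 / 2) *\<^sub>R (\<Sum>u\<in>UNIV. \<Sum>v\<in>UNIV. q u v)"
proof -
  have ne: "u \<noteq> v" if "q u v \<noteq> 0" for u v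
    using that assms(1) by auto
  let ?A = "{(u, v). u < v} :: ('n \<times> 'n) set" and ?B = "{(u, v). v < u} :: ('n \<times> 'n) set"
  have "(\<Sum>u\<in>UNIV. \<Sum>v\<in>UNIV. q u v) = (\<Sum>(u, v)\<in>UNIV. q u v)"
    by (simp add: sum.cartesian_product)
  also have "\<dots> = (\<Sum>(u, v)\<in>?A \<union> ?B. q u v)"
    by (rule sum.mono_neutral_right) (auto dest: ne simp: neq_iff)
  also have "\<dots> = (\<Sum>(u, v)\<in>?A. q u v) + (\<Sum>(u, v)\<in>?B. q u v)"
    by (rule sum.union_disjoint) (auto intro: finite_subset[OF subset_UNIV])
  also have "(\<Sum>(u, v)\<in>?B. q u v) = (\<Sum>(u, v)\<in>?A. q u v)"
    by (rule sum.reindex_bij_witness[of _ prod.swap prod.swap]) (auto simp: assms(2))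
  finally show ?thesis by (simp flip: scaleR_2)
qed

context spin_chart begin

definition skew_part :: "('a \<Rightarrow> real ^ 'n \<Rightarrow> real ^ 'n ^ 'n) \<Rightarrow> real ^ 'n \<Rightarrow> real ^ 'n \<Rightarrow> real ^ 'n \<Rightarrow> real" where
  "skew_part p y v w = v \<bullet> (p a y *v w) - w \<bullet> (p a y *v v)"

lemma linear_skew_part: "linear (\<lambda>v. skew_part p y v w)" "linear (skew_part p y v)"
  by (auto intro!: linearI simp: skew_part_def matrix_vector_distribs inner_add_left inner_add_right algebra_simps)

end

context spin_transition begin

text \<open>Moving the lift across replaces the generators by Clifford multiplication with the frame
  of \<open>b\<close> carried back. Each of the two summations is a trace, so that frame is
  exchanged for the frame of \<open>a\<close> one index at a time.\<close>

lemma skew_sum_transition: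
  assumes "tensor02 X p" "y \<in> A.U"
  shows "(\<Sum>u\<in>UNIV. \<Sum>v\<in>UNIV. A.skew_part p y (frame X a u y) (frame X a v y) *\<^sub>R (gamma X u ** gamma X v)) ** G y =
    G y ** (\<Sum>u\<in>UNIV. \<Sum>v\<in>UNIV. B.skew_part p (\<phi> y) (frame X b u (\<phi> y)) (frame X b v (\<phi> y)) *\<^sub>R (gamma X u ** gamma X v))"
proof -
  let ?f = "\<lambda>s. dd (frame X b s (\<phi> y)) \<phi>' (\<phi> y)" and ?e = "\<lambda>s. frame X a s y"
  let ?q = "A.skew_part p y" and ?cl = "clifford X a y"
  note cl_lin = linear_add[OF A.linear_clifford] linear_scale[OF A.linear_clifford]
  note q_lin = linear_add[OF A.linear_skew_part(1)] linear_scale[OF A.linear_skew_part(1)]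
    linear_add[OF A.linear_skew_part(2)] linear_scale[OF A.linear_skew_part(2)]
  have q: "B.skew_part p (\<phi> y) (frame X b u (\<phi> y)) (frame X b v (\<phi> y)) = ?q (?f u) (?f v)" for u v
    by (simp add: A.skew_part_def B.skew_part_def tensor_transition[OF assms] J_inverse'[OF assms(2)])
  have cc: "G y ** (gamma X u ** gamma X v) = ?cl (?f u) ** ?cl (?f v) ** G y" for u v
  proof -
    have "G y ** (gamma X u ** gamma X v) = (G y ** gamma X u) ** gamma X v" by (simp add: matrix_mul_assoc)
    also have "\<dots> = ?cl (?f u) ** (G y ** gamma X v)"
      unfolding lift_props(2)[OF assms(2), of u] by (simp add: matrix_mul_assoc)
    finally show ?thesis
      unfolding lift_props(2)[OF assms(2), of v] by (simp add: matrix_mul_assoc)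
  qed
  have "G y ** (\<Sum>u\<in>UNIV. \<Sum>v\<in>UNIV. B.skew_part p (\<phi> y) (frame X b u (\<phi> y)) (frame X b v (\<phi> y)) *\<^sub>R (gamma X u ** gamma X v)) =
      (\<Sum>u\<in>UNIV. \<Sum>v\<in>UNIV. ?q (?f u) (?f v) *\<^sub>R (?cl (?f u) ** ?cl (?f v))) ** G y"
    by (simp add: matrix_mult_sums matrix_mult_distribs cc q)
  also have "(\<Sum>u\<in>UNIV. \<Sum>v\<in>UNIV. ?q (?f u) (?f v) *\<^sub>R (?cl (?f u) ** ?cl (?f v))) =
      (\<Sum>u\<in>UNIV. \<Sum>v\<in>UNIV. ?q (?f u) (?e v) *\<^sub>R (?cl (?f u) ** ?cl (?e v)))"
    by (intro sum.cong[OF refl] frame_trace[OF assms(2), where Q = "\<lambda>w w'. ?q (?f _) w *\<^sub>R (?cl (?f _) ** ?cl w')"] linearI)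
      (simp_all add: q_lin cl_lin matrix_mult_distribs scaleR_add_left scaleR_add_right)
  also have "\<dots> = (\<Sum>v\<in>UNIV. \<Sum>u\<in>UNIV. ?q (?f u) (?e v) *\<^sub>R (?cl (?f u) ** ?cl (?e v)))"
    by (rule sum.swap)
  also have "\<dots> = (\<Sum>v\<in>UNIV. \<Sum>u\<in>UNIV. ?q (?e u) (?e v) *\<^sub>R (?cl (?e u) ** ?cl (?e v)))"
    by (intro sum.cong[OF refl] frame_trace[OF assms(2), where Q = "\<lambda>w w'. ?q w (?e _) *\<^sub>R (?cl w' ** ?cl (?e _))"] linearI)
      (simp_all add: q_lin cl_lin matrix_mult_distribs scaleR_add_left scaleR_add_right)
  also have "\<dots> = (\<Sum>u\<in>UNIV. \<Sum>v\<in>UNIV. ?q (?e u) (?e v) *\<^sub>R (gamma X u ** gamma X v))"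
    by (subst sum.swap) (simp add: A.clifford_frame[OF assms(2)])
  finally show ?thesis ..
qed

end

text \<open>Off the diagonal both the coefficient and the product of two generators change sign when
  \<open>u\<close> and \<open>v\<close> are exchanged, so the summand is symmetric; on the diagonal
  the coefficient is zero.\<close>

lemma witten_endo_eq:
  fixes X :: "('a, 'm::topological_space, 'n::{finite,linorder}, 'k::finite) spin_mfd"
  assumes "spin_chart X a N"
  shows "witten_endo X p a y = (1 / 2) *\<^sub>R (\<Sum>u\<in>UNIV. \<Sum>v\<in>UNIV.
    spin_chart.skew_part a p y (frame X a u y) (frame X a v y) *\<^sub>R (gamma X u ** gamma X v))"
proof -
  interpret A: spin_chart X a N by (rule assms)
  have "A.skew_part p y (frame X a u y) (frame X a v y) *\<^sub>R (gamma X u ** gamma X v) =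
      A.skew_part p y (frame X a v y) (frame X a u y) *\<^sub>R (gamma X v ** gamma X u)" for u v
  proof (cases "u = v")
    case False
    then show ?thesis
      using A.c_swap[OF False] by (simp add: A.skew_part_def flip: scaleR_minus_left)
  qed simp
  then show ?thesis
    unfolding witten_endo_def frame_comp_def A.skew_part_def[symmetric]
    by (intro sum_less_skew) (simp_all add: A.skew_part_def)
qed

lemma cscale_mult: "(z *\<^sub>c A) ** B = z *\<^sub>c (A ** B)" "A ** (z *\<^sub>c B) = z *\<^sub>c (A ** B)"
  by (simp_all add: cscale_def matrix_matrix_mult_def vec_eq_iff sum_distrib_left mult_ac)

lemma mat_mult: "mat w ** A = w *\<^sub>c A" "A ** mat w = w *\<^sub>c A" for A :: "complex ^ 'k::finite ^ 'k"
  by (simp_all add: cscale_def matrix_matrix_mult_def mat_def vec_eq_iff mult_delta_left mult_delta_right sum.delta sum.delta' mult.commute)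

lemma spinor_endo_witten_pot:
  fixes X :: "('a, 'm::topological_space, 'n::{finite,linorder}, 'k::finite) spin_mfd"
  assumes "spin_manifold X" "tensor02 X p"
  shows "spinor_endo X (witten_pot X p z w)"
proof -
  interpret spin_manifold X by (rule assms)
  show ?thesis unfolding spinor_endo_def
  proof (intro conjI ballI)
    show "smooth_on (chart X a ` chart_dom X a) (witten_pot X p z w a)" if a: "a \<in> index X" for a
    proof -
      interpret A: spin_chart X a UNIV by (rule spin_chartI[OF a open_UNIV])
      have sp: "smooth_on A.U (p a)" using assms(2) a by (simp add: tensor02_def)
      have "smooth_on A.U (\<lambda>y. witten_pot X p z w a y)"
        unfolding witten_pot_def witten_endo_def frame_comp_def case_prod_unfold
        by (intro smooth_intros A.open_U A.smooth_frame sp)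
      then show ?thesis by simp
    qed
    fix a b x assume a: "a \<in> index X" and b: "b \<in> index X" and x: "x \<in> chart_dom X a \<inter> chart_dom X b"
    interpret T: spin_transition X a b "chart_dom X a \<inter> chart_dom X b"
      by (rule spin_transitionI[OF a b]) (auto intro: open_chart_dom a b)
    have y: "chart X a x \<in> T.A.U" using x by blast
    have p: "point X a (chart X a x) = x" using point_chart[OF a] x by auto
    have t: "transition X a b (chart X a x) = chart X b x" by (simp add: transition_def p)
    have "witten_endo X p a (chart X a x) ** lift X a b x = lift X a b x ** witten_endo X p b (chart X b x)"
      unfolding witten_endo_eq[OF T.A.spin_chart_axioms] witten_endo_eq[OF T.B.spin_chart_axioms]
      using T.skew_sum_transition[OF assms(2) y] by (simp add: p t matrix_mult_distribs)
    then show "witten_pot X p z w a (chart X a x) ** lift X a b x = lift X a b x ** witten_pot X p z w b (chart X b x)"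
      by (simp add: witten_pot_def matrix_mult_distribs cscale_mult mat_mult)
  qed
qed

text \<open>Scalars commute with P, so the mixed terms merge. The conjugated parameters of the
  second operator give the coefficient \<open>f1 * cnj f2 - cnj f1 * f2\<close>.\<close>

lemma witten_pot_mult:
  "witten_pot X p z' w' a y ** witten_pot X p z w a y =
    (z' * z) *\<^sub>c msq (witten_endo X p a y) + (z' * w + w' * z) *\<^sub>c witten_endo X p a y + mat (w' * w)"
  by (simp add: witten_pot_def matrix_mult_distribs cscale_mult mat_mult msq_def)
    (simp add: cscale_def vec_eq_iff mat_def algebra_simps)

lemma cscale_of_real: "complex_of_real r *\<^sub>c A = r *\<^sub>R A"
  by (simp add: cscale_def vec_eq_iff flip: scaleR_conv_of_real)

lemma mat_of_real: "mat (complex_of_real r) = r *\<^sub>R mat 1"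
  by (simp add: mat_def vec_eq_iff of_real_def)

theorem theorem2p1:
  fixes X :: "('a, 'm::t2_space, 'n::{finite,linorder}, 'k::finite) spin_mfd"
    and p :: "'a \<Rightarrow> real ^ 'n::{finite,linorder} \<Rightarrow> real ^ 'n::{finite,linorder} ^ 'n::{finite,linorder}"
    and f1 f2 :: complex
  assumes "CARD('n) \<ge> 3"
    and "compact_oriented_spin_manifold X"
    and "tensor02 X p"
  defines "c \<equiv> gamma X"
    and "P \<equiv> witten_endo X p"
    and "\<Phi> \<equiv> witten_pot X p f1 f2"
    and "\<Psi> \<equiv> witten_pot X p (- cnj f1) (cnj f2)"
    and "D1 \<equiv> dirac_witten X p f1 f2"
    and "D2 \<equiv> dirac_witten X p (- cnj f1) (cnj f2)"
  shows "(\<exists>!\<theta>. associated_connection X (D2 \<circ> D1) \<theta>) \<and>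
    (\<forall>\<theta>. associated_connection X (D2 \<circ> D1) \<theta> \<longrightarrow>
      (\<forall>W \<psi>. spinor_section X W \<psi> \<longrightarrow>
        (\<forall>a\<in>index X. \<forall>y\<in>chart X a ` (chart_dom X a \<inter> W).
          D2 (D1 \<psi>) a y = - connection_laplacian X \<theta> \<psi> a y +
            (mat (complex_of_real (scalar_curvature X a y / 4))
             + (f1 * cnj f2 - cnj f1 * f2) *\<^sub>c P a y
             + (1 / 4) *\<^sub>c (\<Sum>i\<in>UNIV. msq (c i ** \<Phi> a y + \<Psi> a y ** c i))
             + (1 / 2) *\<^sub>c (\<Sum>j\<in>UNIV. c j ** endo_deriv X \<Phi> j a y - endo_deriv X \<Psi> j a y ** c j)
             - (f1 * cnj f1) *\<^sub>c msq (P a y)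
             + mat (f2 * cnj f2)) *v \<psi> a y))) \<and>
    (\<exists>!\<theta>. associated_connection X (D1 \<circ> D1) \<theta>) \<and>
    (\<forall>\<theta>. associated_connection X (D1 \<circ> D1) \<theta> \<longrightarrow>
      (\<forall>W \<psi>. spinor_section X W \<psi> \<longrightarrow>
        (\<forall>a\<in>index X. \<forall>y\<in>chart X a ` (chart_dom X a \<inter> W).
          D1 (D1 \<psi>) a y = - connection_laplacian X \<theta> \<psi> a y +
            (mat (complex_of_real (scalar_curvature X a y / 4))
             + f1\<^sup>2 *\<^sub>c msq (P a y)
             + (1 / 4) *\<^sub>c (\<Sum>i\<in>UNIV. msq (c i ** \<Phi> a y + \<Phi> a y ** c i))
             - (1 / 2) *\<^sub>c (\<Sum>j\<in>UNIV. endo_deriv X \<Phi> j a y ** c j - c j ** endo_deriv X \<Phi> j a y)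
             + (2 * f1 * f2) *\<^sub>c P a y
             + mat (f2\<^sup>2)) *v \<psi> a y)))"
proof -
  have X: "spin_manifold X"
    using assms(2) by unfold_locales (auto simp: compact_oriented_spin_manifold_def)
  interpret spin_manifold X by (rule X)
  have endo: "spinor_endo X \<Phi>" "spinor_endo X \<Psi>"
    unfolding \<Phi>_def \<Psi>_def by (rule spinor_endo_witten_pot[OF X assms(3)])+
  have D: "D1 = dirac_pot \<Phi>" "D2 = dirac_pot \<Psi>"
    by (simp_all add: fun_eq_iff D1_def D2_def \<Phi>_def \<Psi>_def dirac_witten_def dirac_pot_def)
  have quarter: "(1 / 4) *\<^sub>c A = (1 / 4) *\<^sub>R A" and half: "(1 / 2) *\<^sub>c A = (1 / 2) *\<^sub>R A" for A :: "complex ^ 'k ^ 'k"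
    using cscale_of_real[of "1 / 4" A] cscale_of_real[of "1 / 2" A] by simp_all
  \<comment> \<open>Both products are instances: \<open>A\<close> is \<Phi> throughout, and
    \<open>B\<close> is \<Psi> for the first product and \<Phi> for the second.\<close>
  have exists_unique: "\<exists>!\<theta>. associated_connection X (dirac_pot B \<circ> dirac_pot A) \<theta>"
    and unique: "associated_connection X (dirac_pot B \<circ> dirac_pot A) \<theta> \<Longrightarrow> \<theta> = twisted_form A B"
    if "spinor_endo X A" "spinor_endo X B" for A B \<theta>
    using associated_connection_twisted_form[OF that] associated_connection_unique by blast+
  have endo1: "lichnerowicz_endo \<Phi> \<Psi> a y = mat (complex_of_real (scalar_curvature X a y / 4))
             + (f1 * cnj f2 - cnj f1 * f2) *\<^sub>c P a y
             + (1 / 4) *\<^sub>c (\<Sum>i\<in>UNIV. msq (c i ** \<Phi> a y + \<Psi> a y ** c i))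
             + (1 / 2) *\<^sub>c (\<Sum>j\<in>UNIV. c j ** endo_deriv X \<Phi> j a y - endo_deriv X \<Psi> j a y ** c j)
             - (f1 * cnj f1) *\<^sub>c msq (P a y)
             + mat (f2 * cnj f2)" for a y
  proof -
    have "\<Psi> a y ** \<Phi> a y = (f1 * cnj f2 - cnj f1 * f2) *\<^sub>c P a y - (f1 * cnj f1) *\<^sub>c msq (P a y) + mat (f2 * cnj f2)"
      unfolding \<Phi>_def \<Psi>_def witten_pot_mult P_def by (simp add: cscale_def vec_eq_iff mat_def algebra_simps)
    then show ?thesis
      unfolding lichnerowicz_endo_def quarter half mat_of_real c_def by (simp add: add_ac)
  qed
  have endo2: "lichnerowicz_endo \<Phi> \<Phi> a y = mat (complex_of_real (scalar_curvature X a y / 4))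
             + f1\<^sup>2 *\<^sub>c msq (P a y)
             + (1 / 4) *\<^sub>c (\<Sum>i\<in>UNIV. msq (c i ** \<Phi> a y + \<Phi> a y ** c i))
             - (1 / 2) *\<^sub>c (\<Sum>j\<in>UNIV. endo_deriv X \<Phi> j a y ** c j - c j ** endo_deriv X \<Phi> j a y)
             + (2 * f1 * f2) *\<^sub>c P a y
             + mat (f2\<^sup>2)" for a y
  proof -
    have 1: "\<Phi> a y ** \<Phi> a y = f1\<^sup>2 *\<^sub>c msq (P a y) + (2 * f1 * f2) *\<^sub>c P a y + mat (f2\<^sup>2)"
      unfolding \<Phi>_def witten_pot_mult P_def by (simp add: cscale_def vec_eq_iff mat_def algebra_simps power2_eq_square)
    have 2: "(\<Sum>j\<in>UNIV. endo_deriv X \<Phi> j a y ** c j - c j ** endo_deriv X \<Phi> j a y) =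
        - (\<Sum>j\<in>UNIV. c j ** endo_deriv X \<Phi> j a y - endo_deriv X \<Phi> j a y ** c j)"
      by (simp add: sum_subtractf)
    show ?thesis
      unfolding lichnerowicz_endo_def quarter half mat_of_real 1 2 unfolding c_def by (simp add: add_ac)
  qed
  \<comment> \<open>The given connection is arbitrary; uniqueness identifies it with
    \<open>twisted_form A B\<close>, for which the formula is established.\<close>
  have formula: "dirac_pot B (dirac_pot A \<psi>) a y = - connection_laplacian X \<theta> \<psi> a y + lichnerowicz_endo A B a y *v \<psi> a y"
    if "spinor_endo X A" "spinor_endo X B" "associated_connection X (dirac_pot B \<circ> dirac_pot A) \<theta>"
      "spinor_section X W \<psi>" "a \<in> index X" "y \<in> chart X a ` (chart_dom X a \<inter> W)" for A B \<theta> W \<psi> a y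
    using dirac_pot_square[OF that(1,2,4,5,6)] unique[OF that(1,2,3)] by simp
  show ?thesis
    unfolding D endo1[symmetric] endo2[symmetric]
    by (intro conjI allI impI ballI exists_unique endo) (rule formula; (rule endo | assumption))+
qed

end
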